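(* For all mean-payoff games $\mathcal{G}$ and all vertices $v\in V$, the value $\mathsf{ASV}(v)$ can be effectively expressed by a formula $\rho_v$ in the theory $\langle\mathbb{R},+,\le\rangle$ and explicitly computed from this formula. That is, there is an algorithm which, given $\mathcal{G}$ and $v$, constructs a formula $\rho_v(z)$ of $\langle\mathbb{R},+,\le\rangle$ with one free variable $z$ such that for every real $z$, $\rho_v(z)$ is true if and only if $\mathsf{ASV}(v)=z$; and the value $\mathsf{ASV}(v)$ can be computed from $\rho_v$.
   Context: A (bi-weighted) arena $\mathcal{A}=(V,E,\langle V_0,V_1\rangle,w_0,w_1)$ consists of a finite set $V$ of vertices, a set $E\subseteq V\times V$ of edges such that every vertex has at least one outgoing edge, a partition $\langle V_0,V_1\rangle$ of $V$ ($V_i$ is owned by Player $i$), and two weight functions $w_0,w_1:E\to\mathbb{Z}$. A play is an infinite path $\pi=\pi_0\pi_1\dots$ of the arena; a history is a non-empty finite prefix of a play; $w_i(h)$ is the sum of the $w_i$-weights of the edges of a history $h$. Mean-payoff game: the payoff of Player $i\in\{0,1\}$ for a play $\pi$ is $\underline{\mathsf{MP}}_i(\pi)=\liminf_{k\to\infty}\frac1k w_i(\pi_0\dots\pi_k)$. A strategy of Player $i$ is a function mapping each history ending in a vertex $u\in V_i$ to a successor of $u$; $\Sigma_i$ is the set of all strategies of Player $i$. For $v\in V$, $\mathsf{Out}_v(\sigma_0,\sigma_1)$ is the unique play starting in $v$ in which both players follow their strategies. For $\epsilon\ge0$, $\mathsf{BR}_1^{\epsilon}(\sigma_0)=\{\sigma_1\in\Sigma_1\mid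 \forall v\in V\ \forall\sigma_1'\in\Sigma_1:\ \underline{\mathsf{MP}}_1(\mathsf{Out}_v(\sigma_0,\sigma_1))\ge\underline{\mathsf{MP}}_1(\mathsf{Out}_v(\sigma_0,\sigma_1'))-\epsilon\}$. Adversarial Stackelberg value: $\mathsf{ASV}(\sigma_0)(v)=\sup_{\epsilon\ge0,\ \mathsf{BR}_1^{\epsilon}(\sigma_0)\ne\varnothing}\ \inf_{\sigma_1\in\mathsf{BR}_1^{\epsilon}(\sigma_0)}\underline{\mathsf{MP}}_0(\mathsf{Out}_v(\sigma_0,\sigma_1))$ and $\mathsf{ASV}(v)=\sup_{\sigma_0\in\Sigma_0}\mathsf{ASV}(\sigma_0)(v)$. $\langle\mathbb{R},+,\le\rangle$ denotes the first-order theory of the reals with addition and order (with rational constants allowed), which is decidable and admits effective quantifier elimination. *)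

theory Defs
  imports "HOL-Library.Extended_Real" "HOL-Library.Liminf_Limsup" "HOL-Library.Nat_Bijection"
begin

section \<open>Bi-weighted arenas and mean-payoff games\<close>

record 'v arena =
  verts :: "'v set"
  edges :: "('v \<times> 'v) set"
  owned0 :: "'v set"
  owned1 :: "'v set"
  weight0 :: "'v \<times> 'v \<Rightarrow> int"
  weight1 :: "'v \<times> 'v \<Rightarrow> int"

definition arena :: "'v arena \<Rightarrow> bool" where
  "arena G \<longleftrightarrow>
     finite (verts G) \<and>
     edges G \<subseteq> verts G \<times> verts G \<and>
     (\<forall>u\<in>verts G. \<exists>u'. (u, u') \<in> edges G) \<and>
     owned0 G \<inter> owned1 G = {} \<and> owned0 G \<union> owned1 G = verts G"

definition play :: "'v arena \<Rightarrow> (nat \<Rightarrow> 'v) \<Rightarrow> bool" where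
  "play G \<pi> \<longleftrightarrow> (\<forall>k. (\<pi> k, \<pi> (Suc k)) \<in> edges G)"

text \<open>The prefix \<open>\<pi>\<^sub>0 \<dots> \<pi>\<^sub>k\<close>, which has \<open>k + 1\<close> vertices and \<open>k\<close> edges.\<close>

definition play_prefix :: "(nat \<Rightarrow> 'v) \<Rightarrow> nat \<Rightarrow> 'v list" where
  "play_prefix \<pi> k = map \<pi> [0..<Suc k]"

definition history :: "'v arena \<Rightarrow> 'v list \<Rightarrow> bool" where
  "history G h \<longleftrightarrow> (\<exists>\<pi> k. play G \<pi> \<and> h = play_prefix \<pi> k)"

definition history_weight :: "('v \<times> 'v \<Rightarrow> int) \<Rightarrow> 'v list \<Rightarrow> int" where
  "history_weight w h = (\<Sum>j<length h - 1. w (h ! j, h ! Suc j))"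

definition mean_payoff :: "('v \<times> 'v \<Rightarrow> int) \<Rightarrow> (nat \<Rightarrow> 'v) \<Rightarrow> ereal" where
  "mean_payoff w \<pi> =
     liminf (\<lambda>k. ereal (real_of_int (history_weight w (play_prefix \<pi> k)) / real k))"

text \<open>\<open>U\<close> is the set of vertices owned by the player. Values of a strategy on lists that are not
  histories ending in \<open>U\<close> are unconstrained and are never consulted.\<close>

definition strategies :: "'v arena \<Rightarrow> 'v set \<Rightarrow> ('v list \<Rightarrow> 'v) set" where
  "strategies G U = {\<sigma>. \<forall>h. history G h \<and> last h \<in> U \<longrightarrow> (last h, \<sigma> h) \<in> edges G}"

definition follows :: "'v set \<Rightarrow> ('v list \<Rightarrow> 'v) \<Rightarrow> (nat \<Rightarrow> 'v) \<Rightarrow> bool" where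
  "follows U \<sigma> \<pi> \<longleftrightarrow> (\<forall>k. \<pi> k \<in> U \<longrightarrow> \<pi> (Suc k) = \<sigma> (play_prefix \<pi> k))"

definition outcome ::
  "'v arena \<Rightarrow> 'v \<Rightarrow> ('v list \<Rightarrow> 'v) \<Rightarrow> ('v list \<Rightarrow> 'v) \<Rightarrow> nat \<Rightarrow> 'v" where
  "outcome G v \<sigma>0 \<sigma>1 =
     (THE \<pi>. play G \<pi> \<and> \<pi> 0 = v \<and> follows (owned0 G) \<sigma>0 \<pi> \<and> follows (owned1 G) \<sigma>1 \<pi>)"

definition best_responses ::
  "'v arena \<Rightarrow> real \<Rightarrow> ('v list \<Rightarrow> 'v) \<Rightarrow> ('v list \<Rightarrow> 'v) set" where
  "best_responses G \<epsilon> \<sigma>0 =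
     {\<sigma>1 \<in> strategies G (owned1 G). \<forall>v\<in>verts G. \<forall>\<sigma>1'\<in>strategies G (owned1 G).
        mean_payoff (weight1 G) (outcome G v \<sigma>0 \<sigma>1)
          \<ge> mean_payoff (weight1 G) (outcome G v \<sigma>0 \<sigma>1') - ereal \<epsilon>}"

definition ASV_of :: "'v arena \<Rightarrow> ('v list \<Rightarrow> 'v) \<Rightarrow> 'v \<Rightarrow> ereal" where
  "ASV_of G \<sigma>0 v =
     (SUP \<epsilon>\<in>{\<epsilon>. \<epsilon> \<ge> 0 \<and> best_responses G \<epsilon> \<sigma>0 \<noteq> {}}.
        INF \<sigma>1\<in>best_responses G \<epsilon> \<sigma>0. mean_payoff (weight0 G) (outcome G v \<sigma>0 \<sigma>1))"

definition ASV :: "'v arena \<Rightarrow> 'v \<Rightarrow> ereal" where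
  "ASV G v = (SUP \<sigma>0\<in>strategies G (owned0 G). ASV_of G \<sigma>0 v)"

text \<open>The description in \<open>outcome\<close> is satisfied by exactly one sequence.\<close>

lemma outcome_unique:
  assumes G: "arena G" and v: "v \<in> verts G"
    and s0: "\<sigma>0 \<in> strategies G (owned0 G)" and s1: "\<sigma>1 \<in> strategies G (owned1 G)"
  shows "\<exists>!\<pi>. play G \<pi> \<and> \<pi> 0 = v \<and> follows (owned0 G) \<sigma>0 \<pi> \<and> follows (owned1 G) \<sigma>1 \<pi>"
proof -
  define step where "step = (\<lambda>h. if last h \<in> owned0 G then \<sigma>0 h else \<sigma>1 h)"
  define H where "H = rec_nat [v] (\<lambda>_ h. h @ [step h])"
  define \<pi> where "\<pi> = (\<lambda>k. last (H k))"
  have H0: "H 0 = [v]" and HS: "\<And>k. H (Suc k) = H k @ [step (H k)]"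
    by (simp_all add: H_def)
  have pre: "play_prefix \<pi> k = H k" for k
  proof (induction k)
    case 0
    show ?case by (simp add: play_prefix_def \<pi>_def H0)
  next
    case (Suc k)
    have "play_prefix \<pi> (Suc k) = play_prefix \<pi> k @ [\<pi> (Suc k)]"
      by (simp add: play_prefix_def)
    then show ?case using Suc by (simp add: \<pi>_def HS)
  qed
  have \<pi>S: "\<pi> (Suc k) = step (play_prefix \<pi> k)" for k
    by (simp add: pre) (simp add: \<pi>_def HS)
  have lastp: "last (play_prefix \<rho> k) = \<rho> k" for \<rho> :: "nat \<Rightarrow> 'a" and k
    by (simp add: play_prefix_def)
  have hist: "history G (play_prefix \<rho> k)"
    if "\<rho> k \<in> verts G" "\<forall>j<k. (\<rho> j, \<rho> (Suc j)) \<in> edges G" for \<rho> k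
  proof -
    define nx where "nx = (\<lambda>u. SOME u'. (u, u') \<in> edges G)"
    have nx: "(u, nx u) \<in> edges G" if "u \<in> verts G" for u
      using G that unfolding arena_def nx_def by (metis someI_ex)
    define \<tau> where "\<tau> = (\<lambda>j. if j \<le> k then \<rho> j else (nx ^^ (j - k)) (\<rho> k))"
    have iter: "(nx ^^ j) (\<rho> k) \<in> verts G" for j
    proof (induction j)
      case 0
      show ?case using that(1) by simp
    next
      case (Suc j)
      then show ?case using nx G unfolding arena_def by fastforce
    qed
    have "(\<tau> j, \<tau> (Suc j)) \<in> edges G" for j
    proof (cases "j < k")
      case True
      then show ?thesis using that(2) by (simp add: \<tau>_def)
    next
      case False
      then have t: "\<tau> j = (nx ^^ (j - k)) (\<rho> k)" by (auto simp: \<tau>_def)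
      have "\<tau> (Suc j) = nx (\<tau> j)"
        using False t by (simp add: \<tau>_def Suc_diff_le)
      then show ?thesis using nx[OF iter[of "j - k"]] t by simp
    qed
    then have "play G \<tau>" by (simp add: play_def)
    moreover have "play_prefix \<rho> k = play_prefix \<tau> k"
      by (auto simp: play_prefix_def \<tau>_def)
    ultimately show ?thesis unfolding history_def by blast
  qed
  have edge: "\<pi> k \<in> verts G \<and> (\<pi> k, \<pi> (Suc k)) \<in> edges G" for k
  proof (induction k rule: less_induct)
    case (less k)
    have vk: "\<pi> k \<in> verts G"
    proof (cases k)
      case 0
      then show ?thesis using v by (simp add: \<pi>_def H0)
    next
      case (Suc m)
      then have "(\<pi> m, \<pi> k) \<in> edges G" using less[of m] by simp
      then show ?thesis using G by (auto simp: arena_def)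
    qed
    then have h: "history G (play_prefix \<pi> k)" using hist less by simp
    have "(\<pi> k, step (play_prefix \<pi> k)) \<in> edges G"
    proof (cases "\<pi> k \<in> owned0 G")
      case True
      then show ?thesis using s0 h by (auto simp: strategies_def step_def lastp dest!: spec)
    next
      case False
      then have "\<pi> k \<in> owned1 G" using G vk by (auto simp: arena_def)
      then show ?thesis using s1 h False
        by (auto simp: strategies_def step_def lastp dest!: spec)
    qed
    then show ?case using vk \<pi>S by simp
  qed
  show ?thesis
  proof (rule ex1I[of _ \<pi>])
    show "play G \<pi> \<and> \<pi> 0 = v \<and> follows (owned0 G) \<sigma>0 \<pi> \<and> follows (owned1 G) \<sigma>1 \<pi>"
      using edge G
      by (auto simp: play_def follows_def \<pi>S step_def lastp arena_def)
        (auto simp: \<pi>_def H0)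
  next
    fix \<rho>
    assume \<rho>: "play G \<rho> \<and> \<rho> 0 = v \<and> follows (owned0 G) \<sigma>0 \<rho> \<and> follows (owned1 G) \<sigma>1 \<rho>"
    have \<rho>S: "\<rho> (Suc k) = step (play_prefix \<rho> k)" for k
    proof -
      have "\<rho> k \<in> verts G" using \<rho> G by (auto simp: play_def arena_def)
      then show ?thesis using \<rho> G by (auto simp: follows_def step_def lastp arena_def)
    qed
    have "play_prefix \<rho> k = H k" for k
    proof (induction k)
      case 0
      show ?case using \<rho> by (simp add: play_prefix_def H0)
    next
      case (Suc k)
      have "play_prefix \<rho> (Suc k) = play_prefix \<rho> k @ [\<rho> (Suc k)]"
        by (simp add: play_prefix_def)
      then show ?case using Suc \<rho>S by (simp add: HS)
    qed
    then show "\<rho> = \<pi>" by (metis pre lastp ext)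
  qed
qed


section \<open>First-order formulas over the reals with addition and order\<close>

datatype tm = Var nat | Const rat | Add tm tm

datatype fm =
    FLe tm tm
  | FEq tm tm
  | FNot fm
  | FAnd fm fm
  | FOr fm fm
  | FEx nat fm
  | FAll nat fm

fun tm_val :: "(nat \<Rightarrow> real) \<Rightarrow> tm \<Rightarrow> real" where
  "tm_val e (Var x) = e x"
| "tm_val e (Const q) = of_rat q"
| "tm_val e (Add s t) = tm_val e s + tm_val e t"

fun sat :: "(nat \<Rightarrow> real) \<Rightarrow> fm \<Rightarrow> bool" where
  "sat e (FLe s t) \<longleftrightarrow> tm_val e s \<le> tm_val e t"
| "sat e (FEq s t) \<longleftrightarrow> tm_val e s = tm_val e t"
| "sat e (FNot \<phi>) \<longleftrightarrow> \<not> sat e \<phi>"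
| "sat e (FAnd \<phi> \<psi>) \<longleftrightarrow> sat e \<phi> \<and> sat e \<psi>"
| "sat e (FOr \<phi> \<psi>) \<longleftrightarrow> sat e \<phi> \<or> sat e \<psi>"
| "sat e (FEx x \<phi>) \<longleftrightarrow> (\<exists>r. sat (e(x := r)) \<phi>)"
| "sat e (FAll x \<phi>) \<longleftrightarrow> (\<forall>r. sat (e(x := r)) \<phi>)"

fun tm_vars :: "tm \<Rightarrow> nat set" where
  "tm_vars (Var x) = {x}"
| "tm_vars (Const q) = {}"
| "tm_vars (Add s t) = tm_vars s \<union> tm_vars t"

fun free_vars :: "fm \<Rightarrow> nat set" where
  "free_vars (FLe s t) = tm_vars s \<union> tm_vars t"
| "free_vars (FEq s t) = tm_vars s \<union> tm_vars t"
| "free_vars (FNot \<phi>) = free_vars \<phi>"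
| "free_vars (FAnd \<phi> \<psi>) = free_vars \<phi> \<union> free_vars \<psi>"
| "free_vars (FOr \<phi> \<psi>) = free_vars \<phi> \<union> free_vars \<psi>"
| "free_vars (FEx x \<phi>) = free_vars \<phi> - {x}"
| "free_vars (FAll x \<phi>) = free_vars \<phi> - {x}"


section \<open>Algorithms\<close>

text \<open>The total recursive functions on the natural numbers. Several arguments are packed into one
  with the Cantor pairing function. Minimisation is only applied to functions for which the search
  succeeds on every input; by Kleene's normal form theorem this yields exactly the total
  computable functions.\<close>

inductive total_recursive :: "(nat \<Rightarrow> nat) \<Rightarrow> bool" where
  zero: "total_recursive (\<lambda>_. 0)"
| suc: "total_recursive Suc"
| left: "total_recursive (\<lambda>n. fst (prod_decode n))"
| right: "total_recursive (\<lambda>n. snd (prod_decode n))"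
| pair: "total_recursive f \<Longrightarrow> total_recursive g \<Longrightarrow>
    total_recursive (\<lambda>n. prod_encode (f n, g n))"
| comp: "total_recursive f \<Longrightarrow> total_recursive g \<Longrightarrow> total_recursive (\<lambda>n. f (g n))"
| prim_rec: "total_recursive f \<Longrightarrow> total_recursive g \<Longrightarrow>
    total_recursive (\<lambda>n. rec_nat (f (fst (prod_decode n)))
      (\<lambda>k r. g (prod_encode (fst (prod_decode n), prod_encode (k, r)))) (snd (prod_decode n)))"
| minimise: "total_recursive f \<Longrightarrow> (\<And>n. \<exists>m. f (prod_encode (n, m)) = 0) \<Longrightarrow>
    total_recursive (\<lambda>n. LEAST m. f (prod_encode (n, m)) = 0)"


section \<open>Encoding of inputs and outputs\<close>

text \<open>A rational is coded by its numerator and denominator in lowest terms.\<close>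

definition rat_code :: "rat \<Rightarrow> nat" where
  "rat_code q = prod_encode (int_encode (fst (quotient_of q)), nat (snd (quotient_of q)))"

fun tm_code :: "tm \<Rightarrow> nat" where
  "tm_code (Var x) = prod_encode (0, x)"
| "tm_code (Const q) = prod_encode (1, rat_code q)"
| "tm_code (Add s t) = prod_encode (2, prod_encode (tm_code s, tm_code t))"

fun fm_code :: "fm \<Rightarrow> nat" where
  "fm_code (FLe s t) = prod_encode (0, prod_encode (tm_code s, tm_code t))"
| "fm_code (FEq s t) = prod_encode (1, prod_encode (tm_code s, tm_code t))"
| "fm_code (FNot \<phi>) = prod_encode (2, fm_code \<phi>)"
| "fm_code (FAnd \<phi> \<psi>) = prod_encode (3, prod_encode (fm_code \<phi>, fm_code \<psi>))"
| "fm_code (FOr \<phi> \<psi>) = prod_encode (4, prod_encode (fm_code \<phi>, fm_code \<psi>))"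
| "fm_code (FEx x \<phi>) = prod_encode (5, prod_encode (x, fm_code \<phi>))"
| "fm_code (FAll x \<phi>) = prod_encode (6, prod_encode (x, fm_code \<phi>))"

text \<open>The codes determine the coded rationals, terms and formulas.\<close>

lemma rat_code_inject: "rat_code p = rat_code q \<longleftrightarrow> p = q"
proof
  assume "rat_code p = rat_code q"
  moreover have "snd (quotient_of p) > 0" "snd (quotient_of q) > 0"
    by (simp_all add: quotient_of_denom_pos')
  ultimately have "quotient_of p = quotient_of q"
    by (simp add: rat_code_def prod_eq_iff inj_eq[OF inj_int_encode] eq_nat_nat_iff)
  then show "p = q" by (simp add: quotient_of_inject)
qed simp

lemma tm_code_inject: "tm_code s = tm_code t \<longleftrightarrow> s = t"
proof (induction s arbitrary: t)
  case (Var x)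
  show ?case by (cases t) auto
next
  case (Const q)
  show ?case by (cases t) (auto simp: rat_code_inject)
next
  case (Add s1 s2)
  then show ?case by (cases t) auto
qed

lemma fm_code_inject: "fm_code \<phi> = fm_code \<psi> \<longleftrightarrow> \<phi> = \<psi>"
proof (induction \<phi> arbitrary: \<psi>)
  case (FLe s t)
  show ?case by (cases \<psi>) (auto simp: tm_code_inject)
next
  case (FEq s t)
  show ?case by (cases \<psi>) (auto simp: tm_code_inject)
next
  case (FNot \<phi>)
  then show ?case by (cases \<psi>) auto
next
  case (FAnd \<phi>1 \<phi>2)
  then show ?case by (cases \<psi>) auto
next
  case (FOr \<phi>1 \<phi>2)
  then show ?case by (cases \<psi>) auto
next
  case (FEx x \<phi>)
  then show ?case by (cases \<psi>) auto
next
  case (FAll x \<phi>)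
  then show ?case by (cases \<psi>) auto
qed

text \<open>Vertices are presented to an algorithm by their positions in an enumeration \<open>vs\<close> of the vertex
  set. The arena is coded as the list of its vertices, each given by its owner together with its
  row of the adjacency matrix; an entry is \<open>0\<close> if there is no edge and otherwise the successor of the
  coded pair of weights.\<close>

definition edge_code :: "'v arena \<Rightarrow> 'v \<times> 'v \<Rightarrow> nat" where
  "edge_code G e =
     (if e \<in> edges G
      then Suc (prod_encode (int_encode (weight0 G e), int_encode (weight1 G e))) else 0)"

definition arena_code :: "'v list \<Rightarrow> 'v arena \<Rightarrow> nat" where
  "arena_code vs G = list_encode
     (map (\<lambda>u. prod_encode (if u \<in> owned0 G then 0 else 1,
                 list_encode (map (\<lambda>u'. edge_code G (u, u')) vs))) vs)"

end

theory Submission imports Defs "HOL-Library.Infinite_Set" begin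

text \<open>The value exceeds \<open>c\<close> iff, for some \<open>d\<close>, Player 0 has an intended play with payoffs above \<open>c\<close>
  and \<open>d\<close> such that from none of its vertices Player 1 can enforce a payoff at least \<open>d\<close> for himself
  and at most \<open>c\<close> for Player 0. The second objective is closed under interleaving of plays, hence
  Player 0 can punish with positional strategies. Against a fixed positional strategy, and likewise
  for intended plays inside a fixed set of vertices, the achievable pairs of payoffs are governed by
  the convex hulls of the mean weights of the bounded cycles of the strongly connected parts. For
  given \<open>c\<close> the condition therefore compares finitely many affine functions of \<open>c\<close> with bounded
  integer coefficients, so the value is a rational number whose denominator divides a computable
  number \<open>D\<close>. It is found by searching for a rational of this form such that the condition holds at
  distance \<open>1 / (2 D)\<close> below it and fails at the same distance above it. The defining formula is
  then simply \<open>z = q\<close>.\<close>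

section \<open>Recursive functions and decidable predicates\<close>

text \<open>The obstacle is that payoffs are lower limits. That Player 0 receives at most
  \<open>c\<close> then constrains a play only at infinitely many times, and such a condition is not
  closed under interleaving. Determinacy is therefore applied to a stronger objective of Player 1:
  the upper mean of \<open>weight0\<close> is at most \<open>c\<close>, so that both of his
  conditions are lower limits, of \<open>c - weight0\<close> and of \<open>weight1 - d\<close>.
  Nothing is lost on the finite graph that a positional strategy leaves: once the cycle weights are
  separated from the open positive quadrant by a linear functional, its partial sums are bounded
  above at all times, and this also excludes plays that are bad for Player 0 only infinitely often.
  Suprema need not be attained, so the characterisation has a gap at the boundary:
  \<open>exceeds v c\<close> gives \<open>c \<le> ASV G v\<close>, and
  \<open>c < c' < ASV G v\<close> gives \<open>exceeds v c\<close>. Hence a candidate is not tested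
  at its own value but on both sides of it, at half the spacing of the candidates.\<close>

abbreviation pfst :: "nat \<Rightarrow> nat" where "pfst n \<equiv> fst (prod_decode n)"
abbreviation psnd :: "nat \<Rightarrow> nat" where "psnd n \<equiv> snd (prod_decode n)"

named_theorems rec_intros

lemma rec_id [rec_intros]: "total_recursive (\<lambda>n. n)"
  using total_recursive.pair[OF total_recursive.left total_recursive.right] by simp

lemma rec_Suc [rec_intros]: "total_recursive f \<Longrightarrow> total_recursive (\<lambda>n. Suc (f n))"
  using total_recursive.comp[OF total_recursive.suc] .

lemma rec_const [rec_intros]: "total_recursive (\<lambda>_. c)"
  by (induction c) (auto intro: total_recursive.zero rec_Suc)

lemma rec_fst [rec_intros]: "total_recursive f \<Longrightarrow> total_recursive (\<lambda>n. pfst (f n))"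
  using total_recursive.comp[OF total_recursive.left] .

lemma rec_snd [rec_intros]: "total_recursive f \<Longrightarrow> total_recursive (\<lambda>n. psnd (f n))"
  using total_recursive.comp[OF total_recursive.right] .

lemmas rec_pair [rec_intros] = total_recursive.pair

text \<open>Primitive recursion in curried form: \<open>h\<close> finds the input, the counter and
  the accumulator in nested pairs, so the step may depend on the input.\<close>

lemma rec_rec_nat [rec_intros]:
  assumes f: "total_recursive f"
    and h: "total_recursive (\<lambda>m. h (pfst m) (pfst (psnd m)) (psnd (psnd m)))"
    and b: "total_recursive b"
  shows "total_recursive (\<lambda>n. rec_nat (f n) (\<lambda>k r. h n k r) (b n))"
  using total_recursive.comp[OF total_recursive.prim_rec[OF f h] rec_pair[OF rec_id b]] by simp

lemma rec_add [rec_intros]: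
  assumes "total_recursive f" "total_recursive g"
  shows "total_recursive (\<lambda>n. f n + g n)"
proof -
  have "a + b = rec_nat a (\<lambda>_ r. Suc r) b" for a b :: nat by (induction b) auto
  then show ?thesis by (simp only:) (intro rec_intros assms)
qed

lemma rec_mult [rec_intros]:
  assumes "total_recursive f" "total_recursive g"
  shows "total_recursive (\<lambda>n. f n * g n)"
proof -
  have "a * b = rec_nat 0 (\<lambda>_ r. r + a) b" for a b :: nat by (induction b) auto
  then show ?thesis
    by (simp only:) (intro rec_intros assms total_recursive.comp[OF assms(1)])
qed

lemma rec_diff [rec_intros]:
  assumes "total_recursive f" "total_recursive g"
  shows "total_recursive (\<lambda>n. f n - g n)"
proof -
  \<comment> \<open>The predecessor is a recursion that returns the counter and ignores the
    accumulator.\<close>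
  have p: "a - 1 = rec_nat 0 (\<lambda>k _. k) a" for a :: nat by (cases a) auto
  have "a - b = rec_nat a (\<lambda>_ r. rec_nat 0 (\<lambda>k _. k) r) b" for a b :: nat
    by (induction b) (auto simp flip: p)
  then show ?thesis by (simp only:) (intro rec_intros assms)
qed

section \<open>Decidable predicates and bounded quantifiers\<close>

definition decidable :: "(nat \<Rightarrow> bool) \<Rightarrow> bool" where
  "decidable P \<longleftrightarrow> total_recursive (\<lambda>n. if P n then 1 else 0)"

lemma rec_if [rec_intros]:
  assumes "decidable P" "total_recursive f" "total_recursive g"
  shows "total_recursive (\<lambda>n. if P n then f n else g n)"
proof -
  \<comment> \<open>The characteristic function serves as the number of rounds, which is
    \<open>0\<close> or \<open>1\<close>.\<close>
  have "(if P n then f n else g n) = rec_nat (g n) (\<lambda>_ _. f n) (if P n then 1 else 0)" for n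
    by simp
  then show ?thesis
    by (simp only:)
      (intro rec_intros assms assms(1)[unfolded decidable_def] total_recursive.comp[OF assms(2)])
qed

lemma dec_le [rec_intros]:
  assumes "total_recursive f" "total_recursive g"
  shows "decidable (\<lambda>n. f n \<le> g n)"
proof -
  have "(if f n \<le> g n then 1 else 0) = 1 - (f n - g n)" for n by auto
  then show ?thesis unfolding decidable_def by (simp only:) (intro rec_intros assms)
qed

lemma dec_not [rec_intros]:
  assumes "decidable P" shows "decidable (\<lambda>n. \<not> P n)"
proof -
  have "(if \<not> P n then 1 else 0) = (if P n then 0 else 1 :: nat)" for n by simp
  then show ?thesis unfolding decidable_def by (simp only:) (intro rec_intros assms)
qed

lemma dec_conj [rec_intros]:
  assumes "decidable P" "decidable Q" shows "decidable (\<lambda>n. P n \<and> Q n)"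
proof -
  have "(if P n \<and> Q n then 1 else 0) = (if P n then if Q n then 1 else 0 else (0::nat))" for n
    by simp
  then show ?thesis unfolding decidable_def by (simp only:) (intro rec_intros assms)
qed

lemma dec_disj [rec_intros]:
  assumes "decidable P" "decidable Q" shows "decidable (\<lambda>n. P n \<or> Q n)"
  using dec_not[OF dec_conj[OF dec_not[OF assms(1)] dec_not[OF assms(2)]]] by simp

lemma dec_imp [rec_intros]:
  assumes "decidable P" "decidable Q" shows "decidable (\<lambda>n. P n \<longrightarrow> Q n)"
  unfolding imp_conv_disj by (intro rec_intros assms)

lemma dec_less [rec_intros]:
  assumes "total_recursive f" "total_recursive g"
  shows "decidable (\<lambda>n. f n < g n)"
  using dec_not[OF dec_le[OF assms(2,1)]] by (simp add: not_le)

lemma dec_eq [rec_intros]: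
  assumes "total_recursive f" "total_recursive g"
  shows "decidable (\<lambda>n. f n = g n)"
  using dec_conj[OF dec_le[OF assms] dec_le[OF assms(2,1)]] by (simp add: eq_iff)

lemma dec_comp: "decidable P \<Longrightarrow> total_recursive f \<Longrightarrow> decidable (\<lambda>n. P (f n))"
  unfolding decidable_def by (rule total_recursive.comp)

lemma dec_ex_le [rec_intros]:
  assumes P: "decidable (\<lambda>m. P (pfst m) (psnd m))" and b: "total_recursive b"
  shows "decidable (\<lambda>n. \<exists>k\<le>b n. P n k)"
proof -
  have r: "rec_nat 0 (\<lambda>k r. if P n k then 1 else r) m = (if \<exists>k<m. P n k then 1 else 0 :: nat)" for n m
    by (induction m) (auto simp: less_Suc_eq)
  have P': "decidable (\<lambda>m. P (pfst m) (pfst (psnd m)))"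
    using dec_comp[OF P rec_pair[OF rec_fst[OF rec_id] rec_fst[OF rec_snd[OF rec_id]]]] by simp
  have "(if \<exists>k\<le>b n. P n k then 1 else 0 :: nat)
      = rec_nat 0 (\<lambda>k r. if P n k then 1 else r) (Suc (b n))" for n
    by (simp only: r less_Suc_eq_le)
  then show ?thesis
    unfolding decidable_def by (simp only:) (intro rec_intros b P')
qed

lemma dec_all_le [rec_intros]:
  assumes P: "decidable (\<lambda>m. P (pfst m) (psnd m))" and b: "total_recursive b"
  shows "decidable (\<lambda>n. \<forall>k\<le>b n. P n k)"
  using dec_not[OF dec_ex_le[OF dec_not[OF P] b]] by simp

lemma rec_sum [rec_intros]:
  assumes f: "total_recursive (\<lambda>m. f (pfst m) (psnd m))" and b: "total_recursive b"
  shows "total_recursive (\<lambda>n. \<Sum>k<b n. f n k)"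
proof -
  have r: "(\<Sum>k<m. f n k) = rec_nat 0 (\<lambda>k r. r + f n k) m" for n m
    by (induction m) auto
  have f': "total_recursive (\<lambda>m. f (pfst m) (pfst (psnd m)))"
    using total_recursive.comp[OF f rec_pair[OF rec_fst[OF rec_id] rec_fst[OF rec_snd[OF rec_id]]]]
    by simp
  show ?thesis unfolding r by (intro rec_intros b f')
qed

lemma rec_fact [rec_intros]:
  assumes "total_recursive f" shows "total_recursive (\<lambda>n. fact (f n))"
proof -
  have "fact n = rec_nat 1 (\<lambda>k r. Suc k * r) n" for n by (induction n) auto
  then show ?thesis by (simp only:) (intro rec_intros assms)
qed

text \<open>The disjunct \<open>b n \<le> m\<close> makes the search end on every input, as
  minimisation demands; a number that codes no arena need not have a witness for
  \<open>P\<close>.\<close>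

lemma rec_search:
  assumes P: "decidable (\<lambda>m. P (pfst m) (psnd m))" and b: "total_recursive b"
  shows "total_recursive (\<lambda>n. LEAST m. P n m \<or> b n \<le> m)"
proof -
  define f where "f = (\<lambda>m. if P (pfst m) (psnd m) \<or> b (pfst m) \<le> psnd m then 0 else 1 :: nat)"
  have "total_recursive f"
    unfolding f_def by (intro rec_intros P total_recursive.comp[OF b])
  moreover have "\<exists>m. f (prod_encode (n, m)) = 0" for n
    by (rule exI[of _ "b n"]) (simp add: f_def)
  ultimately have "total_recursive (\<lambda>n. LEAST m. f (prod_encode (n, m)) = 0)"
    by (rule total_recursive.minimise)
  moreover have "f (prod_encode (n, m)) = 0 \<longleftrightarrow> P n m \<or> b n \<le> m" for n m
    by (simp add: f_def)
  ultimately show ?thesis by simp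
qed

text \<open>Integers are kept as differences of two natural numbers: sums and products then reduce
  to the rules for \<open>nat\<close>, and comparison is done by moving terms across, without any
  case distinction on signs.\<close>

definition rec_int :: "(nat \<Rightarrow> int) \<Rightarrow> bool" where
  "rec_int f \<longleftrightarrow> (\<exists>p q. total_recursive p \<and> total_recursive q \<and> (\<forall>n. f n = int (p n) - int (q n)))"

lemma rec_intI:
  "total_recursive p \<Longrightarrow> total_recursive q \<Longrightarrow> (\<And>n. f n = int (p n) - int (q n)) \<Longrightarrow> rec_int f"
  unfolding rec_int_def by blast

lemma rec_int_of_nat [rec_intros]: "total_recursive f \<Longrightarrow> rec_int (\<lambda>n. int (f n))"
  by (rule rec_intI[OF _ rec_const[of 0]]) auto

lemma rec_int_const [rec_intros]: "rec_int (\<lambda>_. c)"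
  by (rule rec_intI[OF rec_const[of "nat c"] rec_const[of "nat (- c)"]]) auto

lemma rec_int_add [rec_intros]:
  assumes "rec_int f" "rec_int g" shows "rec_int (\<lambda>n. f n + g n)"
proof -
  obtain p q p' q' where "total_recursive p" "total_recursive q" "\<And>n. f n = int (p n) - int (q n)"
    "total_recursive p'" "total_recursive q'" "\<And>n. g n = int (p' n) - int (q' n)"
    using assms unfolding rec_int_def by metis
  then show ?thesis
    by (intro rec_intI[OF rec_add[of p p'] rec_add[of q q']]) auto
qed

lemma rec_int_diff [rec_intros]:
  assumes "rec_int f" "rec_int g" shows "rec_int (\<lambda>n. f n - g n)"
proof -
  obtain p q p' q' where "total_recursive p" "total_recursive q" "\<And>n. f n = int (p n) - int (q n)"
    "total_recursive p'" "total_recursive q'" "\<And>n. g n = int (p' n) - int (q' n)"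
    using assms unfolding rec_int_def by metis
  then show ?thesis
    by (intro rec_intI[OF rec_add[of p q'] rec_add[of q p']]) auto
qed

lemma rec_int_mult [rec_intros]:
  assumes "rec_int f" "rec_int g" shows "rec_int (\<lambda>n. f n * g n)"
proof -
  obtain p q p' q' where "total_recursive p" "total_recursive q" "\<And>n. f n = int (p n) - int (q n)"
    "total_recursive p'" "total_recursive q'" "\<And>n. g n = int (p' n) - int (q' n)"
    using assms unfolding rec_int_def by metis
  moreover from this have "f n * g n = int (p n * p' n + q n * q' n) - int (p n * q' n + q n * p' n)" for n
    by (simp only: of_nat_add of_nat_mult) (simp add: algebra_simps)
  ultimately show ?thesis
    by (intro rec_intI[of "\<lambda>n. p n * p' n + q n * q' n" "\<lambda>n. p n * q' n + q n * p' n"] rec_intros)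
qed

lemma rec_int_sum [rec_intros]:
  assumes "rec_int (\<lambda>m. f (pfst m) (psnd m))" and b: "total_recursive b"
  shows "rec_int (\<lambda>n. \<Sum>k<b n. f n k)"
proof -
  obtain p q where p: "total_recursive p" and q: "total_recursive q"
    and f: "\<And>m. f (pfst m) (psnd m) = int (p m) - int (q m)"
    using assms(1) unfolding rec_int_def by metis
  have "f n k = int (p (prod_encode (n, k))) - int (q (prod_encode (n, k)))" for n k
    using f[of "prod_encode (n, k)"] by simp
  moreover have "total_recursive (\<lambda>n. \<Sum>k<b n. g (prod_encode (n, k)))" if "total_recursive g" for g
    by (intro rec_intros total_recursive.comp[OF that] b)
  ultimately show ?thesis
    by (intro rec_intI[of "\<lambda>n. \<Sum>k<b n. p (prod_encode (n, k))" "\<lambda>n. \<Sum>k<b n. q (prod_encode (n, k))"])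
      (auto simp: sum_subtractf p q)
qed

lemma rec_int_decode [rec_intros]:
  assumes "total_recursive f" shows "rec_int (\<lambda>n. int_decode (f n))"
proof -
  \<comment> \<open>Parity is obtained by flipping a bit \<open>m\<close> times, and halving by
    counting the odd numbers below \<open>m\<close>.\<close>
  have h: "(\<Sum>i<m. i mod 2) = m div 2" for m :: nat
    by (induction m) (simp_all, presburger)
  have e: "rec_nat 0 (\<lambda>_ r. 1 - r) m = m mod 2" for m :: nat
    by (induction m) (simp_all, presburger)
  have [rec_intros]: "total_recursive (\<lambda>n. g n mod 2)" if "total_recursive g" for g
    unfolding e[symmetric] by (intro rec_intros that)
  have d: "int_decode m = int (if m mod 2 = 0 then m div 2 else 0) - int (if m mod 2 = 0 then 0 else Suc (m div 2))" for m
    by (auto simp: int_decode_def sum_decode_def)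
  show ?thesis
    unfolding d h[symmetric] by (intro rec_intI[OF _ _ refl] rec_intros assms)
qed

lemma dec_int_le [rec_intros]:
  assumes "rec_int f" "rec_int g" shows "decidable (\<lambda>n. f n \<le> g n)"
proof -
  obtain p q p' q' where r: "total_recursive p" "total_recursive q" 
    "total_recursive p'" "total_recursive q'" and "\<And>n. f n = int (p n) - int (q n)" "\<And>n. g n = int (p' n) - int (q' n)"
    using assms unfolding rec_int_def by metis
  then have "f n \<le> g n \<longleftrightarrow> p n + q' n \<le> p' n + q n" for n by auto
  then show ?thesis by (simp only:) (intro rec_intros r)
qed

lemma dec_int_less [rec_intros]:
  assumes "rec_int f" "rec_int g"
  shows "decidable (\<lambda>n. f n < g n)"
  using dec_not[OF dec_int_le[OF assms(2,1)]] by (simp add: not_le)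

lemma dec_int_eq [rec_intros]:
  assumes "rec_int f" "rec_int g"
  shows "decidable (\<lambda>n. f n = g n)"
  using dec_conj[OF dec_int_le[OF assms] dec_int_le[OF assms(2,1)]] by (simp add: eq_iff)

text \<open>Lookup in a coded list, with value \<open>0\<close> outside the list; thus every number codes a function.\<close>

definition entry :: "nat \<Rightarrow> nat \<Rightarrow> nat" where
  "entry t k = pfst (rec_nat t (\<lambda>_ r. psnd (r - 1)) k - 1)"

lemma rec_entry [rec_intros]:
  "total_recursive f \<Longrightarrow> total_recursive g \<Longrightarrow> total_recursive (\<lambda>n. entry (f n) (g n))"
  unfolding entry_def by (intro rec_intros)

lemma prod_decode_0 [simp]: "prod_decode 0 = (0, 0)"
  by (simp add: prod_decode_def prod_decode_aux.simps)

lemma entry_list_encode: "entry (list_encode xs) k = (if k < length xs then xs ! k else 0)"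
proof -
  have z: "rec_nat 0 (\<lambda>_ r. psnd (r - 1)) k = 0" for k
    by (induction k) auto
  \<comment> \<open>\<open>rec_nat\<close> unfolds its last round, whereas the induction over the
    list has to remove the first one.\<close>
  have s: "rec_nat t (\<lambda>_ r. psnd (r - 1)) (Suc k) = rec_nat (psnd (t - 1)) (\<lambda>_ r. psnd (r - 1)) k" for t k
    by (induction k) auto
  show ?thesis
  proof (induction xs arbitrary: k)
    case Nil
    then show ?case using z[of k] by (simp add: entry_def)
  next
    case (Cons x xs)
    show ?case
    proof (cases k)
      case 0
      then show ?thesis by (simp add: entry_def)
    next
      case (Suc m)
      have "entry (list_encode (x # xs)) (Suc m) = entry (list_encode xs) m"
        unfolding entry_def s by simp
      then show ?thesis using Cons[of m] Suc by simp
    qed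
  qed
qed

section \<open>Sizes of codes\<close>

lemma prod_encode_mono: "a \<le> a' \<Longrightarrow> b \<le> b' \<Longrightarrow> prod_encode (a, b) \<le> prod_encode (a', b')"
proof -
  have "triangle m \<le> triangle n" if "m \<le> n" for m n
    using that by (induction rule: dec_induct) auto
  then show "a \<le> a' \<Longrightarrow> b \<le> b' \<Longrightarrow> prod_encode (a, b) \<le> prod_encode (a', b')"
    by (simp add: prod_encode_def add_mono)
qed

lemma pfst_le: "pfst n \<le> n" and psnd_le: "psnd n \<le> n"
  using le_prod_encode_1[of "pfst n" "psnd n"] le_prod_encode_2[of "psnd n" "pfst n"] by simp_all

lemma length_le_list_encode: "length xs \<le> list_encode xs"
proof (induction xs)
  case (Cons x xs)
  then show ?case using le_prod_encode_2[of "list_encode xs" x] by simp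
qed simp

lemma nth_less_list_encode: "k < length xs \<Longrightarrow> xs ! k < list_encode xs"
proof (induction xs arbitrary: k)
  case (Cons x xs)
  show ?case
  proof (cases k)
    case 0
    then show ?thesis using le_prod_encode_1[of x "list_encode xs"] by simp
  next
    case (Suc m)
    then show ?thesis using Cons(1)[of m] Cons(2) le_prod_encode_2[of "list_encode xs" x] by simp
  qed
qed simp

text \<open>An upper bound for the codes of all lists of length \<open>n + 1\<close> with entries at
  most \<open>n\<close>. It turns quantification over functions on \<open>{0..n}\<close> (vertex
  sets, strategies, walks) into bounded quantification over numbers.\<close>

definition code_bound :: "nat \<Rightarrow> nat" where
  "code_bound n = rec_nat 0 (\<lambda>_ r. Suc (prod_encode (n, r))) (Suc n)"

lemma rec_code_bound [rec_intros]:
  assumes "total_recursive f" shows "total_recursive (\<lambda>n. code_bound (f n))"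
proof -
  have "total_recursive (\<lambda>n. code_bound n)"
    unfolding code_bound_def by (intro rec_intros)
  then show ?thesis using assms by (rule total_recursive.comp)
qed

lemma code_boundE:
  assumes "\<And>k. k \<le> n \<Longrightarrow> f k \<le> n"
  obtains t where "t \<le> code_bound n" "\<And>k. k \<le> n \<Longrightarrow> entry t k = f k"
proof -
  have le: "list_encode xs \<le> rec_nat 0 (\<lambda>_ r. Suc (prod_encode (n, r))) (length xs)"
    if "\<forall>x\<in>set xs. x \<le> n" for xs
    using that by (induction xs) (auto intro!: prod_encode_mono)
  let ?xs = "map f [0..<Suc n]"
  have "list_encode ?xs \<le> code_bound n"
    using le[of ?xs] assms by (simp add: code_bound_def del: upt_Suc)
  moreover have "entry (list_encode ?xs) k = f k" if "k \<le> n" for k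
    using that by (simp add: entry_list_encode del: upt_Suc)
  ultimately show ?thesis using that by blast
qed

section \<open>Half-positional determinacy\<close>

definition path :: "('v \<times> 'v) set \<Rightarrow> (nat \<Rightarrow> 'v) \<Rightarrow> bool" where
  "path E \<rho> \<longleftrightarrow> (\<forall>k. (\<rho> k, \<rho> (Suc k)) \<in> E)"

definition psum :: "('v \<times> 'v \<Rightarrow> real) \<Rightarrow> (nat \<Rightarrow> 'v) \<Rightarrow> nat \<Rightarrow> real" where
  "psum w \<rho> k = (\<Sum>j<k. w (\<rho> j, \<rho> (Suc j)))"

text \<open>Nonnegativity of the lower mean payoff, stated without limits. The constant
  \<open>K\<close> absorbs finite prefixes, which makes prefix independence and closure under
  interleaving linear estimates.\<close>

definition nonneg_mean :: "('v \<times> 'v \<Rightarrow> real) \<Rightarrow> (nat \<Rightarrow> 'v) \<Rightarrow> bool" where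
  "nonneg_mean w \<rho> \<longleftrightarrow> (\<forall>\<epsilon>>0. \<exists>K. \<forall>k. psum w \<rho> k \<ge> - \<epsilon> * real k - K)"

lemma psum_add: "psum w \<rho> (m + k) = psum w \<rho> m + psum w (\<lambda>i. \<rho> (i + m)) k"
  unfolding psum_def by (induction k) (simp_all add: add.commute)

lemma psum_ge_init:
  assumes "k \<le> m" shows "psum w \<rho> k \<ge> - (\<Sum>j<m. \<bar>w (\<rho> j, \<rho> (Suc j))\<bar>)"
proof -
  have "\<bar>psum w \<rho> k\<bar> \<le> (\<Sum>j<k. \<bar>w (\<rho> j, \<rho> (Suc j))\<bar>)"
    unfolding psum_def by (rule sum_abs)
  also have "\<dots> \<le> (\<Sum>j<m. \<bar>w (\<rho> j, \<rho> (Suc j))\<bar>)"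
    using assms by (intro sum_mono2) auto
  finally show ?thesis by linarith
qed

lemma nonneg_mean_shift: "nonneg_mean w (\<lambda>i. \<rho> (i + m)) \<longleftrightarrow> nonneg_mean w \<rho>"
proof
  assume L: "nonneg_mean w (\<lambda>i. \<rho> (i + m))"
  show "nonneg_mean w \<rho>"
    unfolding nonneg_mean_def
  proof (intro allI impI)
    fix \<epsilon> :: real assume e: "\<epsilon> > 0"
    obtain K where K: "\<And>k. psum w (\<lambda>i. \<rho> (i + m)) k \<ge> - \<epsilon> * real k - K"
      using L e unfolding nonneg_mean_def by blast
    let ?B = "\<Sum>j<m. \<bar>w (\<rho> j, \<rho> (Suc j))\<bar>"
    have "psum w \<rho> k \<ge> - \<epsilon> * real k - (\<bar>K\<bar> + ?B)" for k
    proof (cases "k \<le> m")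
      case True
      have "0 \<le> \<epsilon> * real k" using e by simp
      then show ?thesis using psum_ge_init[OF True, of w \<rho>] by linarith
    next
      case False
      then obtain l where l: "k = m + l" using nat_le_iff_add nat_le_linear by blast
      have "0 \<le> \<epsilon> * real m" using e by simp
      then have "\<epsilon> * real l \<le> \<epsilon> * real k" using l by (simp add: distrib_left)
      then show ?thesis
        using K[of l] psum_ge_init[of m m w \<rho>] psum_add[of w \<rho> m l] l by simp
    qed
    then show "\<exists>K. \<forall>k. psum w \<rho> k \<ge> - \<epsilon> * real k - K" by blast
  qed
next
  assume L: "nonneg_mean w \<rho>"
  show "nonneg_mean w (\<lambda>i. \<rho> (i + m))"
    unfolding nonneg_mean_def
  proof (intro allI impI)
    fix \<epsilon> :: real assume e: "\<epsilon> > 0"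
    obtain K where K: "\<And>k. psum w \<rho> k \<ge> - \<epsilon> * real k - K"
      using L e unfolding nonneg_mean_def by blast
    have "psum w (\<lambda>i. \<rho> (i + m)) k \<ge> - \<epsilon> * real k - (K + \<epsilon> * real m + psum w \<rho> m)" for k
      using K[of "m + k"] psum_add[of w \<rho> m k] by (simp add: algebra_simps)
    then show "\<exists>K. \<forall>k. psum w (\<lambda>i. \<rho> (i + m)) k \<ge> - \<epsilon> * real k - K" by blast
  qed
qed

section \<open>Interleaving of plays\<close>

lemma enumerate_card_below:
  fixes S :: "nat set"
  assumes "infinite S" shows "{i. i < enumerate S m \<and> i \<in> S} = enumerate S ` {..<m}"
proof (intro set_eqI iffI)
  fix i assume "i \<in> {i. i < enumerate S m \<and> i \<in> S}"
  moreover from this obtain l where "i = enumerate S l"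
    using enumerate_Ex[OF assms] by (metis mem_Collect_eq)
  ultimately show "i \<in> enumerate S ` {..<m}"
    using assms by (auto simp: strict_mono_less[OF strict_mono_enumerate])
next
  fix i assume "i \<in> enumerate S ` {..<m}"
  then show "i \<in> {i. i < enumerate S m \<and> i \<in> S}"
    using assms enumerate_in_set by (auto simp: strict_mono_less[OF strict_mono_enumerate])
qed

lemma filter_below_enumerate:
  fixes S :: "nat set"
  assumes "infinite S"
  shows "filter (\<lambda>i. i \<in> S) [0..<enumerate S m] = map (enumerate S) [0..<m]"
proof (rule sorted_distinct_set_unique)
  show "sorted (map (enumerate S) [0..<m])"
    by (simp add: sorted_iff_nth_mono strict_mono_less_eq[OF strict_mono_enumerate[OF assms]])
  show "distinct (map (enumerate S) [0..<m])"
    using strict_mono_imp_inj_on[OF strict_mono_enumerate[OF assms]]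
    by (auto simp: distinct_map inj_on_def)
  show "set (filter (\<lambda>i. i \<in> S) [0..<enumerate S m]) = set (map (enumerate S) [0..<m])"
    using enumerate_card_below[OF assms, of m] by (auto simp: atLeast0LessThan)
qed (simp_all add: sorted_wrt_filter)

lemma sum_enumerate:
  fixes S :: "nat set" and f :: "nat \<Rightarrow> real"
  assumes "infinite S"
  shows "(\<Sum>i | i < k \<and> i \<in> S. f i) = (\<Sum>m<card {i. i < k \<and> i \<in> S}. f (enumerate S m))"
proof (induction k)
  case (Suc k)
  show ?case
  proof (cases "k \<in> S")
    case True
    then obtain m where m: "k = enumerate S m" using enumerate_Ex[OF assms] by metis
    have "card {i. i < k \<and> i \<in> S} = m"
      using m enumerate_card_below[OF assms, of m]
        card_image[OF strict_mono_imp_inj_on[OF strict_mono_enumerate[OF assms], of "{..<m}"]]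
      by simp
    moreover have "{i. i < Suc k \<and> i \<in> S} = insert k {i. i < k \<and> i \<in> S}"
      using True by auto
    ultimately show ?thesis using Suc m by simp
  next
    case False
    then have "{i. i < Suc k \<and> i \<in> S} = {i. i < k \<and> i \<in> S}"
      by (auto simp: less_Suc_eq)
    then show ?thesis using Suc by simp
  qed
qed simp

text \<open>A thread with finitely many steps contributes only a bounded amount.\<close>

lemma nonneg_mean_shuffle:
  fixes S :: "bool \<Rightarrow> nat set"
  assumes S: "S True \<union> S False = UNIV" "S True \<inter> S False = {}"
    and "\<And>j. infinite (S j) \<Longrightarrow> nonneg_mean w (\<lambda>m. \<rho> (enumerate (S j) m))"
    and step: "\<And>j m. infinite (S j) \<Longrightarrow>
      \<rho> (enumerate (S j) (Suc m)) = \<rho> (Suc (enumerate (S j) m))"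
  shows "nonneg_mean w (\<rho> :: nat \<Rightarrow> 'v)"
  unfolding nonneg_mean_def
proof (intro allI impI)
  fix \<epsilon> :: real assume e: "\<epsilon> > 0"
  let ?f = "\<lambda>i. w (\<rho> i, \<rho> (Suc i))"
  let ?T = "\<lambda>k j. {i. i < k \<and> i \<in> S j}"
  let ?s = "\<lambda>k j. sum ?f (?T k j)"
  have "\<exists>K. \<forall>k. ?s k j \<ge> - \<epsilon> * real (card (?T k j)) - K" for j :: bool
  proof (cases "infinite (S j)")
    case True
    let ?r = "\<lambda>m. \<rho> (enumerate (S j) m)"
    obtain K where K: "\<And>k. psum w ?r k \<ge> - \<epsilon> * real k - K"
      using assms(3)[OF True] e unfolding nonneg_mean_def by blast
    have "?s k j = psum w ?r (card (?T k j))" for k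
      unfolding sum_enumerate[OF True] psum_def step[OF True] ..
    then show ?thesis using K by metis
  next
    case False
    have "?s k j \<ge> - \<epsilon> * real (card (?T k j)) - (\<Sum>i | i \<in> S j. \<bar>?f i\<bar>)" for k
    proof -
      have "\<bar>\<Sum>i | i < k \<and> i \<in> S j. ?f i\<bar> \<le> (\<Sum>i | i < k \<and> i \<in> S j. \<bar>?f i\<bar>)"
        by (rule sum_abs)
      also have "\<dots> \<le> (\<Sum>i | i \<in> S j. \<bar>?f i\<bar>)"
        using False by (intro sum_mono2) auto
      moreover have "0 \<le> \<epsilon> * real (card (?T k j))" using e by simp
      ultimately show ?thesis by linarith
    qed
    then show ?thesis by blast
  qed
  then obtain K where K: "\<And>j k. ?s k j \<ge> - \<epsilon> * real (card (?T k j)) - K j"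
    using choice[of "\<lambda>j K. \<forall>k. ?s k j \<ge> - \<epsilon> * real (card (?T k j)) - K"]
    by blast
  \<comment> \<open>The permitted loss of \<epsilon> per step is divided between the two threads
    according to the number of steps each has made before time \<open>k\<close>.\<close>
  have "psum w \<rho> k \<ge> - \<epsilon> * real k - (K True + K False)" for k
  proof -
    have U: "{..<k} = (?T k True) \<union> (?T k False)"
      using S(1) by auto
    have D: "(?T k True) \<inter> (?T k False) = {}" using S(2) by auto
    have "psum w \<rho> k = ?s k True + ?s k False"
      unfolding psum_def U by (rule sum.union_disjoint[OF _ _ D]) auto
    moreover have "k = card (?T k True) + card (?T k False)"
      using card_Un_disjoint[OF _ _ D] U by (metis (no_types, lifting) card_lessThan finite_Un finite_lessThan)
    then have "real k = real (card (?T k True)) + real (card (?T k False))"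
      by (metis of_nat_add)
    then have "\<epsilon> * real k = \<epsilon> * real (card (?T k True)) + \<epsilon> * real (card (?T k False))"
      by (metis distrib_left)
    ultimately show ?thesis using K[where j=True and k=k] K[where j=False and k=k] by linarith
  qed
  then show "\<exists>K. \<forall>k. psum w \<rho> k \<ge> - \<epsilon> * real k - K" by blast
qed

lemma last_play_prefix [simp]: "last (play_prefix \<rho> k) = \<rho> k"
  and length_play_prefix [simp]: "length (play_prefix \<rho> k) = Suc k"
  and play_prefix_neq_Nil [simp]: "play_prefix \<rho> k \<noteq> []"
  by (simp_all add: play_prefix_def)

lemma nth_play_prefix [simp]: "i \<le> k \<Longrightarrow> play_prefix \<rho> k ! i = \<rho> i"
  unfolding play_prefix_def by (simp del: upt_Suc)

text \<open>A step belongs to one of two threads, according to the edge taken at the last visit of \<open>u\<close>.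
  Each thread is a play on its own, because the other thread leaves and re-enters it at \<open>u\<close>.\<close>

primrec thread :: "'v \<Rightarrow> 'v \<Rightarrow> (nat \<Rightarrow> 'v) \<Rightarrow> nat \<Rightarrow> bool" where
  "thread u t \<rho> 0 = (\<rho> 1 = t)"
| "thread u t \<rho> (Suc i) = (if \<rho> (Suc i) = u then \<rho> (Suc (Suc i)) = t else thread u t \<rho> i)"

lemma thread_cong:
  "(\<And>l. l \<le> Suc i \<Longrightarrow> \<rho> l = \<rho>' l) \<Longrightarrow> thread u t \<rho> i = thread u t \<rho>' i"
  by (induction i) auto

text \<open>Away from \<open>u\<close> the thread of a step is inherited from the previous step, so
  it can be read off the history that ends there; only at \<open>u\<close> does it depend on the
  edge taken next.\<close>

lemma thread_cong_not_u:
  assumes "\<And>l. l \<le> i \<Longrightarrow> \<rho> l = \<rho>' l" "\<rho> 0 = u" "\<rho> i \<noteq> u"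
  shows "thread u t \<rho> i = thread u t \<rho>' i"
proof (cases i)
  case (Suc l)
  then show ?thesis using assms thread_cong[of l \<rho> \<rho>' u t] by auto
qed (use assms in auto)

lemma thread_at_u: "\<rho> 0 = u \<Longrightarrow> \<rho> i = u \<Longrightarrow> thread u t \<rho> i = (\<rho> (Suc i) = t)"
  by (cases i) auto

lemma thread_changeD: "thread u t \<rho> (Suc i) \<noteq> thread u t \<rho> i \<Longrightarrow> \<rho> (Suc i) = u"
  by (auto split: if_splits)

definition thread_steps :: "'v \<Rightarrow> 'v \<Rightarrow> (nat \<Rightarrow> 'v) \<Rightarrow> bool \<Rightarrow> nat set" where
  "thread_steps u t \<rho> j = {i. thread u t \<rho> i = j}"

lemma mem_thread_steps: "i \<in> thread_steps u t \<rho> j \<longleftrightarrow> thread u t \<rho> i = j"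
  by (simp add: thread_steps_def)

lemma thread_step:
  assumes inf: "infinite (thread_steps u t \<rho> j)"
  shows "\<rho> (enumerate (thread_steps u t \<rho> j) (Suc m)) = \<rho> (Suc (enumerate (thread_steps u t \<rho> j) m))"
proof -
  let ?S = "thread_steps u t \<rho> j"
  define e e' where "e = enumerate ?S m" and "e' = enumerate ?S (Suc m)"
  have lt: "e < e'" using enumerate_step[OF inf, of m] by (simp add: e_def e'_def)
  have e: "thread u t \<rho> e = j" "thread u t \<rho> e' = j"
    using enumerate_in_set[OF inf] by (simp_all add: e_def e'_def flip: mem_thread_steps)
  have gap: "thread u t \<rho> i \<noteq> j" if i: "e < i" "i < e'" for i
  proof
    assume "thread u t \<rho> i = j"
    then obtain l where "i = enumerate ?S l" using enumerate_Ex[OF inf, of i] by (metis mem_thread_steps)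
    then show False
      using i strict_mono_less[OF strict_mono_enumerate[OF inf]] by (auto simp: e_def e'_def)
  qed
  show ?thesis
  proof (cases "e' = Suc e")
    case False
    \<comment> \<open>The other thread starts right after \<open>e\<close> and ends right before
      \<open>e'\<close>. Threads change only at \<open>u\<close>, so the detour both begins and ends
      in \<open>u\<close>.\<close>
    then have "thread u t \<rho> (Suc e) \<noteq> j" using gap[of "Suc e"] lt by simp
    then have "\<rho> (Suc e) = u" using thread_changeD[of u t \<rho> e] e(1) by metis
    moreover obtain l where l: "e' = Suc l" using lt by (cases e') auto
    then have "thread u t \<rho> l \<noteq> j" using gap[of l] lt False by simp
    then have "\<rho> e' = u" using thread_changeD[of u t \<rho> l] e(2) l by metis
    ultimately show ?thesis by (simp add: e_def e'_def)
  qed (simp add: e_def e'_def)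
qed

lemma thread_start:
  assumes inf: "infinite (thread_steps u t \<rho> j)" and "\<rho> 0 = u"
  shows "\<rho> (enumerate (thread_steps u t \<rho> j) 0) = u"
proof (cases "enumerate (thread_steps u t \<rho> j) 0")
  case (Suc l)
  then have "thread u t \<rho> l \<noteq> j" 
    using not_less_Least[of l "\<lambda>i. i \<in> thread_steps u t \<rho> j"] by (auto simp: enumerate_0 mem_thread_steps)
  moreover have "thread u t \<rho> (Suc l) = j" using enumerate_in_set[OF inf, of 0] Suc by (metis mem_thread_steps)
  ultimately show ?thesis using thread_changeD Suc by metis
qed (use assms in simp)

text \<open>The strategy of the current thread is fed the part of the history that belongs to this
  thread. Reading the list as a function is safe: the strategy is consulted at vertices other than
  \<open>u\<close>, where \<open>thread\<close> does not look past the end.\<close>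

definition thread_strategy :: "'v \<Rightarrow> 'v \<Rightarrow> (bool \<Rightarrow> 'v list \<Rightarrow> 'v) \<Rightarrow> 'v list \<Rightarrow> 'v" where
  "thread_strategy u t s h =
     (let k = length h - 1; j = thread u t ((!) h) k
      in s j (map ((!) h) (filter (\<lambda>i. thread u t ((!) h) i = j) [0..<k]) @ [last h]))"

lemma thread_follows:
  assumes fol: "follows U (thread_strategy u t s) \<rho>" and u: "u \<notin> U" "\<rho> 0 = u"
    and inf: "infinite (thread_steps u t \<rho> j)"
  shows "follows U (s j) (\<lambda>m. \<rho> (enumerate (thread_steps u t \<rho> j) m))"
  unfolding follows_def
proof (intro allI impI)
  fix m
  let ?S = "thread_steps u t \<rho> j"
  let ?e = "enumerate ?S"
  let ?h = "play_prefix \<rho> (?e m)"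
  assume m: "\<rho> (?e m) \<in> U"
  have j: "thread u t ((!) ?h) (?e m) = j"
    using enumerate_in_set[OF inf, of m] thread_cong_not_u[of "?e m" \<rho> "(!) ?h" u t] u m
    by (metis mem_thread_steps nth_play_prefix)
  have "thread u t ((!) ?h) i = thread u t \<rho> i" if "i < ?e m" for i
    using that by (intro thread_cong) simp
  then have "filter (\<lambda>i. thread u t ((!) ?h) i = j) [0..<?e m] = filter (\<lambda>i. i \<in> ?S) [0..<?e m]"
    by (intro filter_cong) (simp_all add: mem_thread_steps)
  moreover have "map ((!) ?h) (filter (\<lambda>i. i \<in> ?S) [0..<?e m]) = map \<rho> (filter (\<lambda>i. i \<in> ?S) [0..<?e m])"
    by (intro map_cong) auto
  moreover have "map \<rho> (filter (\<lambda>i. i \<in> ?S) [0..<?e m]) @ [\<rho> (?e m)] = play_prefix (\<lambda>m. \<rho> (?e m)) m"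
    unfolding filter_below_enumerate[OF inf] play_prefix_def by simp
  ultimately have "thread_strategy u t s ?h = s j (play_prefix (\<lambda>m. \<rho> (?e m)) m)"
    using j by (simp only: thread_strategy_def Let_def length_play_prefix diff_Suc_1 last_play_prefix)
  then show "\<rho> (?e (Suc m)) = s j (play_prefix (\<lambda>m. \<rho> (?e m)) m)"
    using thread_step[OF inf, of m] fol m by (simp add: follows_def)
qed

lemma play_prefix_cong: "(\<And>l. l \<le> i \<Longrightarrow> \<rho> l = \<rho>' l) \<Longrightarrow> play_prefix \<rho> i = play_prefix \<rho>' i"
  unfolding play_prefix_def by (rule map_cong) auto

lemma play_prefix_Suc: "play_prefix \<rho> (Suc i) = play_prefix \<rho> i @ [\<rho> (Suc i)]"
  by (simp add: play_prefix_def)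

lemma play_prefix_shift:
  "play_prefix \<rho> (k + i) = map \<rho> [0..<k] @ play_prefix (\<lambda>i. \<rho> (i + k)) i"
proof (induction i)
  case 0
  then show ?case by (simp add: play_prefix_def)
next
  case (Suc i)
  then show ?case by (simp add: play_prefix_Suc add.commute)
qed

lemma run_extend:
  "\<exists>\<rho>'. (\<forall>i\<le>k. \<rho>' i = \<rho> i) \<and> (\<forall>i\<ge>k. \<rho>' (Suc i) = f (play_prefix \<rho>' i))"
proof -
  define H where "H = rec_nat (play_prefix \<rho> k) (\<lambda>_ h. h @ [f h])"
  define \<rho>' where "\<rho>' = (\<lambda>i. if i \<le> k then \<rho> i else last (H (i - k)))"
  have "play_prefix \<rho>' (k + i) = H i" for i
  proof (induction i)
    case 0
    then show ?case using play_prefix_cong[of k \<rho>' \<rho>] by (simp add: \<rho>'_def H_def)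
  next
    case (Suc i)
    then show ?case by (simp add: play_prefix_Suc) (simp add: \<rho>'_def H_def)
  qed
  then have "\<rho>' (Suc i) = f (play_prefix \<rho>' i)" if "k \<le> i" for i
    using that by (auto simp: \<rho>'_def H_def Suc_diff_le nat_le_iff_add)
  then show ?thesis by (intro exI[of _ \<rho>']) (simp add: \<rho>'_def)
qed

section \<open>Winning for the two players\<close>

definition pos_edges :: "'v set \<Rightarrow> ('v \<times> 'v) set \<Rightarrow> ('v \<Rightarrow> 'v) \<Rightarrow> ('v \<times> 'v) set" where
  "pos_edges V0 E \<tau> = {(a, b) \<in> E. a \<in> V0 \<longrightarrow> b = \<tau> a}"

definition wins0 :: "'v set \<Rightarrow> ((nat \<Rightarrow> 'v) \<Rightarrow> bool) \<Rightarrow> ('v \<times> 'v) set \<Rightarrow> 'v \<Rightarrow> bool" where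
  "wins0 V0 Obj E x \<longleftrightarrow> (\<exists>\<tau>. (\<forall>a\<in>V0. (a, \<tau> a) \<in> E) \<and>
     (\<forall>\<rho>. path (pos_edges V0 E \<tau>) \<rho> \<longrightarrow> \<rho> 0 = x \<longrightarrow> \<not> Obj \<rho>))"

text \<open>Legality is required on all nonempty lists, not only on histories, so that a strategy
  can be fed suffixes or subsequences of a history.\<close>

definition wins1 :: "'v set \<Rightarrow> ((nat \<Rightarrow> 'v) \<Rightarrow> bool) \<Rightarrow> ('v \<times> 'v) set \<Rightarrow> 'v \<Rightarrow> bool" where
  "wins1 V1 Obj E x \<longleftrightarrow> (\<exists>s. (\<forall>h. h \<noteq> [] \<longrightarrow> last h \<in> V1 \<longrightarrow> (last h, s h) \<in> E) \<and>
     (\<forall>\<rho>. path E \<rho> \<longrightarrow> \<rho> 0 = x \<longrightarrow> follows V1 s \<rho> \<longrightarrow> Obj \<rho>))"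

lemma wins1_one_player:
  assumes tot: "\<And>a. a \<in> V1 \<Longrightarrow> \<exists>b. (a, b) \<in> E"
    and sub: "E \<subseteq> (V0 \<union> V1) \<times> (V0 \<union> V1)"
    and unique: "\<And>a b b'. a \<in> V0 \<Longrightarrow> (a, b) \<in> E \<Longrightarrow> (a, b') \<in> E \<Longrightarrow> b = b'"
    and \<rho>: "path E \<rho>" "\<rho> 0 = x" "Obj \<rho>"
  shows "wins1 V1 Obj E x"
proof -
  \<comment> \<open>The strategy looks only at the time: \<open>length h\<close> is the index of the
    next position of \<rho>. The alternative keeps it legal on lists that do not follow
    \<rho>.\<close>
  define s where "s = (\<lambda>h. if (last h, \<rho> (length h)) \<in> E then \<rho> (length h) else SOME b. (last h, b) \<in> E)"
  have "(last h, s h) \<in> E" if "last h \<in> V1" for h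
    using tot[OF that] by (auto simp: s_def intro: someI_ex)
  moreover have "Obj \<rho>'" if \<rho>': "path E \<rho>'" "\<rho>' 0 = x" "follows V1 s \<rho>'" for \<rho>'
  proof -
    have "\<rho>' k = \<rho> k" for k
    proof (induction k)
      case (Suc k)
      have e: "(\<rho> k, \<rho> (Suc k)) \<in> E" "(\<rho>' k, \<rho>' (Suc k)) \<in> E"
        using \<rho> \<rho>' by (auto simp: path_def)
      show ?case
      proof (cases "\<rho> k \<in> V0")
        case True
        then show ?thesis using unique e Suc by metis
      next
        case False
        then have "\<rho>' k \<in> V1" using e(1) sub Suc by auto
        then show ?thesis using \<rho>'(3) e Suc by (simp add: follows_def s_def)
      qed
    qed (use \<rho> \<rho>' in simp)
    then show ?thesis using \<rho>(3) by presburger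
  qed
  ultimately show ?thesis unfolding wins1_def by blast
qed

text \<open>Player 1 wins against both halves of the choice at \<open>u\<close> by playing the two winning
  strategies on separate threads.\<close>

lemma wins1_threads:
  assumes u: "u \<notin> V1"
    and w: "\<And>j. wins1 V1 (\<lambda>\<rho>. \<forall>w\<in>W. nonneg_mean w \<rho>) {(a, b) \<in> E. a = u \<longrightarrow> (b = t) = j} u"
  shows "wins1 V1 (\<lambda>\<rho>. \<forall>w\<in>W. nonneg_mean w \<rho>) E u"
proof -
  define Q where "Q = (\<lambda>j s. (\<forall>h. h \<noteq> [] \<longrightarrow> last h \<in> V1 \<longrightarrow> (last h, s h) \<in> {(a, b) \<in> E. a = u \<longrightarrow> (b = t) = j}) \<and>
    (\<forall>\<rho>. path {(a, b) \<in> E. a = u \<longrightarrow> (b = t) = j} \<rho> \<longrightarrow> \<rho> 0 = u \<longrightarrow> follows V1 s \<rho> \<longrightarrow> (\<forall>w\<in>W. nonneg_mean w \<rho>)))"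
  have "\<forall>j. \<exists>s. Q j s" using w unfolding wins1_def Q_def by blast
  then obtain s where Q: "\<forall>j. Q j (s j)" by (rule choice[THEN exE])
  have legal: "(last h, s j h) \<in> {(a, b) \<in> E. a = u \<longrightarrow> (b = t) = j}" if "h \<noteq> []" "last h \<in> V1" for j h
    using Q[rule_format, of j] that unfolding Q_def by presburger
  have win: "nonneg_mean w \<rho>" if "path {(a, b) \<in> E. a = u \<longrightarrow> (b = t) = j} \<rho>" "\<rho> 0 = u" "follows V1 (s j) \<rho>"
    "w \<in> W" for j \<rho> w
    using Q[rule_format, of j, unfolded Q_def, THEN conjunct2, rule_format, OF that] .
  have "(last h, thread_strategy u t s h) \<in> E" if "h \<noteq> []" "last h \<in> V1" for h
    using legal[of "_ @ [last h]"] that unfolding thread_strategy_def Let_def by fastforce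
  moreover have "nonneg_mean w \<rho>"
    if \<rho>: "path E \<rho>" "\<rho> 0 = u" "follows V1 (thread_strategy u t s) \<rho>" and "w \<in> W" for \<rho> w
  proof (rule nonneg_mean_shuffle[of "thread_steps u t \<rho>"])
    show "thread_steps u t \<rho> True \<union> thread_steps u t \<rho> False = UNIV"
      "thread_steps u t \<rho> True \<inter> thread_steps u t \<rho> False = {}"
      by (auto simp: mem_thread_steps)
  next
    fix j m assume "infinite (thread_steps u t \<rho> j)"
    then show "\<rho> (enumerate (thread_steps u t \<rho> j) (Suc m)) = \<rho> (Suc (enumerate (thread_steps u t \<rho> j) m))"
      by (rule thread_step)
  next
    fix j assume inf: "infinite (thread_steps u t \<rho> j)"
    let ?e = "enumerate (thread_steps u t \<rho> j)"
    show "nonneg_mean w (\<lambda>m. \<rho> (?e m))"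
    proof (rule win[OF _ _ _ \<open>w \<in> W\<close>])
      show "\<rho> (?e 0) = u" using thread_start[OF inf \<rho>(2)] .
      show "follows V1 (s j) (\<lambda>m. \<rho> (?e m))" using thread_follows[OF \<rho>(3) u \<rho>(2) inf] .
      \<comment> \<open>A visit to \<open>u\<close> is counted for the thread named by the edge
        taken there, so thread \<open>j\<close> uses at \<open>u\<close> only edges of half
        \<open>j\<close>.\<close>
      have "(\<rho> (?e m), \<rho> (Suc (?e m))) \<in> {(a, b) \<in> E. a = u \<longrightarrow> (b = t) = j}" for m
        using \<rho>(1) thread_at_u[of \<rho> u "?e m" t, OF \<rho>(2)] enumerate_in_set[OF inf, of m]
        by (auto simp: path_def mem_thread_steps)
      then show "path {(a, b) \<in> E. a = u \<longrightarrow> (b = t) = j} (\<lambda>m. \<rho> (?e m))"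
        unfolding path_def thread_step[OF inf] by blast
    qed
  qed
  ultimately show ?thesis unfolding wins1_def by blast
qed

text \<open>Player 1 follows the strategy for \<open>E'\<close> until the first visit of
  \<open>u\<close>, then the strategy for \<open>u\<close>, applied to the history cut at this visit
  by \<open>dropWhile\<close>. Without a visit the play stays in \<open>E'\<close>; with one, prefix
  independence decides.\<close>

lemma wins1_via:
  assumes shift: "\<And>\<rho> k. Obj (\<lambda>i. \<rho> (i + k)) \<longleftrightarrow> Obj \<rho>"
    and u: "wins1 V1 Obj E u" and x: "wins1 V1 Obj E' x"
    and E': "E' \<subseteq> E" "\<And>a b. (a, b) \<in> E \<Longrightarrow> a \<noteq> u \<Longrightarrow> (a, b) \<in> E'"
  shows "wins1 V1 Obj E x"
proof -
  obtain s where s: "\<And>h. h \<noteq> [] \<Longrightarrow> last h \<in> V1 \<Longrightarrow> (last h, s h) \<in> E'"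
    "\<And>\<rho>. path E' \<rho> \<Longrightarrow> \<rho> 0 = x \<Longrightarrow> follows V1 s \<rho> \<Longrightarrow> Obj \<rho>"
    using x unfolding wins1_def by metis
  obtain r where r: "\<And>h. h \<noteq> [] \<Longrightarrow> last h \<in> V1 \<Longrightarrow> (last h, r h) \<in> E"
    "\<And>\<rho>. path E \<rho> \<Longrightarrow> \<rho> 0 = u \<Longrightarrow> follows V1 r \<rho> \<Longrightarrow> Obj \<rho>"
    using u unfolding wins1_def by metis
  define q where "q = (\<lambda>h. if u \<in> set h then r (dropWhile (\<lambda>a. a \<noteq> u) h) else s h)"
  have "(last h, q h) \<in> E" if h: "h \<noteq> []" "last h \<in> V1" for h
  proof (cases "u \<in> set h")
    case True
    then have "dropWhile (\<lambda>a. a \<noteq> u) h \<noteq> []" by auto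
    moreover from this have "last (dropWhile (\<lambda>a. a \<noteq> u) h) = last h"
      by (metis last_appendR takeWhile_dropWhile_id)
    ultimately show ?thesis using r(1) h True by (metis q_def)
  qed (use s(1) h E' in \<open>auto simp: q_def\<close>)
  moreover have "Obj \<rho>" if \<rho>: "path E \<rho>" "\<rho> 0 = x" "follows V1 q \<rho>" for \<rho>
  proof (cases "\<exists>k. \<rho> k = u")
    case False
    then have "u \<notin> set (play_prefix \<rho> k)" for k by (auto simp: play_prefix_def)
    then have "follows V1 s \<rho>" using \<rho>(3) by (simp add: follows_def q_def)
    moreover have "path E' \<rho>" using \<rho>(1) False E' by (auto simp: path_def)
    ultimately show ?thesis using s(2) \<rho>(2) by blast
  next
    case True
    define k where "k = (LEAST k. \<rho> k = u)"
    have k: "\<rho> k = u" "\<And>i. i < k \<Longrightarrow> \<rho> i \<noteq> u"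
      using True unfolding k_def by (auto intro: LeastI_ex dest: not_less_Least)
    have q: "q (play_prefix \<rho> (k + i)) = r (play_prefix (\<lambda>i. \<rho> (i + k)) i)" for i
    proof -
      have "hd (play_prefix (\<lambda>i. \<rho> (i + k)) i) = u"
        by (simp add: hd_conv_nth k)
      then have "u \<in> set (play_prefix (\<lambda>i. \<rho> (i + k)) i)"
        "dropWhile (\<lambda>a. a \<noteq> u) (play_prefix (\<lambda>i. \<rho> (i + k)) i) = play_prefix (\<lambda>i. \<rho> (i + k)) i"
        using list.set_sel(1)[OF play_prefix_neq_Nil] by (metis, simp add: dropWhile_eq_self_iff)
      moreover have "dropWhile (\<lambda>a. a \<noteq> u) (map \<rho> [0..<k] @ h) = dropWhile (\<lambda>a. a \<noteq> u) h" for h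
        by (rule dropWhile_append2) (use k(2) in fastforce)
      ultimately show ?thesis unfolding play_prefix_shift q_def by simp
    qed
    have "follows V1 r (\<lambda>i. \<rho> (i + k))"
      using \<rho>(3) q unfolding follows_def by (metis add.commute add_Suc)
    moreover have "path E (\<lambda>i. \<rho> (i + k))" using \<rho>(1) by (simp add: path_def)
    ultimately have "Obj (\<lambda>i. \<rho> (i + k))" using r(2)[of "\<lambda>i. \<rho> (i + k)"] k(1) by simp
    then show ?thesis using shift by simp
  qed
  ultimately show ?thesis unfolding wins1_def by blast
qed

text \<open>The strategy that wins from \<open>x\<close> in \<open>E'\<close> also wins in
  \<open>E\<close>, because its plays never reach \<open>u\<close>: up to the first visit they would
  lie in \<open>E'\<close>, and from \<open>u\<close> Player 0 could win inside
  \<open>E'\<close>.\<close>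

lemma wins1_avoiding:
  assumes shift: "\<And>\<rho> k. Obj (\<lambda>i. \<rho> (i + k)) \<longleftrightarrow> Obj \<rho>"
    and sub: "E \<subseteq> (V0 \<union> V1) \<times> (V0 \<union> V1)" and disj: "V0 \<inter> V1 = {}"
    and u: "wins0 V0 Obj E' u" and x: "wins1 V1 Obj E' x"
    and E': "E' \<subseteq> E" "\<And>a b. (a, b) \<in> E \<Longrightarrow> a \<noteq> u \<Longrightarrow> (a, b) \<in> E'"
  shows "wins1 V1 Obj E x"
proof -
  obtain s where s: "\<And>h. h \<noteq> [] \<Longrightarrow> last h \<in> V1 \<Longrightarrow> (last h, s h) \<in> E'"
    "\<And>\<rho>. path E' \<rho> \<Longrightarrow> \<rho> 0 = x \<Longrightarrow> follows V1 s \<rho> \<Longrightarrow> Obj \<rho>"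
    using x unfolding wins1_def by metis
  obtain \<tau> where \<tau>: "\<And>a. a \<in> V0 \<Longrightarrow> (a, \<tau> a) \<in> E'"
    "\<And>\<rho>. path (pos_edges V0 E' \<tau>) \<rho> \<Longrightarrow> \<rho> 0 = u \<Longrightarrow> \<not> Obj \<rho>"
    using u unfolding wins0_def by metis
  have "Obj \<rho>" if \<rho>: "path E \<rho>" "\<rho> 0 = x" "follows V1 s \<rho>" for \<rho>
  proof (cases "\<exists>k. \<rho> k = u")
    case False
    then have "path E' \<rho>" using \<rho>(1) E' by (auto simp: path_def)
    then show ?thesis using s(2) \<rho> by blast
  next
    case True
    define k where "k = (LEAST k. \<rho> k = u)"
    have k: "\<rho> k = u" "\<And>i. i < k \<Longrightarrow> \<rho> i \<noteq> u"
      using True unfolding k_def by (auto intro: LeastI_ex dest: not_less_Least)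
    \<comment> \<open>The contradictory play: as \<rho> up to the first visit of \<open>u\<close>,
      then \<tau> against \<open>s\<close>, which still sees the whole history.\<close>
    obtain \<rho>' where r1: "\<forall>i\<le>k. \<rho>' i = \<rho> i"
      and r2: "\<forall>i\<ge>k. \<rho>' (Suc i) = (\<lambda>h. if last h \<in> V0 then \<tau> (last h) else s h) (play_prefix \<rho>' i)"
      using run_extend[of k \<rho> "\<lambda>h. if last h \<in> V0 then \<tau> (last h) else s h"] by blast
    have "\<rho>' (Suc i) = (if \<rho>' i \<in> V0 then \<tau> (\<rho>' i) else s (play_prefix \<rho>' i))" if "k \<le> i" for i
      using r2[rule_format, OF that] by simp
    note r = r1[rule_format] this
    have V: "\<rho>' (k + i) \<in> V0 \<union> V1 \<and> (\<rho>' (k + i), \<rho>' (Suc (k + i))) \<in> pos_edges V0 E' \<tau>" for i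
    proof (induction i)
      case 0
      have "u \<in> V0 \<union> V1" using \<rho>(1) sub k(1) unfolding path_def by blast
      then show ?case
        using r(1)[of k] r(2)[of k] k(1) \<tau>(1)[of u] s(1)[of "play_prefix \<rho>' k"] disj
        by (auto simp: pos_edges_def)
    next
      case (Suc i)
      then have "\<rho>' (k + Suc i) \<in> V0 \<union> V1" using E'(1) sub by (auto simp: pos_edges_def)
      then show ?case
        using r(2)[of "k + Suc i"] \<tau>(1)[of "\<rho>' (k + Suc i)"] s(1)[of "play_prefix \<rho>' (k + Suc i)"] disj
        by (auto simp: pos_edges_def)
    qed
    have "path (pos_edges V0 E' \<tau>) (\<lambda>i. \<rho>' (i + k))"
      using V by (simp add: path_def add.commute)
    then have no: "\<not> Obj \<rho>'" using \<tau>(2)[of "\<lambda>i. \<rho>' (i + k)"] r(1)[of k] k(1) shift by simp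
    have "path E' \<rho>'"
      unfolding path_def
    proof
      fix i
      show "(\<rho>' i, \<rho>' (Suc i)) \<in> E'"
      proof (cases "i < k")
        case True
        then show ?thesis using r(1)[of i] r(1)[of "Suc i"] k(2)[of i] \<rho>(1) E'(2) by (simp add: path_def)
      next
        case False
        then show ?thesis using V[of "i - k"] by (simp add: pos_edges_def)
      qed
    qed
    moreover have "follows V1 s \<rho>'"
      unfolding follows_def
    proof (intro allI impI)
      fix i assume i: "\<rho>' i \<in> V1"
      show "\<rho>' (Suc i) = s (play_prefix \<rho>' i)"
      proof (cases "i < k")
        case True
        then have "play_prefix \<rho>' i = play_prefix \<rho> i" using r(1) by (intro play_prefix_cong) simp
        then show ?thesis
          using r(1)[of i] r(1)[of "Suc i"] i True \<rho>(3) by (simp add: follows_def)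
      next
        case False
        then show ?thesis using r(2)[of i] i disj by auto
      qed
    qed
    ultimately have "Obj \<rho>'" using s(2) r(1)[of 0] \<rho>(2) by simp
    then show ?thesis using no by simp
  qed
  then show ?thesis using s(1) E'(1) unfolding wins1_def by blast
qed

text \<open>Induction on the number of edges. At a vertex \<open>u\<close> where Player 0 has a
  choice, its edges are divided into the one to \<open>t\<close> and the others. If Player 0 wins
  from \<open>u\<close> in one half, a winning Player 1 of that half avoids \<open>u\<close>.
  Otherwise Player 1 wins from \<open>u\<close> in both halves, and by interleaving also in the
  whole graph. The positional strategy found may depend on \<open>x\<close>.\<close>

theorem half_positional_determinacy:
  assumes "finite E" and "V0 \<inter> V1 = {}" and "E \<subseteq> (V0 \<union> V1) \<times> (V0 \<union> V1)"
    and "\<And>a. a \<in> V0 \<union> V1 \<Longrightarrow> \<exists>b. (a, b) \<in> E"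
  shows "wins0 V0 (\<lambda>\<rho>. \<forall>w\<in>W. nonneg_mean w \<rho>) E x \<or> wins1 V1 (\<lambda>\<rho>. \<forall>w\<in>W. nonneg_mean w \<rho>) E x"
  using assms
proof (induction "card E" arbitrary: E x rule: less_induct)
  case less
  define Obj where "Obj = (\<lambda>\<rho>. \<forall>w\<in>W. nonneg_mean w \<rho>)"
  have shift: "Obj (\<lambda>i. \<rho> (i + k)) \<longleftrightarrow> Obj \<rho>" for \<rho> k
    by (simp add: Obj_def nonneg_mean_shift)
  show ?case
  proof (cases "\<forall>a\<in>V0. \<forall>b b'. (a, b) \<in> E \<longrightarrow> (a, b') \<in> E \<longrightarrow> b = b'")
    case True
    show ?thesis
    proof (cases "\<exists>\<rho>. path E \<rho> \<and> \<rho> 0 = x \<and> Obj \<rho>")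
      case True': True
      then obtain \<rho> where \<rho>: "path E \<rho>" "\<rho> 0 = x" "Obj \<rho>" by blast
      have "wins1 V1 Obj E x"
        by (rule wins1_one_player[where ?V0.0=V0 and Obj=Obj, OF _ less.prems(3) _ \<rho>]) (use True less.prems(4) in blast)+
      then show ?thesis unfolding Obj_def by blast
    next
      case False
      obtain \<tau> where "\<And>a. a \<in> V0 \<Longrightarrow> (a, \<tau> a) \<in> E" using less.prems(4) by (metis UnI1)
      moreover have "path E \<rho>" if "path (pos_edges V0 E \<tau>) \<rho>" for \<rho>
        using that by (auto simp: path_def pos_edges_def)
      ultimately show ?thesis using False unfolding wins0_def Obj_def by blast
    qed
  next
    case False
    then obtain u t t' where u: "u \<in> V0" "(u, t) \<in> E" "(u, t') \<in> E" "t \<noteq> t'" by blast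
    define sub where "sub = (\<lambda>j. {(a, b) \<in> E. a = u \<longrightarrow> (b = t) = j})"
    have subE: "sub j \<subseteq> E" "\<And>a b. (a, b) \<in> E \<Longrightarrow> a \<noteq> u \<Longrightarrow> (a, b) \<in> sub j" for j
      by (auto simp: sub_def)
    have "(u, if j then t' else t) \<in> E - sub j" for j using u by (auto simp: sub_def)
    then have "card (sub j) < card E" for j
      by (intro psubset_card_mono less.prems(1)) (use subE in blast)
    moreover have "\<exists>b. (a, b) \<in> sub j" if "a \<in> V0 \<union> V1" for a j
    proof (cases "a = u")
      case True
      have "(u, if j then t else t') \<in> sub j" using u by (auto simp: sub_def)
      then show ?thesis using True by blast
    qed (use less.prems(4)[OF that] subE(2) in blast)
    ultimately have IH: "wins0 V0 Obj (sub j) y \<or> wins1 V1 Obj (sub j) y" for j y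
      unfolding Obj_def using less.prems(2,3) subE(1) finite_subset[OF subE(1) less.prems(1)]
      by (intro less.hyps) blast+
    have up: "wins0 V0 Obj E y" if win: "wins0 V0 Obj (sub j) y" for j y
    proof -
      obtain \<tau> where \<tau>: "\<And>a. a \<in> V0 \<Longrightarrow> (a, \<tau> a) \<in> sub j"
        "\<And>\<rho>. path (pos_edges V0 (sub j) \<tau>) \<rho> \<Longrightarrow> \<rho> 0 = y \<Longrightarrow> \<not> Obj \<rho>"
        using win unfolding wins0_def by metis
      \<comment> \<open>Once \<tau> is fixed, the edges at \<open>u\<close> outside the half are
        gone anyway, since \<tau> chooses inside it.\<close>
      have "pos_edges V0 E \<tau> \<subseteq> pos_edges V0 (sub j) \<tau>"
        using \<tau>(1) subE(2) u(1) unfolding pos_edges_def by blast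
      then have "path (pos_edges V0 (sub j) \<tau>) \<rho>" if "path (pos_edges V0 E \<tau>) \<rho>" for \<rho>
        using that unfolding path_def by blast
      then show ?thesis using \<tau> subE(1) unfolding wins0_def by blast
    qed
    show ?thesis
    proof (cases "\<exists>j. wins0 V0 Obj (sub j) u")
      case True
      then obtain j where "wins0 V0 Obj (sub j) u" by blast
      moreover have "wins0 V0 Obj (sub j) x \<or> wins1 V1 Obj (sub j) x" by (rule IH)
      moreover have "wins0 V0 Obj (sub j) x \<Longrightarrow> wins0 V0 Obj E x" by (rule up)
      ultimately have "wins0 V0 Obj E x \<or> wins1 V1 Obj E x"
        using 
          wins1_avoiding[where Obj=Obj, OF shift less.prems(3,2) _ _ subE, of j u x] by blast
      then show ?thesis unfolding Obj_def .
    next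
      case False
      then have "wins1 V1 Obj (sub j) u" for j using IH by blast
      then have "wins1 V1 Obj E u"
        using wins1_threads[of u V1 W E t] u(1) less.prems(2) unfolding Obj_def sub_def by blast
      moreover have "wins0 V0 Obj (sub True) x \<or> wins1 V1 Obj (sub True) x" by (rule IH)
      moreover have "wins0 V0 Obj (sub True) x \<Longrightarrow> wins0 V0 Obj E x" by (rule up)
      ultimately have "wins0 V0 Obj E x \<or> wins1 V1 Obj E x"
        using  wins1_via[where Obj=Obj, OF shift _ _ subE, of V1 u True x]
        by blast
      then show ?thesis unfolding Obj_def .
    qed
  qed
qed

section \<open>Closed walks and averages\<close>

primrec walk :: "('v \<times> 'v) set \<Rightarrow> 'v \<Rightarrow> ('v \<times> 'v) list \<Rightarrow> 'v \<Rightarrow> bool" where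
  "walk E a [] b \<longleftrightarrow> a = b"
| "walk E a (e # p) b \<longleftrightarrow> e \<in> E \<and> fst e = a \<and> walk E (snd e) p b"

abbreviation wsum :: "('v \<times> 'v \<Rightarrow> 'a::comm_monoid_add) \<Rightarrow> ('v \<times> 'v) list \<Rightarrow> 'a" where
  "wsum w p \<equiv> sum_list (map w p)"

definition cycles :: "('v \<times> 'v) set \<Rightarrow> nat \<Rightarrow> 'v \<Rightarrow> ('v \<times> 'v) list set" where
  "cycles E n a = {p. walk E a p a \<and> p \<noteq> [] \<and> length p \<le> n}"

text \<open>A play from \<open>u\<close> can combine cycles through \<open>a\<close> and
  \<open>b\<close> in any proportion exactly when both vertices lie in one strongly connected part
  reachable from \<open>u\<close>.\<close>

definition linked :: "('v \<times> 'v) set \<Rightarrow> 'v \<Rightarrow> 'v \<Rightarrow> 'v \<Rightarrow> bool" where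
  "linked E u a b \<longleftrightarrow> (u, a) \<in> E\<^sup>* \<and> (a, b) \<in> E\<^sup>* \<and> (b, a) \<in> E\<^sup>*"

lemma walk_append: "walk E a (p @ q) c \<longleftrightarrow> (\<exists>b. walk E a p b \<and> walk E b q c)"
  by (induction p arbitrary: a) auto

lemma walk_mono: "walk E a p b \<Longrightarrow> E \<subseteq> E' \<Longrightarrow> walk E' a p b"
  by (induction p arbitrary: a) auto

lemma walk_subset: "walk E a p b \<Longrightarrow> set p \<subseteq> E"
  by (induction p arbitrary: a) auto

lemma walk_power: "walk E a p a \<Longrightarrow> walk E a (concat (replicate k p)) a"
  by (induction k) (auto simp: walk_append)

lemma wsum_power:
  fixes w :: "'v \<times> 'v \<Rightarrow> real" shows "wsum w (concat (replicate k p)) = real k * wsum w p"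
  by (induction k) (simp_all add: algebra_simps)

lemma rtrancl_iff_walk: "(a, b) \<in> E\<^sup>* \<longleftrightarrow> (\<exists>p. walk E a p b)"
proof
  assume "(a, b) \<in> E\<^sup>*"
  then show "\<exists>p. walk E a p b"
  proof (induction rule: converse_rtrancl_induct)
    case base
    show ?case by (rule exI[of _ "[]"]) simp
  next
    case (step a c)
    then obtain p where "walk E c p b" by blast
    then show ?case using step by (intro exI[of _ "(a, c) # p"]) simp
  qed
next
  have "walk E a p b \<Longrightarrow> (a, b) \<in> E\<^sup>*" for p
    by (induction p arbitrary: a) (auto intro: converse_rtrancl_into_rtrancl)
  then show "\<exists>p. walk E a p b \<Longrightarrow> (a, b) \<in> E\<^sup>*" by blast
qed

lemma walk_split:
  assumes "walk E a p b" "i < length p"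
  shows "walk E a (take i p) (fst (p ! i))" "walk E (fst (p ! i)) (drop i p) b"
proof -
  obtain c where c: "walk E a (take i p) c" "walk E c (drop i p) b"
    using assms walk_append[of E a "take i p" "drop i p" b] by auto
  moreover have "drop i p = p ! i # drop (Suc i) p" using assms(2) by (simp add: Cons_nth_drop_Suc)
  ultimately have "c = fst (p ! i)" by simp
  then show "walk E a (take i p) (fst (p ! i))" "walk E (fst (p ! i)) (drop i p) b" using c by auto
qed

lemma walk_nth:
  assumes "walk E a p b" "i < length p"
  shows "p ! i \<in> E" "snd (p ! i) = (if Suc i < length p then fst (p ! Suc i) else b)"
proof -
  show "p ! i \<in> E" using walk_subset[OF assms(1)] assms(2) by auto
  have "walk E (fst (p ! i)) (p ! i # drop (Suc i) p) b"
    using walk_split(2)[OF assms] assms(2) by (simp add: Cons_nth_drop_Suc)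
  then have "walk E (snd (p ! i)) (drop (Suc i) p) b" by simp
  then show "snd (p ! i) = (if Suc i < length p then fst (p ! Suc i) else b)"
    by (cases "Suc i < length p") (auto simp flip: Cons_nth_drop_Suc)
qed

lemma walk_path: "path E \<rho> \<Longrightarrow> walk E (\<rho> i) (map (\<lambda>k. (\<rho> k, \<rho> (Suc k))) [i..<i + n]) (\<rho> (i + n))"
  by (induction n) (auto simp: walk_append path_def)

text \<open>The assumptions say that neither a point of \<open>S\<close> nor a segment between two
  of them meets the open positive quadrant; in the plane this suffices for separation. The
  functional is the one that vanishes at the point with \<open>X > 0\<close> and largest slope
  \<open>Y / X\<close>.\<close>

lemma separate_from_quadrant:
  fixes S :: "(real \<times> real) set"
  assumes S: "finite S"
    and 1: "\<And>X Y. (X, Y) \<in> S \<Longrightarrow> \<not> (X > 0 \<and> Y > 0)"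
    and 2: "\<And>X Y X' Y'. (X, Y) \<in> S \<Longrightarrow> (X', Y') \<in> S \<Longrightarrow> X > 0 \<Longrightarrow> X' \<le> 0 \<Longrightarrow> Y' > 0 \<Longrightarrow> X * Y' \<le> X' * Y"
  shows "\<exists>\<alpha> \<beta>. 0 \<le> \<alpha> \<and> 0 \<le> \<beta> \<and> 0 < \<alpha> + \<beta> \<and> (\<forall>(X, Y)\<in>S. \<alpha> * X + \<beta> * Y \<le> 0)"
proof (cases "\<exists>(X, Y)\<in>S. X > 0")
  case False
  then show ?thesis by (intro exI[of _ 1] exI[of _ 0]) auto
next
  case True
  let ?P = "{p \<in> S. fst p > 0}"
  have "finite ?P" "?P \<noteq> {}" using S True by auto
  then obtain p where "is_arg_min (\<lambda>p. - (snd p / fst p)) (\<lambda>p. p \<in> ?P) p"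
    using ex_is_arg_min_if_finite by blast
  moreover obtain X Y where p: "p = (X, Y)" by (cases p)
  ultimately have P: "(X, Y) \<in> S" "X > 0"
    and min: "\<And>X' Y'. (X', Y') \<in> S \<Longrightarrow> X' > 0 \<Longrightarrow> Y' / X' \<le> Y / X"
    by (fastforce simp: is_arg_min_linorder)+
  have Y: "Y \<le> 0" using 1[OF P(1)] P(2) by auto
  have "- Y * X' + X * Y' \<le> 0" if S': "(X', Y') \<in> S" for X' Y'
  proof (cases "X' > 0")
    case True
    then show ?thesis using min[OF S'] P(2) by (simp add: field_simps)
  next
    case False
    show ?thesis
    proof (cases "Y' > 0")
      case True
      then show ?thesis using 2[OF P(1) S' P(2)] False by (simp add: algebra_simps)
    next
      case F: False
      have "0 \<le> Y * X'" "X * Y' \<le> 0"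
        using False F Y P(2) by (auto intro: mult_nonpos_nonpos mult_nonneg_nonpos)
      then show ?thesis by simp
    qed
  qed
  then show ?thesis using P(2) Y by (intro exI[of _ "- Y"] exI[of _ X]) auto
qed

text \<open>Cutting out a short closed piece does not decrease the weight; what remains at the end
  has at most \<open>n\<close> edges, each of weight at most \<open>B\<close>.\<close>

lemma wsum_le_of_cycles:
  fixes w :: "'v \<times> 'v \<Rightarrow> real"
  assumes R: "finite R" "E \<subseteq> R \<times> R" "card R \<le> n"
    and cyc: "\<And>a p. a \<in> R \<Longrightarrow> p \<in> cycles E n a \<Longrightarrow> wsum w p \<le> 0"
    and B: "\<And>e. e \<in> E \<Longrightarrow> w e \<le> B" "0 \<le> B"
  shows "walk E a p b \<Longrightarrow> wsum w p \<le> real n * B"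
proof (induction "length p" arbitrary: p rule: less_induct)
  case less
  show ?case
  proof (cases "length p \<le> n")
    case True
    have "wsum w p \<le> wsum (\<lambda>_. B) p"
      using walk_subset[OF less.prems] B by (intro sum_list_mono) auto
    also have "\<dots> = real (length p) * B" by (simp add: sum_list_triv)
    also have "\<dots> \<le> real n * B" using True B by (intro mult_right_mono) auto
    finally show ?thesis .
  next
    case False
    \<comment> \<open>Pigeonhole on the \<open>n + 1\<close> sources of the edges
      \<open>0..n\<close>: two agree, and the piece between them has at most \<open>n\<close>
      edges.\<close>
    have "fst (p ! i) \<in> R" if "i \<le> n" for i
      using walk_nth(1)[OF less.prems, of i] R(2) False that by auto
    then have "(\<lambda>i. fst (p ! i)) ` {..n} \<subseteq> R" by auto
    then have "card ((\<lambda>i. fst (p ! i)) ` {..n}) \<le> n"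
      using card_mono[OF R(1)] R(3) by (metis le_trans)
    then have "\<not> inj_on (\<lambda>i. fst (p ! i)) {..n}"
      using card_image[of "\<lambda>i. fst (p ! i)" "{..n}"] by auto
    then obtain i j where ij: "i < j" "j \<le> n" "fst (p ! i) = fst (p ! j)"
      unfolding inj_on_def by (metis atMost_iff linorder_neqE_nat)
    let ?c = "take (j - i) (drop i p)"
    have j: "walk E a (take j p) (fst (p ! j))" "walk E (fst (p ! j)) (drop j p) b"
      using walk_split[OF less.prems] ij False by auto
    have tj: "take j p = take i p @ ?c"
      using ij by (metis le_add_diff_inverse less_imp_le take_add)
    have i: "walk E a (take i p) (fst (p ! i))"
      using walk_split[OF less.prems, of i] ij False by auto
    have "walk E (fst (p ! i)) ?c (fst (p ! j))"
      using walk_split(2)[OF j(1), of i] ij False by (simp add: drop_take)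
    then have c: "?c \<in> cycles E n (fst (p ! i))"
      using ij False by (auto simp: cycles_def)
    have "fst (p ! i) \<in> R" using walk_nth(1)[OF less.prems, of i] ij False R(2) by auto
    then have c0: "wsum w ?c \<le> 0" using cyc c by blast
    have "p = take i p @ ?c @ drop j p" using tj by (metis append_assoc append_take_drop_id)
    then have "wsum w p = wsum w (take i p @ ?c @ drop j p)" by (rule arg_cong)
    then have s: "wsum w p = wsum w (take i p @ drop j p) + wsum w ?c"
      by (simp only: map_append sum_list_append add_ac)
    have "walk E a (take i p @ drop j p) b"
      unfolding walk_append using i j(2) ij(3) by metis
    then have "wsum w (take i p @ drop j p) \<le> real n * B"
      using less.hyps[of "take i p @ drop j p"] ij False by simp
    then show ?thesis using s c0 by linarith
  qed
qed

lemma finite_cycles: "finite E \<Longrightarrow> finite (cycles E n a)"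
  by (rule finite_subset[OF _ finite_lists_length_le[of E n]]) (auto simp: cycles_def dest: walk_subset)

text \<open>A play stays eventually inside the set \<open>R\<close> of vertices that it visits infinitely often, and
  all cycles inside \<open>R\<close> have nonpositive weight for a suitable combination of the two weights.\<close>

lemma path_separated:
  fixes x y :: "'v \<times> 'v \<Rightarrow> real"
  assumes V: "finite V" "E \<subseteq> V \<times> V" "card V \<le> n" and \<rho>: "path E \<rho>"
    and 1: "\<And>a p. linked E (\<rho> 0) a a \<Longrightarrow> p \<in> cycles E n a \<Longrightarrow> \<not> (wsum x p > 0 \<and> wsum y p > 0)"
    and 2: "\<And>a b p q. linked E (\<rho> 0) a b \<Longrightarrow> p \<in> cycles E n a \<Longrightarrow> q \<in> cycles E n b \<Longrightarrow>
      wsum x p > 0 \<Longrightarrow> wsum x q \<le> 0 \<Longrightarrow> wsum y q > 0 \<Longrightarrow> wsum x p * wsum y q \<le> wsum x q * wsum y p"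
  shows "\<exists>\<alpha> \<beta> K. 0 \<le> \<alpha> \<and> 0 \<le> \<beta> \<and> 0 < \<alpha> + \<beta> \<and> (\<forall>k. \<alpha> * psum x \<rho> k + \<beta> * psum y \<rho> k \<le> K)"
proof -
  define R where "R = {a. infinite {k. \<rho> k = a}}"
  have \<rho>V: "\<rho> k \<in> V" for k using \<rho> V(2) by (auto simp: path_def)
  have RV: "R \<subseteq> V"
  proof
    fix a assume "a \<in> R"
    then have "{k. \<rho> k = a} \<noteq> {}" unfolding R_def by (metis finite.emptyI mem_Collect_eq)
    then show "a \<in> V" using \<rho>V by auto
  qed
  have "finite (\<Union>a\<in>V - R. {k. \<rho> k = a})" using V(1) by (auto simp: R_def)
  \<comment> \<open>After \<open>k0\<close> only vertices visited infinitely often occur; any two of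
    these are linked.\<close>
  then obtain k0 where k0': "\<forall>k\<in>(\<Union>a\<in>V - R. {k. \<rho> k = a}). k < k0"
    using finite_nat_set_iff_bounded by metis
  have k0: "\<rho> k \<in> R" if "k \<ge> k0" for k
  proof (rule ccontr)
    assume "\<rho> k \<notin> R"
    then have "k \<in> (\<Union>a\<in>V - R. {k. \<rho> k = a})" using \<rho>V[of k] by simp
    then show False using k0' that by (meson leD)
  qed
  have reach: "(\<rho> i, b) \<in> E\<^sup>*" if "b \<in> R" for i b
  proof -
    have "infinite {k. \<rho> k = b}" using that by (simp add: R_def)
    then obtain j where "j \<ge> i" "\<rho> j = b"
      by (metis (mono_tags) infinite_nat_iff_unbounded_le mem_Collect_eq)
    then show ?thesis using walk_path[OF \<rho>, of i "j - i"] by (auto simp: rtrancl_iff_walk)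
  qed
  have linked: "linked E (\<rho> 0) a b" if "a \<in> R" "b \<in> R" for a b
  proof -
    have "\<exists>k. \<rho> k = c" if "c \<in> R" for c
      using that unfolding R_def by (metis (mono_tags) empty_Collect_eq finite.emptyI mem_Collect_eq)
    then show ?thesis using reach that by (metis linked_def)
  qed
  have finE: "finite E" using V finite_subset by blast
  have finR: "finite R" using RV V(1) finite_subset by blast
  let ?C = "\<Union>a\<in>R. cycles E n a"
  obtain \<alpha> \<beta> where ab: "0 \<le> \<alpha>" "0 \<le> \<beta>" "0 < \<alpha> + \<beta>"
    and neg: "\<And>p. p \<in> ?C \<Longrightarrow> \<alpha> * wsum x p + \<beta> * wsum y p \<le> 0"
  proof -
    have "\<exists>\<alpha> \<beta>. 0 \<le> \<alpha> \<and> 0 \<le> \<beta> \<and> 0 < \<alpha> + \<beta> \<and> (\<forall>(X, Y)\<in>(\<lambda>p. (wsum x p, wsum y p)) ` ?C. \<alpha> * X + \<beta> * Y \<le> 0)"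
    proof (rule separate_from_quadrant)
      show "finite ((\<lambda>p. (wsum x p, wsum y p)) ` ?C)"
        using finR finite_cycles[OF finE] by auto
    next
      fix X Y assume "(X, Y) \<in> (\<lambda>p. (wsum x p, wsum y p)) ` ?C"
      then show "\<not> (X > 0 \<and> Y > 0)" using 1 linked by blast
    next
      fix X Y X' Y'
      assume "(X, Y) \<in> (\<lambda>p. (wsum x p, wsum y p)) ` ?C" "(X', Y') \<in> (\<lambda>p. (wsum x p, wsum y p)) ` ?C"
        and s: "X > 0" "X' \<le> 0" "Y' > 0"
      then obtain a b p q where h: "a \<in> R" "b \<in> R" "p \<in> cycles E n a" "q \<in> cycles E n b"
        "X = wsum x p" "Y = wsum y p" "X' = wsum x q" "Y' = wsum y q" by blast
      show "X * Y' \<le> X' * Y"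
        unfolding h(5-8) by (rule 2[OF linked[OF h(1,2)] h(3,4) s[unfolded h(5-8)]])
    qed
    then obtain \<alpha> \<beta> where ab: "0 \<le> \<alpha> \<and> 0 \<le> \<beta> \<and> 0 < \<alpha> + \<beta> \<and>
      (\<forall>(X, Y)\<in>(\<lambda>p. (wsum x p, wsum y p)) ` ?C. \<alpha> * X + \<beta> * Y \<le> 0)"
      by (elim exE)
    then have "\<forall>p\<in>?C. \<alpha> * wsum x p + \<beta> * wsum y p \<le> 0" by simp
    then show ?thesis using ab by (intro that[of \<alpha> \<beta>]) (blast | simp)+
  qed
  define w where "w = (\<lambda>e. \<alpha> * x e + \<beta> * y e)"
  have wsum: "wsum w p = \<alpha> * wsum x p + \<beta> * wsum y p" for p
    by (induction p) (simp_all add: w_def algebra_simps)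
  have psum: "psum w \<rho> k = \<alpha> * psum x \<rho> k + \<beta> * psum y \<rho> k" for k
    by (simp add: psum_def w_def sum.distrib sum_distrib_left)
  \<comment> \<open>The walk bound is applied inside \<open>R\<close>, because only cycles there are
    known to have nonpositive combined weight.\<close>
  let ?E = "E \<inter> R \<times> R"
  define B where "B = (\<Sum>e\<in>E. \<bar>w e\<bar>)"
  have B: "w e \<le> B" if "e \<in> ?E" for e
  proof -
    have "w e \<le> \<bar>w e\<bar>" by simp
    also have "\<dots> \<le> B" unfolding B_def using that finE by (intro member_le_sum) auto
    finally show ?thesis .
  qed
  have "0 \<le> B" unfolding B_def by (rule sum_nonneg) simp
  have bound: "wsum w p \<le> real n * B" if "walk ?E a p b" for a p b
  proof (rule wsum_le_of_cycles[OF finR _ order_trans[OF card_mono[OF V(1) RV] V(3)] _ B \<open>0 \<le> B\<close> that])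
    fix a p assume "a \<in> R" "p \<in> cycles ?E n a"
    then have "p \<in> ?C" by (auto simp: cycles_def intro: walk_mono)
    then show "wsum w p \<le> 0" using neg wsum by simp
  qed auto
  let ?I = "\<Sum>j<k0. \<bar>w (\<rho> j, \<rho> (Suc j))\<bar>"
  have init: "psum w \<rho> k \<le> ?I" if "k \<le> k0" for k
    using psum_ge_init[OF that, of "\<lambda>e. - w e" \<rho>] by (simp add: psum_def sum_negf)
  have "psum w \<rho> k \<le> ?I + real n * B" for k
  proof (cases "k \<le> k0")
    case True
    have "0 \<le> real n * B" using \<open>0 \<le> B\<close> by simp
    then show ?thesis using init[OF True] by linarith
  next
    case False
    then obtain l where l: "k = k0 + l" using nat_le_iff_add nat_le_linear by blast
    have "path ?E (\<lambda>i. \<rho> (i + k0))" using \<rho> k0 by (auto simp: path_def)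
    then have "walk ?E (\<rho> k0) (map (\<lambda>k. (\<rho> (k + k0), \<rho> (Suc k + k0))) [0..<l]) (\<rho> (l + k0))"
      using walk_path[of ?E "\<lambda>i. \<rho> (i + k0)" 0 l] by simp
    from bound[OF this] have "psum w (\<lambda>i. \<rho> (i + k0)) l \<le> real n * B"
      by (simp add: psum_def sum_list_sum_nth comp_def atLeast0LessThan)
    then show ?thesis using init[of k0] psum_add[of w \<rho> k0 l] l by simp
  qed
  then show ?thesis using ab psum by metis
qed

lemma path_Cons:
  assumes "path E \<rho>" "walk E u p (\<rho> 0)"
  shows "\<exists>\<rho>'. path E \<rho>' \<and> \<rho>' 0 = u \<and> (\<lambda>i. \<rho>' (i + length p)) = \<rho>"
  using assms(2)
proof (induction p arbitrary: u)
  case Nil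
  then show ?case using assms(1) by auto
next
  case (Cons e p)
  then obtain \<rho>' where r: "path E \<rho>'" "\<rho>' 0 = snd e" "(\<lambda>i. \<rho>' (i + length p)) = \<rho>" by auto
  have "path E (case_nat u \<rho>')"
    unfolding path_def
  proof
    fix k show "(case_nat u \<rho>' k, case_nat u \<rho>' (Suc k)) \<in> E"
      using r Cons.prems by (cases k) (auto simp: path_def)
  qed
  moreover have "(\<lambda>i. case_nat u \<rho>' (i + length (e # p))) = \<rho>" using r(3) by auto
  ultimately show ?case by (intro exI[of _ "case_nat u \<rho>'"]) simp
qed

text \<open>The play goes to \<open>a\<close> and repeats \<open>r\<close> forever: complete rounds
  contribute nonnegative amounts and an incomplete round a bounded one. The same play serves all
  weight functions at once.\<close>

lemma lasso:
  assumes c: "walk E a r a" "r \<noteq> []" and u: "(u, a) \<in> E\<^sup>*"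
  shows "\<exists>\<rho>. path E \<rho> \<and> \<rho> 0 = u \<and> (\<forall>w :: 'v \<times> 'v \<Rightarrow> real. wsum w r \<ge> 0 \<longrightarrow> nonneg_mean w \<rho>)"
proof -
  let ?n = "length r"
  define \<rho> where "\<rho> = (\<lambda>k. fst (r ! (k mod ?n)))"
  have n: "?n > 0" using c(2) by simp
  have a: "fst (r ! 0) = a" using c by (cases r) auto
  have e: "(\<rho> k, \<rho> (Suc k)) = r ! (k mod ?n)" for k
  proof -
    have "k mod ?n < ?n" using n by simp
    from this walk_nth(2)[OF c(1) this] a show ?thesis
      by (auto simp: \<rho>_def mod_Suc prod_eq_iff split: if_splits)
  qed
  have path: "path E \<rho>"
    unfolding path_def e using walk_nth(1)[OF c(1)] n by simp
  have per: "(\<lambda>i. \<rho> (i + ?n)) = \<rho>" by (simp add: \<rho>_def)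
  have "nonneg_mean w \<rho>" if w: "wsum w r \<ge> 0" for w :: "'v \<times> 'v \<Rightarrow> real"
  proof -
    let ?B = "\<Sum>j<?n. \<bar>w (\<rho> j, \<rho> (Suc j))\<bar>"
    have s: "psum w \<rho> ?n = wsum w r"
      unfolding psum_def e by (simp add: sum_list_sum_nth atLeast0LessThan)
    have lb: "psum w \<rho> k \<ge> - ?B" for k
    proof (induction k rule: less_induct)
      case (less k)
      show ?case
      proof (cases "k \<le> ?n")
        case True then show ?thesis by (rule psum_ge_init)
      next
        case False
        then show ?thesis
          using less[of "k - ?n"] n w psum_add[of w \<rho> ?n "k - ?n"] unfolding per s by simp
      qed
    qed
    have "psum w \<rho> k \<ge> - \<epsilon> * real k - ?B" if "\<epsilon> > 0" for \<epsilon> k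
    proof -
      have "0 \<le> \<epsilon> * real k" using that by simp
      then show ?thesis using lb[of k] by linarith
    qed
    then show ?thesis unfolding nonneg_mean_def by blast
  qed
  moreover obtain p where "walk E u p (\<rho> 0)"
    using u a n by (auto simp: rtrancl_iff_walk \<rho>_def)
  then obtain \<rho>' where r': "path E \<rho>'" "\<rho>' 0 = u" "(\<lambda>i. \<rho>' (i + length p)) = \<rho>"
    using path_Cons[OF path] by blast
  ultimately show ?thesis using nonneg_mean_shift[of _ \<rho>' "length p"] by metis
qed

text \<open>The multiplicities are close to multiples of \<open>Y\<^sub>q - X\<^sub>q\<close> and \<open>X\<^sub>p - Y\<^sub>p\<close>; with these exact
  coefficients both components of the combination equal the cross product.\<close>

lemma combine_cycles:
  fixes x y :: "'v \<times> 'v \<Rightarrow> real"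
  assumes p: "walk E a p a" and q: "walk E b q b" and l: "linked E u a b"
    and s: "wsum x p > 0" "wsum y p \<le> 0" "wsum x q \<le> 0" "wsum y q > 0"
    and cross: "wsum x p * wsum y q > wsum x q * wsum y p"
  shows "\<exists>r. walk E a r a \<and> wsum x r > 0 \<and> wsum y r > 0"
proof -
  obtain g h where g: "walk E a g b" and h: "walk E b h a"
    using l unfolding linked_def rtrancl_iff_walk by blast
  define \<Delta> where "\<Delta> = wsum x p * wsum y q - wsum x q * wsum y p"
  define \<sigma> \<tau> where "\<sigma> = wsum y q - wsum x q" and "\<tau> = wsum x p - wsum y p"
  have pos: "\<Delta> > 0" "\<sigma> \<ge> 0" "\<tau> \<ge> 0" using s cross by (auto simp: \<Delta>_def \<sigma>_def \<tau>_def)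
  define C where "C = (\<lambda>w. \<bar>wsum w p\<bar> + \<bar>wsum w q\<bar> + \<bar>wsum w g\<bar> + \<bar>wsum w h\<bar> :: real)"
  \<comment> \<open>\<open>C\<close> bounds the rounding errors of the multiplicities together with
    the connecting walks \<open>g\<close> and \<open>h\<close>, which occur once; the gain
    \<open>n * \<Delta>\<close> outgrows it.\<close>
  obtain n :: nat where n: "real n * \<Delta> > C x + C y"
    using reals_Archimedean3[OF pos(1)] by blast
  define r where "r = concat (replicate (nat \<lceil>real n * \<sigma>\<rceil>) p) @ g @ concat (replicate (nat \<lceil>real n * \<tau>\<rceil>) q) @ h"
  have walk: "walk E a r a"
    unfolding r_def walk_append using walk_power[OF p] walk_power[OF q] g h by blast
  have ge: "real (nat \<lceil>t\<rceil>) * X \<ge> t * X - \<bar>X\<bar>" if "t \<ge> 0" for t X :: real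
  proof -
    have "0 \<le> real (nat \<lceil>t\<rceil>) - t" "real (nat \<lceil>t\<rceil>) - t \<le> 1" using that by linarith+
    then have "\<bar>(real (nat \<lceil>t\<rceil>) - t) * X\<bar> \<le> \<bar>X\<bar>"
      by (simp add: abs_mult mult_left_le_one_le)
    then show ?thesis by (simp add: left_diff_distrib)
  qed
  have "wsum w r > 0" if "\<sigma> * wsum w p + \<tau> * wsum w q = \<Delta>" "C w \<le> C x + C y" for w
  proof -
    have "wsum w r \<ge> real n * \<sigma> * wsum w p + real n * \<tau> * wsum w q - C w"
      using ge[of "real n * \<sigma>" "wsum w p"] ge[of "real n * \<tau>" "wsum w q"] pos
      by (simp add: r_def wsum_power C_def)
    also have "real n * \<sigma> * wsum w p + real n * \<tau> * wsum w q = real n * \<Delta>"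
      unfolding that(1)[symmetric] by (simp add: algebra_simps)
    finally show ?thesis using n that(2) by linarith
  qed
  moreover have "\<sigma> * wsum x p + \<tau> * wsum x q = \<Delta>" "\<sigma> * wsum y p + \<tau> * wsum y q = \<Delta>"
    unfolding \<sigma>_def \<tau>_def \<Delta>_def by (simp_all add: algebra_simps)
  moreover have "C x \<le> C x + C y" "C y \<le> C x + C y" by (simp_all add: C_def)
  ultimately show ?thesis using walk by blast
qed

section \<open>Mean payoffs and outcomes\<close>

abbreviation shifted :: "('v \<times> 'v \<Rightarrow> int) \<Rightarrow> real \<Rightarrow> 'v \<times> 'v \<Rightarrow> real" where
  "shifted w a \<equiv> (\<lambda>e. real_of_int (w e) - a)"

lemma psum_shifted: "psum (shifted w a) \<pi> k = psum (shifted w b) \<pi> k + (b - a) * real k"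
  by (simp add: psum_def sum_subtractf algebra_simps)

section \<open>Mean payoffs as growth of partial sums\<close>

lemma mean_payoff_psum:
  "mean_payoff w \<pi> = liminf (\<lambda>k. ereal (psum (shifted w 0) \<pi> k / real k))"
  unfolding mean_payoff_def
  by (intro arg_cong[where f=liminf]) (simp add: history_weight_def psum_def)

lemma mean_payoff_ge_iff: "ereal a \<le> mean_payoff w \<pi> \<longleftrightarrow> nonneg_mean (shifted w a) \<pi>"
proof
  assume L: "ereal a \<le> mean_payoff w \<pi>"
  show "nonneg_mean (shifted w a) \<pi>"
    unfolding nonneg_mean_def
  proof (intro allI impI)
    fix \<epsilon> :: real assume e: "\<epsilon> > 0"
    have "ereal (a - \<epsilon>) < ereal a" using e by simp
    then have "\<forall>\<^sub>F k in sequentially. ereal (a - \<epsilon>) < ereal (psum (shifted w 0) \<pi> k / real k)"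
      using L unfolding mean_payoff_psum le_Liminf_iff by blast
    then obtain n where n: "\<And>k. k \<ge> n \<Longrightarrow> a - \<epsilon> < psum (shifted w 0) \<pi> k / real k"
      by (auto simp: eventually_sequentially)
    \<comment> \<open>Covering the times up to \<open>Suc n\<close> also keeps \<open>k\<close>
      positive in the remaining case, where the quotient by \<open>k\<close> is cleared.\<close>
    let ?B = "\<Sum>j<Suc n. \<bar>shifted w a (\<pi> j, \<pi> (Suc j))\<bar>"
    have "psum (shifted w a) \<pi> k \<ge> - \<epsilon> * real k - ?B" for k
    proof (cases "k \<le> Suc n")
      case True
      have "0 \<le> \<epsilon> * real k" using e by simp
      then show ?thesis using psum_ge_init[OF True, of "shifted w a" \<pi>] by linarith
    next
      case False
      then have "(a - \<epsilon>) * real k \<le> psum (shifted w 0) \<pi> k"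
        using n[of k] by (simp add: pos_less_divide_eq)
      moreover have "0 \<le> ?B" by (intro sum_nonneg) simp
      moreover have "psum (shifted w a) \<pi> k = psum (shifted w 0) \<pi> k - a * real k"
        using psum_shifted[of w a \<pi> k 0] by simp
      ultimately show ?thesis by (simp only: left_diff_distrib minus_mult_left[symmetric])
    qed
    then show "\<exists>K. \<forall>k. psum (shifted w a) \<pi> k \<ge> - \<epsilon> * real k - K" by blast
  qed
next
  assume R: "nonneg_mean (shifted w a) \<pi>"
  show "ereal a \<le> mean_payoff w \<pi>"
    unfolding mean_payoff_psum le_Liminf_iff
  proof (intro allI impI)
    fix y assume y: "y < ereal a"
    then obtain b where b: "y < ereal b" "b < a" using ereal_dense2[OF y] by auto
    define \<epsilon> where "\<epsilon> = (a - b) / 2"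
    have e: "\<epsilon> > 0" using b by (simp add: \<epsilon>_def)
    then obtain K where K: "\<And>k. psum (shifted w a) \<pi> k \<ge> - \<epsilon> * real k - K"
      using R unfolding nonneg_mean_def by blast
    obtain n :: nat where n: "real n * \<epsilon> > K" using reals_Archimedean3[OF e] by blast
    have "y < ereal (psum (shifted w 0) \<pi> k / real k)" if "k \<ge> Suc n" for k
    proof -
      have "real n * \<epsilon> \<le> real k * \<epsilon>" using that e by (intro mult_right_mono) auto
      then have "- \<epsilon> * real k - K \<ge> - 2 * \<epsilon> * real k" using n by (simp add: mult.commute)
      moreover have "- 2 * \<epsilon> * real k = b * real k - a * real k"
        by (simp add: \<epsilon>_def field_simps)
      moreover have "psum (shifted w 0) \<pi> k = psum (shifted w a) \<pi> k + a * real k"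
        using psum_shifted[of w 0 \<pi> k a] by simp
      ultimately have "psum (shifted w 0) \<pi> k \<ge> b * real k"
        using K[of k] by linarith
      then have "b \<le> psum (shifted w 0) \<pi> k / real k"
        using that by (simp add: pos_le_divide_eq)
      then show ?thesis using b(1) by (meson ereal_less_eq(3) less_le_trans)
    qed
    then show "\<forall>\<^sub>F k in sequentially. y < ereal (psum (shifted w 0) \<pi> k / real k)"
      unfolding eventually_sequentially by blast
  qed
qed

text \<open>Positivity of the upper mean. It is what remains of a payoff below \<open>c\<close>
  after passing to \<open>c - w\<close>: linear growth, but only along infinitely many
  times.\<close>

definition steep :: "('v \<times> 'v \<Rightarrow> real) \<Rightarrow> (nat \<Rightarrow> 'v) \<Rightarrow> bool" where
  "steep w \<pi> \<longleftrightarrow> (\<exists>\<epsilon>>0. \<forall>K. \<exists>k. psum w \<pi> k > \<epsilon> * real k + K)"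

lemma mean_payoff_less_steep:
  assumes "mean_payoff w \<pi> < ereal c" shows "steep (\<lambda>e. c - real_of_int (w e)) \<pi>"
proof -
  have "\<not> nonneg_mean (shifted w c) \<pi>" using assms by (simp flip: mean_payoff_ge_iff)
  then obtain \<epsilon> where e: "\<epsilon> > 0" "\<And>K. \<exists>k. psum (shifted w c) \<pi> k < - \<epsilon> * real k - K"
    unfolding nonneg_mean_def by (auto simp: not_le)
  have "psum (\<lambda>e. c - real_of_int (w e)) \<pi> k = - psum (shifted w c) \<pi> k" for k
    by (simp add: psum_def sum_subtractf)
  then have "psum (\<lambda>e. c - real_of_int (w e)) \<pi> k > \<epsilon> * real k + K"
    if "psum (shifted w c) \<pi> k < - \<epsilon> * real k - K" for k K
    using that by simp
  then show ?thesis using e unfolding steep_def by blast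
qed

lemma mean_payoff_gt_linear:
  assumes "ereal d < mean_payoff w \<pi>"
  shows "\<exists>\<epsilon> K. \<epsilon> > 0 \<and> (\<forall>k. psum (shifted w d) \<pi> k \<ge> \<epsilon> * real k - K)"
proof -
  obtain a where a: "d < a" "ereal a < mean_payoff w \<pi>"
    using ereal_dense2[OF assms] by auto
  then have "nonneg_mean (shifted w a) \<pi>" by (simp flip: mean_payoff_ge_iff)
  then obtain K where K: "\<And>k. psum (shifted w a) \<pi> k \<ge> - ((a - d) / 2) * real k - K"
    unfolding nonneg_mean_def using a(1) by (metis diff_gt_0_iff_gt half_gt_zero)
  have "psum (shifted w d) \<pi> k \<ge> (a - d) / 2 * real k - K" for k
    using K[of k] psum_shifted[of w d \<pi> k a] by (simp add: algebra_simps add_divide_distrib diff_divide_distrib)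
  then show ?thesis using a(1) by (metis diff_gt_0_iff_gt half_gt_zero)
qed

lemma linear_steep:
  assumes "\<epsilon> > 0" "\<And>k. psum w \<pi> k \<ge> \<epsilon> * real k - K" shows "steep w \<pi>"
  unfolding steep_def
proof (intro exI[of _ "\<epsilon> / 2"] conjI allI)
  fix K'
  obtain k :: nat where "real k * (\<epsilon> / 2) > K' + K"
    using reals_Archimedean3[of "\<epsilon> / 2"] assms(1) half_gt_zero by blast
  then have "psum w \<pi> k > \<epsilon> / 2 * real k + K'" using assms(2)[of k] by (simp add: mult.commute)
  then show "\<exists>k. psum w \<pi> k > \<epsilon> / 2 * real k + K'" by blast
qed (use assms in simp)

text \<open>The growth of \<open>y\<close> holds at all times, hence also at those where
  \<open>x\<close> is large; there the combination passes every bound. This is why linear growth is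
  demanded of one of the two weights only. If \<alpha> is \<open>0\<close>, the growth of
  \<open>y\<close> alone suffices.\<close>

lemma not_separated:
  assumes ab: "0 \<le> \<alpha>" "0 \<le> \<beta>" "0 < \<alpha> + \<beta>"
    and K: "\<And>k. \<alpha> * psum x \<pi> k + \<beta> * psum y \<pi> k \<le> K"
    and x: "steep x \<pi>" and y: "\<epsilon> > 0" "\<And>k. psum y \<pi> k \<ge> \<epsilon> * real k - L"
  shows False
proof (cases "\<alpha> = 0")
  case True
  obtain k :: nat where "real k * \<epsilon> > K / \<beta> + L" using reals_Archimedean3[OF y(1)] by blast
  then have "psum y \<pi> k > K / \<beta>" using y(2)[of k] by (simp add: mult.commute)
  then have "\<beta> * psum y \<pi> k > K" using True ab by (simp add: pos_divide_less_eq mult.commute)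
  then show False using K[of k] True by simp
next
  case False
  then have a: "\<alpha> > 0" using ab by simp
  obtain \<eta> where e: "\<eta> > 0" "\<And>C. \<exists>k. psum x \<pi> k > \<eta> * real k + C"
    using x unfolding steep_def by blast
  obtain k where "psum x \<pi> k > \<eta> * real k + (K + \<beta> * L) / \<alpha>" using e(2) by blast
  moreover have "0 \<le> \<eta> * real k" using e(1) by simp
  ultimately have "psum x \<pi> k > (K + \<beta> * L) / \<alpha>" by linarith
  then have "\<alpha> * psum x \<pi> k > K + \<beta> * L" using a by (simp add: pos_divide_less_eq mult.commute)
  moreover have "0 \<le> \<epsilon> * real k" using y(1) by simp
  then have "psum y \<pi> k \<ge> - L" using y(2)[of k] by linarith
  then have "\<beta> * psum y \<pi> k \<ge> \<beta> * (- L)" using ab(2) by (rule mult_left_mono)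
  ultimately show False using K[of k] by simp
qed

section \<open>Approximate best responses in terms of plays\<close>

definition plays_of :: "'v arena \<Rightarrow> ('v list \<Rightarrow> 'v) \<Rightarrow> 'v \<Rightarrow> (nat \<Rightarrow> 'v) set" where
  "plays_of G \<sigma>0 v = {\<pi>. play G \<pi> \<and> \<pi> 0 = v \<and> follows (owned0 G) \<sigma>0 \<pi>}"

locale game =
  fixes G :: "'v arena"
  assumes arena: "arena G"
begin

lemma play_in_verts: "play G \<pi> \<Longrightarrow> \<pi> k \<in> verts G"
  using arena by (auto simp: play_def arena_def)

lemma finite_edges: "finite (edges G)"
  using arena unfolding arena_def by (metis finite_SigmaI finite_subset)

lemma successor: "u \<in> verts G \<Longrightarrow> \<exists>b. (u, b) \<in> edges G"
  using arena by (auto simp: arena_def)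

definition wmax :: real where
  "wmax = (\<Sum>e\<in>edges G. \<bar>real_of_int (weight0 G e)\<bar> + \<bar>real_of_int (weight1 G e)\<bar>)"

lemma weight_le_wmax:
  assumes "e \<in> edges G"
  shows "\<bar>real_of_int (weight0 G e)\<bar> \<le> wmax" "\<bar>real_of_int (weight1 G e)\<bar> \<le> wmax"
proof -
  have "\<bar>real_of_int (weight0 G e)\<bar> + \<bar>real_of_int (weight1 G e)\<bar> \<le> wmax"
    unfolding wmax_def using assms finite_edges
    by (intro member_le_sum[where f="\<lambda>e. \<bar>real_of_int (weight0 G e)\<bar> + \<bar>real_of_int (weight1 G e)\<bar>"]) auto
  then show "\<bar>real_of_int (weight0 G e)\<bar> \<le> wmax" "\<bar>real_of_int (weight1 G e)\<bar> \<le> wmax" by linarith+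
qed

lemma mean_payoff_bounded:
  assumes p: "play G \<pi>" and W: "\<And>e. e \<in> edges G \<Longrightarrow> \<bar>real_of_int (w e)\<bar> \<le> W"
  shows "ereal (- W) \<le> mean_payoff w \<pi>" "mean_payoff w \<pi> \<le> ereal W"
proof -
  have W': "\<bar>real_of_int (w (\<pi> j, \<pi> (Suc j)))\<bar> \<le> W" for j
    using W p by (simp add: play_def)
  have "shifted w (- W) (\<pi> j, \<pi> (Suc j)) \<ge> 0" "shifted w W (\<pi> j, \<pi> (Suc j)) \<le> 0" for j
    using W'[of j] by linarith+
  then have lo: "psum (shifted w (- W)) \<pi> k \<ge> 0" and hi: "psum (shifted w W) \<pi> k \<le> 0" for k
    unfolding psum_def by (auto intro: sum_nonneg sum_nonpos)
  have "psum (shifted w (- W)) \<pi> k \<ge> - \<epsilon> * real k - 0" if "\<epsilon> > 0" for \<epsilon> k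
  proof -
    have "0 \<le> \<epsilon> * real k" using that by simp
    then show ?thesis using lo[of k] by linarith
  qed
  then show "ereal (- W) \<le> mean_payoff w \<pi>"
    unfolding mean_payoff_ge_iff nonneg_mean_def by blast
  show "mean_payoff w \<pi> \<le> ereal W"
  proof (rule ccontr)
    assume "\<not> mean_payoff w \<pi> \<le> ereal W"
    then have "ereal W < mean_payoff w \<pi>" by simp
    from mean_payoff_gt_linear[OF this]
    obtain \<epsilon> K where e: "\<epsilon> > 0" "\<And>k. psum (shifted w W) \<pi> k \<ge> \<epsilon> * real k - K" by blast
    obtain k :: nat where "real k * \<epsilon> > K" using reals_Archimedean3[OF e(1)] by blast
    then show False using e(2)[of k] hi[of k] by (simp add: mult.commute)
  qed
qed

lemma mean_payoff_real:
  assumes "play G \<pi>"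
  shows "\<bar>mean_payoff (weight0 G) \<pi>\<bar> \<noteq> \<infinity>" "\<bar>mean_payoff (weight1 G) \<pi>\<bar> \<noteq> \<infinity>"
  using mean_payoff_bounded[OF assms, of "weight0 G" wmax] mean_payoff_bounded[OF assms, of "weight1 G" wmax]
    weight_le_wmax by (auto simp: ereal_infty_less_eq)

lemma outcome_in_plays_of:
  assumes "v \<in> verts G" "\<sigma>0 \<in> strategies G (owned0 G)" "\<sigma>1 \<in> strategies G (owned1 G)"
  shows "outcome G v \<sigma>0 \<sigma>1 \<in> plays_of G \<sigma>0 v"
  using theI'[OF outcome_unique[OF arena assms]] by (simp add: plays_of_def outcome_def)

lemma strategies_nonempty: "\<exists>\<sigma>. \<sigma> \<in> strategies G U"
proof -
  have "last h \<in> verts G" if "history G h" for h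
    using that play_in_verts by (auto simp: history_def)
  then have "(\<lambda>h. SOME b. (last h, b) \<in> edges G) \<in> strategies G U"
    using successor by (auto simp: strategies_def intro: someI_ex)
  then show ?thesis by blast
qed

text \<open>Histories from different start vertices differ in their heads, so one strategy of Player
  1 can realise an independently chosen play from each vertex.\<close>

lemma plays_of_outcomes:
  assumes s0: "\<sigma>0 \<in> strategies G (owned0 G)"
    and f: "\<And>u. u \<in> verts G \<Longrightarrow> f u \<in> plays_of G \<sigma>0 u"
  shows "\<exists>\<sigma>1\<in>strategies G (owned1 G). \<forall>u\<in>verts G. outcome G u \<sigma>0 \<sigma>1 = f u"
proof -
  \<comment> \<open>\<open>length h\<close> is the index of the next vertex of the chosen play;
    histories that left it get an arbitrary successor.\<close>
  define \<sigma>1 where "\<sigma>1 = (\<lambda>h. if h = play_prefix (f (hd h)) (length h - 1) then f (hd h) (length h)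
    else SOME b. (last h, b) \<in> edges G)"
  have hd: "hd (play_prefix \<pi> k) = \<pi> 0" for \<pi> :: "nat \<Rightarrow> 'v" and k
    by (simp add: hd_conv_nth)
  have s1: "\<sigma>1 \<in> strategies G (owned1 G)"
    unfolding strategies_def
  proof (intro CollectI allI impI)
    fix h assume "history G h \<and> last h \<in> owned1 G"
    then obtain \<pi> k where h: "play G \<pi>" "h = play_prefix \<pi> k" by (auto simp: history_def)
    show "(last h, \<sigma>1 h) \<in> edges G"
    proof (cases "h = play_prefix (f (hd h)) (length h - 1)")
      case True
      have "\<pi> 0 \<in> verts G" using play_in_verts[OF h(1)] .
      then have "play G (f (\<pi> 0))" using f by (simp add: plays_of_def)
      moreover have "hd h = \<pi> 0" "length h = Suc k" using h(2) hd by simp_all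
      moreover from this have "last h = f (\<pi> 0) k" using True by (metis diff_Suc_1 last_play_prefix)
      ultimately show ?thesis using True by (simp add: \<sigma>1_def play_def)
    next
      case False
      have "last h \<in> verts G" using play_in_verts[OF h(1)] h(2) by simp
      then show ?thesis using False successor by (auto simp: \<sigma>1_def intro: someI_ex)
    qed
  qed
  moreover have "outcome G u \<sigma>0 \<sigma>1 = f u" if u: "u \<in> verts G" for u
  proof -
    have fu: "f u 0 = u" "play G (f u)" "follows (owned0 G) \<sigma>0 (f u)"
      using f[OF u] by (auto simp: plays_of_def)
    have "follows (owned1 G) \<sigma>1 (f u)"
      by (simp add: follows_def \<sigma>1_def hd fu(1))
    then show ?thesis
      unfolding outcome_def using fu by (intro the1_equality[OF outcome_unique[OF arena u s0 s1]]) simp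
  qed
  ultimately show ?thesis by blast
qed

definition mp1 :: "(nat \<Rightarrow> 'v) \<Rightarrow> real" where
  "mp1 \<pi> = real_of_ereal (mean_payoff (weight1 G) \<pi>)"

lemma mp1: "play G \<pi> \<Longrightarrow> mean_payoff (weight1 G) \<pi> = ereal (mp1 \<pi>)"
  using mean_payoff_real[of \<pi>] by (simp add: mp1_def ereal_real)

lemma mp1_bounded: "play G \<pi> \<Longrightarrow> \<bar>mp1 \<pi>\<bar> \<le> wmax"
  using mean_payoff_bounded[of \<pi> "weight1 G" wmax] weight_le_wmax(2) mp1[of \<pi>] by (simp add: abs_le_iff)

text \<open>Any single play against \<sigma>0 is the outcome of some strategy of Player 1, so
  comparing strategies amounts to comparing plays.\<close>

lemma best_responses_iff:
  assumes "\<sigma>0 \<in> strategies G (owned0 G)" "\<sigma>1 \<in> strategies G (owned1 G)"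
  shows "\<sigma>1 \<in> best_responses G \<epsilon> \<sigma>0 \<longleftrightarrow>
    (\<forall>u\<in>verts G. \<forall>\<pi>\<in>plays_of G \<sigma>0 u. mp1 \<pi> - \<epsilon> \<le> mp1 (outcome G u \<sigma>0 \<sigma>1))"
proof -
  have out: "\<exists>\<sigma>1'\<in>strategies G (owned1 G). outcome G u \<sigma>0 \<sigma>1' = \<pi>"
    if "u \<in> verts G" "\<pi> \<in> plays_of G \<sigma>0 u" for u \<pi>
    using plays_of_outcomes[OF assms(1), of "\<lambda>u'. if u' = u then \<pi> else outcome G u' \<sigma>0 \<sigma>1"]
      outcome_in_plays_of[OF _ assms] that by force
  have val: "mean_payoff (weight1 G) (outcome G u \<sigma>0 \<sigma>1') = ereal (mp1 (outcome G u \<sigma>0 \<sigma>1'))"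
    if "u \<in> verts G" "\<sigma>1' \<in> strategies G (owned1 G)" for u \<sigma>1'
    using outcome_in_plays_of[OF that(1) assms(1) that(2)] by (intro mp1) (simp add: plays_of_def)
  have "\<sigma>1 \<in> best_responses G \<epsilon> \<sigma>0 \<longleftrightarrow> (\<forall>u\<in>verts G. \<forall>\<sigma>1'\<in>strategies G (owned1 G).
      mp1 (outcome G u \<sigma>0 \<sigma>1') - \<epsilon> \<le> mp1 (outcome G u \<sigma>0 \<sigma>1))"
    using assms(2) by (simp add: best_responses_def val)
  also have "\<dots> \<longleftrightarrow> (\<forall>u\<in>verts G. \<forall>\<pi>\<in>plays_of G \<sigma>0 u. mp1 \<pi> - \<epsilon> \<le> mp1 (outcome G u \<sigma>0 \<sigma>1))"
    using out outcome_in_plays_of[OF _ assms(1)] by metis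
  finally show ?thesis .
qed

text \<open>The supremum of Player 1's payoffs against \<sigma>0 need not be attained, but some play
  comes within \<epsilon> of it from every vertex.\<close>

lemma best_responses_nonempty:
  assumes s0: "\<sigma>0 \<in> strategies G (owned0 G)" and e: "\<epsilon> > 0"
  shows "best_responses G \<epsilon> \<sigma>0 \<noteq> {}"
proof -
  obtain \<sigma>1 where s1: "\<sigma>1 \<in> strategies G (owned1 G)" using strategies_nonempty by blast
  have "\<exists>\<pi>\<in>plays_of G \<sigma>0 u. \<forall>\<pi>'\<in>plays_of G \<sigma>0 u. mp1 \<pi>' - \<epsilon> \<le> mp1 \<pi>" if u: "u \<in> verts G" for u
  proof -
    let ?A = "mp1 ` plays_of G \<sigma>0 u"
    have ne: "?A \<noteq> {}" using outcome_in_plays_of[OF u s0 s1] by blast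
    have bdd: "bdd_above ?A"
      using mp1_bounded by (intro bdd_aboveI[of _ wmax]) (auto simp: plays_of_def abs_le_iff)
    have "Sup ?A - \<epsilon> < Sup ?A" using e by simp
    then obtain \<pi> where "\<pi> \<in> plays_of G \<sigma>0 u" "Sup ?A - \<epsilon> < mp1 \<pi>"
      using less_cSup_iff[OF ne bdd] by auto
    moreover have "mp1 \<pi>' \<le> Sup ?A" if "\<pi>' \<in> plays_of G \<sigma>0 u" for \<pi>'
      using that bdd by (intro cSup_upper) auto
    ultimately show ?thesis by (intro bexI[of _ \<pi>]) fastforce+
  qed
  then obtain f where f: "\<And>u. u \<in> verts G \<Longrightarrow> f u \<in> plays_of G \<sigma>0 u"
    "\<And>u \<pi>'. u \<in> verts G \<Longrightarrow> \<pi>' \<in> plays_of G \<sigma>0 u \<Longrightarrow> mp1 \<pi>' - \<epsilon> \<le> mp1 (f u)"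
    by metis
  obtain \<sigma>1' where "\<sigma>1' \<in> strategies G (owned1 G)" "\<And>u. u \<in> verts G \<Longrightarrow> outcome G u \<sigma>0 \<sigma>1' = f u"
    using plays_of_outcomes[OF s0, of f] f(1) by metis
  then have "\<sigma>1' \<in> best_responses G \<epsilon> \<sigma>0" using best_responses_iff[OF s0] f(2) by simp
  then show ?thesis by blast
qed

lemma ASV_of_ge:
  assumes v: "v \<in> verts G" and s0: "\<sigma>0 \<in> strategies G (owned0 G)"
    and \<pi>: "\<pi> \<in> plays_of G \<sigma>0 v" "ereal d < mean_payoff (weight1 G) \<pi>"
    and c: "\<And>\<pi>. \<pi> \<in> plays_of G \<sigma>0 v \<Longrightarrow> ereal d < mean_payoff (weight1 G) \<pi> \<Longrightarrow> c \<le> mean_payoff (weight0 G) \<pi>"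
  shows "c \<le> ASV_of G \<sigma>0 v"
proof -
  have P: "play G \<rho>" if "\<rho> \<in> plays_of G \<sigma>0 v" for \<rho> using that by (simp add: plays_of_def)
  \<comment> \<open>Half of the gap: every \<epsilon>-best response still pays Player 1 more than
    \<open>d\<close> from \<open>v\<close>.\<close>
  define \<epsilon> where "\<epsilon> = (mp1 \<pi> - d) / 2"
  have e: "\<epsilon> > 0" using \<pi> mp1[OF P] by (simp add: \<epsilon>_def)
  have "c \<le> (INF \<sigma>1\<in>best_responses G \<epsilon> \<sigma>0. mean_payoff (weight0 G) (outcome G v \<sigma>0 \<sigma>1))"
  proof (rule INF_greatest)
    fix \<sigma>1 assume b: "\<sigma>1 \<in> best_responses G \<epsilon> \<sigma>0"
    then have s1: "\<sigma>1 \<in> strategies G (owned1 G)" by (simp add: best_responses_def)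
    let ?o = "outcome G v \<sigma>0 \<sigma>1"
    have o: "?o \<in> plays_of G \<sigma>0 v" using outcome_in_plays_of[OF v s0 s1] .
    have "mp1 \<pi> - \<epsilon> \<le> mp1 ?o" using b \<pi>(1) v by (simp add: best_responses_iff[OF s0 s1])
    then have "d < mp1 ?o" using e by (simp add: \<epsilon>_def field_simps)
    then show "c \<le> mean_payoff (weight0 G) ?o" using c[OF o] mp1[OF P[OF o]] by simp
  qed
  also have "\<dots> \<le> ASV_of G \<sigma>0 v"
    unfolding ASV_of_def using best_responses_nonempty[OF s0 e] e by (intro SUP_upper) simp
  finally show ?thesis .
qed

text \<open>The threshold \<open>d\<close> is the supremum of Player 1's payoffs from
  \<open>v\<close> minus \<epsilon>. Every play from \<open>v\<close> that reaches it is the outcome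
  of some \<epsilon>-best response, hence subject to the infimum.\<close>

lemma ASV_of_gtD:
  assumes v: "v \<in> verts G" and s0: "\<sigma>0 \<in> strategies G (owned0 G)" and c: "c < ASV_of G \<sigma>0 v"
  shows "\<exists>\<pi> d. \<pi> \<in> plays_of G \<sigma>0 v \<and> ereal d \<le> mean_payoff (weight1 G) \<pi> \<and> c < mean_payoff (weight0 G) \<pi> \<and>
    (\<forall>\<pi>'\<in>plays_of G \<sigma>0 v. ereal d \<le> mean_payoff (weight1 G) \<pi>' \<longrightarrow> c < mean_payoff (weight0 G) \<pi>')"
proof -
  obtain \<epsilon> \<sigma>1 where b: "\<sigma>1 \<in> best_responses G \<epsilon> \<sigma>0"
    and inf: "c < (INF \<sigma>1\<in>best_responses G \<epsilon> \<sigma>0. mean_payoff (weight0 G) (outcome G v \<sigma>0 \<sigma>1))"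
    using c unfolding ASV_of_def less_SUP_iff by blast
  have s1: "\<sigma>1 \<in> strategies G (owned1 G)" using b by (simp add: best_responses_def)
  let ?o = "outcome G v \<sigma>0 \<sigma>1"
  let ?A = "mp1 ` plays_of G \<sigma>0 v"
  have P: "play G \<rho>" if "\<rho> \<in> plays_of G \<sigma>0 v" for \<rho> using that by (simp add: plays_of_def)
  have o: "?o \<in> plays_of G \<sigma>0 v" using outcome_in_plays_of[OF v s0 s1] .
  have bdd: "bdd_above ?A"
    using mp1_bounded P by (intro bdd_aboveI[of _ wmax]) (auto simp: abs_le_iff)
  have "mp1 \<pi> \<le> mp1 ?o + \<epsilon>" if "\<pi> \<in> plays_of G \<sigma>0 v" for \<pi>
    using b that v by (simp add: best_responses_iff[OF s0 s1] algebra_simps)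
  then have "Sup ?A \<le> mp1 ?o + \<epsilon>" using o by (intro cSup_least) auto
  then have od: "ereal (Sup ?A - \<epsilon>) \<le> mean_payoff (weight1 G) ?o"
    using mp1[OF P[OF o]] by simp
  have all: "c < mean_payoff (weight0 G) \<pi>"
    if \<pi>: "\<pi> \<in> plays_of G \<sigma>0 v" "ereal (Sup ?A - \<epsilon>) \<le> mean_payoff (weight1 G) \<pi>" for \<pi>
  proof -
    \<comment> \<open>Best responses are judged at all vertices; keeping the old outcomes elsewhere
      preserves this property.\<close>
    let ?f = "\<lambda>u. if u = v then \<pi> else outcome G u \<sigma>0 \<sigma>1"
    obtain \<sigma>1' where s': "\<sigma>1' \<in> strategies G (owned1 G)" "\<And>u. u \<in> verts G \<Longrightarrow> outcome G u \<sigma>0 \<sigma>1' = ?f u"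
      using plays_of_outcomes[OF s0, of ?f] outcome_in_plays_of[OF _ s0 s1] \<pi>(1) by fastforce
    have "mp1 \<pi>' - \<epsilon> \<le> mp1 (?f u)" if "u \<in> verts G" "\<pi>' \<in> plays_of G \<sigma>0 u" for u \<pi>'
    proof (cases "u = v")
      case True
      then have "mp1 \<pi>' \<le> Sup ?A" using that bdd by (intro cSup_upper) auto
      then show ?thesis using True \<pi>(2) mp1[OF P[OF \<pi>(1)]] by simp
    next
      case False
      then show ?thesis using b that by (simp add: best_responses_iff[OF s0 s1])
    qed
    then have "\<sigma>1' \<in> best_responses G \<epsilon> \<sigma>0"
      using s' by (simp add: best_responses_iff[OF s0 s'(1)])
    then have "c < mean_payoff (weight0 G) (outcome G v \<sigma>0 \<sigma>1')"
      using inf by (rule less_INF_D[rotated])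
    then show ?thesis using s'(2)[OF v] by simp
  qed
  show ?thesis using o od all by blast
qed

lemma ASV_bounded:
  assumes v: "v \<in> verts G" shows "ereal (- wmax) \<le> ASV G v" "ASV G v \<le> ereal wmax"
proof -
  obtain \<sigma>0 where s0: "\<sigma>0 \<in> strategies G (owned0 G)" using strategies_nonempty by blast
  obtain \<sigma>1 where s1: "\<sigma>1 \<in> strategies G (owned1 G)" using strategies_nonempty by blast
  have lo: "ereal (- wmax) \<le> mean_payoff (weight0 G) \<pi>" if "\<pi> \<in> plays_of G \<sigma> v" for \<pi> \<sigma>
    using that mean_payoff_bounded(1)[of \<pi> "weight0 G"] weight_le_wmax(1) by (simp add: plays_of_def)
  have o: "outcome G v \<sigma>0 \<sigma>1 \<in> plays_of G \<sigma>0 v" using outcome_in_plays_of[OF v s0 s1] .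
  then have "ereal (mp1 (outcome G v \<sigma>0 \<sigma>1) - 1) < mean_payoff (weight1 G) (outcome G v \<sigma>0 \<sigma>1)"
    using mp1 by (simp add: plays_of_def)
  then have "ereal (- wmax) \<le> ASV_of G \<sigma>0 v"
    by (rule ASV_of_ge[OF v s0 o]) (rule lo)
  also have "\<dots> \<le> ASV G v" unfolding ASV_def using s0 by (rule SUP_upper)
  finally show "ereal (- wmax) \<le> ASV G v" .
  show "ASV G v \<le> ereal wmax"
    unfolding ASV_def
  proof (rule SUP_least, rule ccontr)
    fix \<sigma> assume s: "\<sigma> \<in> strategies G (owned0 G)" and "\<not> ASV_of G \<sigma> v \<le> ereal wmax"
    then have "ereal wmax < ASV_of G \<sigma> v" by (simp add: not_le)
    then obtain \<pi> where "\<pi> \<in> plays_of G \<sigma> v" "ereal wmax < mean_payoff (weight0 G) \<pi>"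
      using ASV_of_gtD[OF v s] by blast
    then show False
      using mean_payoff_bounded(2)[of \<pi> "weight0 G" wmax] weight_le_wmax(1) by (simp add: plays_of_def)
  qed
qed

end

section \<open>Characterisation of the value\<close>

text \<open>A triple \<open>(a, b, e)\<close> with \<open>e > 0\<close> stands for the affine function \<open>c \<mapsto> (a + b c) / e\<close>.\<close>

definition excess :: "int \<times> int \<times> int \<Rightarrow> real \<Rightarrow> real \<Rightarrow> real" where
  "excess P c d = (case P of (a, b, e) \<Rightarrow> real_of_int a + real_of_int b * c - d * real_of_int e)"

text \<open>Comparison of two quotients by cross-multiplication; for rational \<open>c\<close> it
  becomes an inequality between integers.\<close>

definition beats :: "real \<Rightarrow> int \<times> int \<times> int \<Rightarrow> int \<times> int \<times> int \<Rightarrow> bool" where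
  "beats c P Q = (case (P, Q) of ((a, b, e), (a', b', e')) \<Rightarrow>
     real_of_int e * (real_of_int a' + real_of_int b' * c) < real_of_int e' * (real_of_int a + real_of_int b * c))"

abbreviation slope_denom :: "int \<times> int \<times> int \<Rightarrow> int" where
  "slope_denom P \<equiv> snd (snd P)"

definition piece_value :: "int \<times> int \<times> int \<Rightarrow> real \<Rightarrow> real" where
  "piece_value P c = (case P of (a, b, e) \<Rightarrow> (real_of_int a + real_of_int b * c) / real_of_int e)"

lemma excess_pos_iff: "slope_denom P > 0 \<Longrightarrow> excess P c d > 0 \<longleftrightarrow> d < piece_value P c"
  and excess_neg_iff: "slope_denom P > 0 \<Longrightarrow> excess P c d < 0 \<longleftrightarrow> piece_value P c < d"
  by (auto simp: excess_def piece_value_def pos_less_divide_eq pos_divide_less_eq split: prod.splits)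

lemma beats_iff:
  "slope_denom P > 0 \<Longrightarrow> slope_denom Q > 0 \<Longrightarrow> beats c P Q \<longleftrightarrow> piece_value Q c < piece_value P c"
  by (auto simp: beats_def piece_value_def field_simps split: prod.splits)

lemma between_finite:
  fixes b :: real
  assumes "finite A" "\<And>a. a \<in> A \<Longrightarrow> a < b"
  shows "\<exists>d. d < b \<and> (\<forall>a\<in>A. a < d)"
proof (cases "A = {}")
  case False
  then have "Max A < b" using assms by simp
  then obtain d where "Max A < d" "d < b" using dense by blast
  moreover have "a \<le> Max A" if "a \<in> A" for a using assms(1) that by simp
  ultimately show ?thesis by (meson le_less_trans)
qed (auto intro: lt_ex)

lemma mean_payoff_shift: "mean_payoff w (\<lambda>i. \<pi> (i + k)) = mean_payoff w \<pi>"
proof -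
  have le: "x \<le> y" if "\<And>a. ereal a \<le> x \<Longrightarrow> ereal a \<le> y" for x y :: ereal
  proof (rule ccontr)
    assume "\<not> x \<le> y"
    then have "y < x" by simp
    then obtain a where "y < ereal a" "ereal a < x" using ereal_dense2 by blast
    then show False using that[of a] by (meson less_imp_le not_le)
  qed
  have eq: "ereal a \<le> mean_payoff w (\<lambda>i. \<pi> (i + k)) \<longleftrightarrow> ereal a \<le> mean_payoff w \<pi>" for a
    unfolding mean_payoff_ge_iff by (rule nonneg_mean_shift)
  show ?thesis
    by (rule antisym) (rule le, erule eq[THEN iffD1] eq[THEN iffD2])+
qed

lemma wsum_shifted: "wsum (shifted w a) p = real_of_int (wsum w p) - a * real (length p)"
  by (induction p) (simp_all add: algebra_simps)

lemma wsum_coshifted: "wsum (\<lambda>e. a - real_of_int (w e)) p = a * real (length p) - real_of_int (wsum w p)"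
  by (induction p) (simp_all add: algebra_simps)

lemma linked_sym: "linked E u a b \<Longrightarrow> linked E u b a"
  by (auto simp: linked_def)

lemma linked_left: "linked E u a b \<Longrightarrow> linked E u a a"
  by (auto simp: linked_def)

text \<open>One number bounds the vertices, the weights and the lengths of the cycles considered. It
  is a parameter because the algorithm knows only a bound computed from the code.\<close>

locale bounded_game = game G for G :: "'v arena" +
  fixes n :: nat
  assumes card_le: "card (verts G) \<le> n"
    and weight_le: "e \<in> edges G \<Longrightarrow> \<bar>weight0 G e\<bar> \<le> int n" "e \<in> edges G \<Longrightarrow> \<bar>weight1 G e\<bar> \<le> int n"
begin

abbreviation X :: "('v \<times> 'v) list \<Rightarrow> int" where "X p \<equiv> wsum (weight0 G) p"
abbreviation Y :: "('v \<times> 'v) list \<Rightarrow> int" where "Y p \<equiv> wsum (weight1 G) p"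
abbreviation L :: "('v \<times> 'v) list \<Rightarrow> int" where "L p \<equiv> int (length p)"

definition high :: "('v \<times> 'v) list \<Rightarrow> real \<Rightarrow> bool" where
  "high p c \<longleftrightarrow> c * real (length p) < real_of_int (X p)"

definition point :: "('v \<times> 'v) list \<Rightarrow> int \<times> int \<times> int" where
  "point p = (Y p, 0, L p)"

text \<open>The line through the mean-weight vectors of two cycles.\<close>

definition line :: "('v \<times> 'v) list \<Rightarrow> ('v \<times> 'v) list \<Rightarrow> int \<times> int \<times> int" where
  "line p q = (X q * Y p - X p * Y q, L p * Y q - L q * Y p, X q * L p - X p * L q)"

text \<open>The two cycles lie on different sides of \<open>c\<close> for Player 0. The value of the
  line at \<open>c\<close> is thus Player 1's payoff at the point of the segment where Player 0
  receives exactly \<open>c\<close>, and the denominator is positive.\<close>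

definition lines :: "('v \<times> 'v) set \<Rightarrow> 'v \<Rightarrow> real \<Rightarrow> (int \<times> int \<times> int) set" where
  "lines E u c = {line p q | p q a b. linked E u a b \<and> p \<in> cycles E n a \<and>
     q \<in> cycles E n b \<and> \<not> high p c \<and> high q c}"

definition points :: "bool \<Rightarrow> ('v \<times> 'v) set \<Rightarrow> 'v \<Rightarrow> real \<Rightarrow> (int \<times> int \<times> int) set" where
  "points h E u c = {point p | p a. linked E u a a \<and> p \<in> cycles E n a \<and> high p c = h}"

definition tree_edges :: "('v \<Rightarrow> 'v) \<Rightarrow> ('v \<times> 'v) set" where
  "tree_edges \<tau> = pos_edges (owned0 G) (edges G) \<tau>"

definition sub_edges :: "'v set \<Rightarrow> ('v \<times> 'v) set" where
  "sub_edges U = edges G \<inter> U \<times> U"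

text \<open>The pieces \<open>P\<close> yield what an intended play inside \<open>U\<close> can pay Player 1 while paying Player 0
  more than \<open>c\<close>, the pieces \<open>Q\<close> what Player 1 can enforce against the punishment \<open>\<tau>\<close> while
  paying Player 0 at most \<open>c\<close>. No threshold for Player 1 occurs: it lies between these values.\<close>

definition exceeds :: "'v \<Rightarrow> real \<Rightarrow> bool" where
  "exceeds v c \<longleftrightarrow> (\<exists>U\<subseteq>verts G. v \<in> U \<and>
     (\<exists>P \<in> points True (sub_edges U) v c \<union> lines (sub_edges U) v c.
       \<forall>u\<in>U. \<exists>\<tau>. (\<forall>a\<in>owned0 G. (a, \<tau> a) \<in> edges G) \<and>
         (\<forall>Q \<in> points False (tree_edges \<tau>) u c \<union> lines (tree_edges \<tau>) u c. beats c P Q)))"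

lemma edges_subset: "sub_edges U \<subseteq> edges G" "tree_edges \<tau> \<subseteq> edges G"
  by (auto simp: sub_edges_def tree_edges_def pos_edges_def)

lemma edges_in_verts: "edges G \<subseteq> verts G \<times> verts G"
  using arena by (simp add: arena_def)

lemma finite_verts: "finite (verts G)"
  using arena by (simp add: arena_def)

lemma excess_point: "excess (point p) c d = wsum (shifted (weight1 G) d) p"
  by (simp add: excess_def point_def wsum_shifted)

text \<open>The excess of a line is the cross product of the two shifted weight vectors, the
  quantity that decides both separation from the quadrant and the combination of cycles.\<close>

lemma excess_line:
  "excess (line p q) c d = wsum (shifted (weight0 G) c) q * wsum (shifted (weight1 G) d) p
     - wsum (shifted (weight0 G) c) p * wsum (shifted (weight1 G) d) q"
  unfolding excess_def line_def wsum_shifted by (simp add: algebra_simps)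

lemma high_iff: "high p c \<longleftrightarrow> wsum (shifted (weight0 G) c) p > 0"
  by (simp add: high_def wsum_shifted)

lemma points_denom: "P \<in> points h E u c \<Longrightarrow> slope_denom P > 0"
  by (auto simp: points_def point_def cycles_def)

lemma lines_denom: assumes "P \<in> lines E u c" shows "slope_denom P > 0"
proof -
  obtain p q where P: "P = line p q" and pq: "\<not> high p c" "high q c" "length p > 0" "length q > 0"
    using assms by (auto simp: lines_def cycles_def)
  have "real_of_int (X p) * real (length q) \<le> c * real (length p) * real (length q)"
    using pq(1) by (intro mult_right_mono) (simp_all add: high_def)
  also have "\<dots> < real_of_int (X q) * real (length p)"
    using pq(2,3) unfolding high_def by (metis mult.assoc mult.commute mult_strict_right_mono of_nat_0_less_iff)
  finally have "real_of_int (X p * L q) < real_of_int (X q * L p)" by simp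
  then have "X p * L q < X q * L p" by (simp only: of_int_less_iff)
  then show ?thesis by (simp add: P line_def)
qed

lemma finite_lines: assumes "E \<subseteq> edges G" shows "finite (points h E u c \<union> lines E u c)"
proof -
  have E: "finite E" using assms finite_edges finite_subset by blast
  let ?C = "\<Union>a\<in>verts G. cycles E n a"
  have C: "finite ?C" using finite_verts finite_cycles[OF E] by blast
  have mem: "p \<in> ?C" if "p \<in> cycles E n a" for p a
  proof -
    have "a \<in> verts G" using that assms edges_in_verts by (cases p) (auto simp: cycles_def)
    then show ?thesis using that by blast
  qed
  have "points h E u c \<subseteq> point ` ?C" using mem unfolding points_def by blast
  moreover have "lines E u c \<subseteq> (\<lambda>(p, q). line p q) ` (?C \<times> ?C)"
  proof
    fix P assume "P \<in> lines E u c"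
    then obtain p q a b where P: "P = line p q"
      and "p \<in> cycles E n a" "q \<in> cycles E n b"
      unfolding lines_def by blast
    then have "(p, q) \<in> ?C \<times> ?C" using mem by (intro SigmaI)
    then show "P \<in> (\<lambda>(p, q). line p q) ` (?C \<times> ?C)" using P by (intro image_eqI[of _ _ "(p, q)"]) simp
  qed
  ultimately have "points h E u c \<union> lines E u c \<subseteq> point ` ?C \<union> (\<lambda>(p, q). line p q) ` (?C \<times> ?C)"
    by blast
  then show ?thesis using C by (meson finite_SigmaI finite_UnI finite_imageI finite_subset)
qed

lemma history_of_edges:
  assumes "\<And>j. j < k \<Longrightarrow> (\<rho> j, \<rho> (Suc j)) \<in> edges G" "\<rho> k \<in> verts G"
  shows "history G (play_prefix \<rho> k)"
proof -
  obtain \<rho>' where r: "\<forall>i\<le>k. \<rho>' i = \<rho> i" "\<forall>i\<ge>k. \<rho>' (Suc i) = (\<lambda>h. SOME b. (last h, b) \<in> edges G) (play_prefix \<rho>' i)"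
    using run_extend[of k \<rho> "\<lambda>h. SOME b. (last h, b) \<in> edges G"] by blast
  have e: "\<rho>' (k + i) \<in> verts G \<and> (\<rho>' (k + i), \<rho>' (Suc (k + i))) \<in> edges G" for i
  proof (induction i)
    case 0
    then show ?case using r assms(2) someI_ex[OF successor] by simp
  next
    case (Suc i)
    then have "\<rho>' (k + Suc i) \<in> verts G" using edges_in_verts by auto
    then show ?case using r(2)[rule_format, of "k + Suc i"] someI_ex[OF successor] by simp
  qed
  have "(\<rho>' i, \<rho>' (Suc i)) \<in> edges G" for i
  proof (cases "i < k")
    case True
    then show ?thesis using r(1) assms(1) by simp
  next
    case False
    then show ?thesis using e[of "i - k"] by simp
  qed
  then have "play G \<rho>'" by (simp add: play_def)
  moreover have "play_prefix \<rho> k = play_prefix \<rho>' k" using r(1) by (intro play_prefix_cong) simp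
  ultimately show ?thesis unfolding history_def by blast
qed

section \<open>From pieces to a strategy of Player 0\<close>

lemma positive_cycle_of_piece:
  assumes P: "P \<in> points True E u c \<union> lines E u c" and d: "excess P c d > 0"
  shows "\<exists>a r. (u, a) \<in> E\<^sup>* \<and> walk E a r a \<and> wsum (shifted (weight0 G) c) r > 0 \<and> wsum (shifted (weight1 G) d) r > 0"
proof (cases "P \<in> points True E u c")
  case True
  then obtain p a where p: "P = point p" "linked E u a a" "p \<in> cycles E n a" "high p c"
    unfolding points_def by blast
  have "(u, a) \<in> E\<^sup>*" "walk E a p a" using p by (auto simp: linked_def cycles_def)
  moreover have "wsum (shifted (weight0 G) c) p > 0" "wsum (shifted (weight1 G) d) p > 0"
    using p(1,4) d by (simp_all add: high_iff excess_point)
  ultimately show ?thesis by blast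
next
  case False
  then obtain p q a b where P: "P = line p q" and l: "linked E u a b"
    and p: "p \<in> cycles E n a" "\<not> high p c" and q: "q \<in> cycles E n b" "high q c"
    using P unfolding lines_def by blast
  have r: "(u, b) \<in> E\<^sup>*" and w: "walk E a p a" "walk E b q b"
    using linked_sym[OF l] p q by (auto simp: linked_def cycles_def)
  let ?x = "wsum (shifted (weight0 G) c)" and ?y = "wsum (shifted (weight1 G) d)"
  have x: "?x p \<le> 0" "?x q > 0" using p q by (simp_all add: high_iff)
  have e: "?x q * ?y p > ?x p * ?y q" using d by (simp only: P excess_line diff_gt_0_iff_gt)
  show ?thesis
  proof (cases "?y q > 0")
    case True
    then show ?thesis using x r w by blast
  next
    case False
    then have y: "?y q \<le> 0" by simp
    \<comment> \<open>If \<open>q\<close> alone does not favour Player 1, the positive cross product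
      forces \<open>p\<close> to do so, and a mixture of \<open>q\<close> and \<open>p\<close> is
      positive in both weights.\<close>
    have "0 \<le> ?x p * ?y q" using x y by (intro mult_nonpos_nonpos)
    then have "0 < ?x q * ?y p" using e by linarith
    then have "?y p > 0" using x(2) by (simp add: zero_less_mult_iff)
    then show ?thesis using combine_cycles[OF w(2,1) linked_sym[OF l] x(2) y x(1) _ e] r by blast
  qed
qed

lemma lasso_mean_payoff:
  assumes "walk E a r a" "(u, a) \<in> E\<^sup>*" and pos: "wsum (shifted (weight0 G) c) r > 0" "wsum (shifted (weight1 G) d) r > 0"
  shows "\<exists>\<rho>. path E \<rho> \<and> \<rho> 0 = u \<and> ereal c < mean_payoff (weight0 G) \<rho> \<and> ereal d < mean_payoff (weight1 G) \<rho>"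
proof -
  have r: "r \<noteq> []" using pos by auto
  obtain \<rho> where \<rho>: "path E \<rho>" "\<rho> 0 = u" and nn: "\<And>w :: 'v \<times> 'v \<Rightarrow> real. wsum w r \<ge> 0 \<Longrightarrow> nonneg_mean w \<rho>"
    using lasso[OF assms(1) r assms(2)] by blast
  have "ereal b < mean_payoff w \<rho>" if "wsum (shifted w b) r > 0" for w b
  proof -
    \<comment> \<open>The exact mean of \<open>r\<close>; it lies strictly above \<open>b\<close>
      and is guaranteed by the lasso.\<close>
    define b' where "b' = real_of_int (wsum w r) / real (length r)"
    have "wsum (shifted w b') r \<ge> 0" using r by (simp add: wsum_shifted b'_def)
    then have "ereal b' \<le> mean_payoff w \<rho>" using nn by (simp add: mean_payoff_ge_iff)
    moreover have "b < b'" using that r by (simp add: wsum_shifted b'_def pos_less_divide_eq)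
    ultimately show ?thesis by (metis ereal_less(2) less_ereal.simps(1) less_le_trans)
  qed
  then show ?thesis using \<rho> pos by blast
qed

text \<open>A counterexample would be steep for \<open>c - weight0\<close> and of linear growth for
  \<open>weight1 - d\<close>, while the negative excesses separate the cycle weights of the
  punishment graph from the open quadrant.\<close>

lemma punishing:
  assumes path: "path (tree_edges \<tau>) \<pi>" "\<pi> 0 = u"
    and neg: "\<And>Q. Q \<in> points False (tree_edges \<tau>) u c \<union> lines (tree_edges \<tau>) u c \<Longrightarrow> excess Q c d < 0"
    and d: "ereal d < mean_payoff (weight1 G) \<pi>"
  shows "ereal c \<le> mean_payoff (weight0 G) \<pi>"
proof (rule ccontr)
  assume "\<not> ereal c \<le> mean_payoff (weight0 G) \<pi>"
  then have st: "steep (\<lambda>e. c - real_of_int (weight0 G e)) \<pi>"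
    by (intro mean_payoff_less_steep) (simp add: not_le)
  obtain \<epsilon> K where lin: "\<epsilon> > 0" "\<And>k. psum (shifted (weight1 G) d) \<pi> k \<ge> \<epsilon> * real k - K"
    using mean_payoff_gt_linear[OF d] by blast
  let ?E = "tree_edges \<tau>"
  let ?x = "wsum (\<lambda>e. c - real_of_int (weight0 G e))" and ?y = "wsum (shifted (weight1 G) d)"
  have x: "?x p = - wsum (shifted (weight0 G) c) p" for p
    by (simp add: wsum_shifted wsum_coshifted)
  have E: "?E \<subseteq> verts G \<times> verts G" using edges_subset(2) edges_in_verts by blast
  have pt: "?y p < 0" if "linked ?E u a a" "p \<in> cycles ?E n a" "?x p \<ge> 0" for p a
  proof -
    have "point p \<in> points False ?E u c" using that unfolding points_def high_iff x by fastforce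
    then show ?thesis using neg excess_point by (metis UnI1)
  qed
  have "\<exists>\<alpha> \<beta> K. 0 \<le> \<alpha> \<and> 0 \<le> \<beta> \<and> 0 < \<alpha> + \<beta> \<and>
    (\<forall>k. \<alpha> * psum (\<lambda>e. c - real_of_int (weight0 G e)) \<pi> k + \<beta> * psum (shifted (weight1 G) d) \<pi> k \<le> K)"
  proof (rule path_separated[OF finite_verts E card_le path(1)])
    fix a p assume "linked ?E (\<pi> 0) a a" "p \<in> cycles ?E n a"
    then show "\<not> (?x p > 0 \<and> ?y p > 0)" using pt[of a p] path(2) by auto
  next
    fix a b p q
    assume l: "linked ?E (\<pi> 0) a b" and p: "p \<in> cycles ?E n a" and q: "q \<in> cycles ?E n b"
      and s: "?x p > 0" "?x q \<le> 0" "?y q > 0"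
    \<comment> \<open>A cycle paying Player 0 exactly \<open>c\<close> counts as low, and low points
      have negative excess; so \<open>q\<close> is strictly high and forms a line with
      \<open>p\<close>.\<close>
    have "?x q \<noteq> 0" using pt[of b q] linked_left[OF linked_sym[OF l]] q s path(2) by auto
    then have "line p q \<in> lines ?E u c"
      using l p q s path(2) unfolding lines_def high_iff x by fastforce
    then have "excess (line p q) c d < 0" using neg by blast
    then show "?x p * ?y q \<le> ?x q * ?y p" unfolding excess_line x by simp
  qed
  then show False using not_separated st lin by meson
qed

lemma exceeds_imp_ASV_ge:
  assumes v: "v \<in> verts G" and ex: "exceeds v c"
  shows "ereal c \<le> ASV G v"
proof -
  obtain U P \<tau> where U: "U \<subseteq> verts G" "v \<in> U"
    and P: "P \<in> points True (sub_edges U) v c \<union> lines (sub_edges U) v c"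
    and legal: "\<And>u a. u \<in> U \<Longrightarrow> a \<in> owned0 G \<Longrightarrow> (a, \<tau> u a) \<in> edges G"
    and beats: "\<And>u Q. u \<in> U \<Longrightarrow> Q \<in> points False (tree_edges (\<tau> u)) u c \<union> lines (tree_edges (\<tau> u)) u c \<Longrightarrow> beats c P Q"
    using ex unfolding exceeds_def by metis
  let ?Q = "\<lambda>u. points False (tree_edges (\<tau> u)) u c \<union> lines (tree_edges (\<tau> u)) u c"
  have denom: "slope_denom R > 0" if "R \<in> points h E u c \<union> lines E u c" for R h E u
    using that points_denom lines_denom by blast
  have fin: "finite ((\<lambda>Q. piece_value Q c) ` (\<Union>u\<in>U. ?Q u))"
    using finite_lines[OF edges_subset(2)] finite_subset[OF U(1) finite_verts] by blast
  have lt: "a < piece_value P c" if "a \<in> (\<lambda>Q. piece_value Q c) ` (\<Union>u\<in>U. ?Q u)" for a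
  proof -
    obtain u Q where Q: "u \<in> U" "Q \<in> ?Q u" "a = piece_value Q c" using \<open>a \<in> _\<close> by blast
    then show ?thesis using beats[OF Q(1,2)] beats_iff[OF denom[OF P] denom[OF Q(2)]] by simp
  qed
  \<comment> \<open>Finitely many punishment values lie strictly below that of \<open>P\<close>; any
    number in between serves as the threshold of Player 1.\<close>
  obtain d where d: "d < piece_value P c" "\<forall>a\<in>(\<lambda>Q. piece_value Q c) ` (\<Union>u\<in>U. ?Q u). a < d"
    using between_finite[OF fin lt] by blast
  have neg: "excess Q c d < 0" if "u \<in> U" "Q \<in> ?Q u" for u Q
  proof -
    have "piece_value Q c < d" using d(2) that by blast
    then show ?thesis using excess_neg_iff denom[OF that(2)] by blast
  qed
  have "excess P c d > 0" using excess_pos_iff denom[OF P] d(1) by blast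
  then obtain a r where "(v, a) \<in> (sub_edges U)\<^sup>*" "walk (sub_edges U) a r a"
    "wsum (shifted (weight0 G) c) r > 0" "wsum (shifted (weight1 G) d) r > 0"
    using positive_cycle_of_piece[OF P] by blast
  then obtain \<rho> where \<rho>: "path (sub_edges U) \<rho>" "\<rho> 0 = v"
    "ereal c < mean_payoff (weight0 G) \<rho>" "ereal d < mean_payoff (weight1 G) \<rho>"
    using lasso_mean_payoff by metis
  have \<rho>U: "\<rho> k \<in> U" and \<rho>E: "(\<rho> k, \<rho> (Suc k)) \<in> edges G" for k
    using \<rho>(1) by (auto simp: path_def sub_edges_def)
  \<comment> \<open>The last vertex that \<open>h\<close> shares with \<rho>, just before the first
    difference. The punishment depends on it, as each vertex of \<open>U\<close> has its own
    positional strategy.\<close>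
  define turn where "turn = (\<lambda>h. \<rho> ((LEAST i. h ! i \<noteq> \<rho> i) - 1))"
  define \<sigma>0 where "\<sigma>0 = (\<lambda>h. if h = play_prefix \<rho> (length h - 1) then \<rho> (length h) else \<tau> (turn h) (last h))"
  have s0: "\<sigma>0 \<in> strategies G (owned0 G)"
    unfolding strategies_def
  proof (intro CollectI allI impI)
    fix h assume h: "history G h \<and> last h \<in> owned0 G"
    then obtain k where len: "length h = Suc k" by (auto simp: history_def)
    show "(last h, \<sigma>0 h) \<in> edges G"
    proof (cases "h = play_prefix \<rho> (length h - 1)")
      case True
      then have "last h = \<rho> k" using len by (metis diff_Suc_1 last_play_prefix)
      then show ?thesis using True \<rho>E len by (simp add: \<sigma>0_def)
    next
      case False
      then show ?thesis using legal \<rho>U h by (simp add: \<sigma>0_def turn_def)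
    qed
  qed
  have "\<rho> \<in> plays_of G \<sigma>0 v"
    using \<rho>(2) \<rho>E by (simp add: plays_of_def play_def follows_def \<sigma>0_def)
  then have "ereal c \<le> ASV_of G \<sigma>0 v"
  proof (rule ASV_of_ge[OF v s0 _ \<rho>(4)])
    fix \<pi> assume \<pi>: "\<pi> \<in> plays_of G \<sigma>0 v" and gt: "ereal d < mean_payoff (weight1 G) \<pi>"
    have \<pi>E: "(\<pi> k, \<pi> (Suc k)) \<in> edges G" for k using \<pi> by (simp add: plays_of_def play_def)
    have fol: "\<pi> (Suc k) = \<sigma>0 (play_prefix \<pi> k)" if "\<pi> k \<in> owned0 G" for k
      using \<pi> that by (simp add: plays_of_def follows_def)
    show "ereal c \<le> mean_payoff (weight0 G) \<pi>"
    proof (cases "\<pi> = \<rho>")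
      case True
      then show ?thesis using \<rho>(3) by simp
    next
      case False
      then have ne: "\<exists>i. \<pi> i \<noteq> \<rho> i" by blast
      define m where "m = (LEAST i. \<pi> i \<noteq> \<rho> i)"
      have m: "\<pi> m \<noteq> \<rho> m" "\<And>i. i < m \<Longrightarrow> \<pi> i = \<rho> i"
        using LeastI_ex[OF ne] not_less_Least unfolding m_def by blast+
      have "m \<noteq> 0" using m(1) \<pi> \<rho>(2) by (cases m) (auto simp: plays_of_def)
      then obtain k where k: "m = Suc k" by (cases m) auto
      have u: "\<pi> k = \<rho> k" using m(2) k by simp
      have "(\<pi> j, \<pi> (Suc j)) \<in> tree_edges (\<tau> (\<rho> k))" if j: "k \<le> j" for j
      proof (cases "\<pi> j \<in> owned0 G")
        case True
        \<comment> \<open>At a vertex of Player 0 the intended play would have been continued, so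
          the deviation at \<open>k\<close> is due to Player 1 and its first edge is
          unconstrained.\<close>
        have "k \<noteq> j"
        proof
          assume kj: "k = j"
          have "play_prefix \<pi> k = play_prefix \<rho> k" using m(2) k by (intro play_prefix_cong) simp
          then have "\<pi> (Suc k) = \<rho> (Suc k)" using fol[OF True] kj by (simp add: \<sigma>0_def)
          then show False using m(1) k by simp
        qed
        then have mj: "m \<le> j" using j k by simp
        have "play_prefix \<pi> j \<noteq> play_prefix \<rho> j"
          using m(1) mj by (metis nth_play_prefix)
        moreover have "(LEAST i. play_prefix \<pi> j ! i \<noteq> \<rho> i) = m"
          using m mj by (intro Least_equality) (simp, metis le_less_trans nle_le nth_play_prefix order.strict_implies_order not_le)
        ultimately have "\<pi> (Suc j) = \<tau> (\<rho> k) (\<pi> j)"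
          using fol[OF True] k by (simp add: \<sigma>0_def turn_def)
        then show ?thesis using \<pi>E[of j] by (simp add: tree_edges_def pos_edges_def)
      qed (use \<pi>E in \<open>simp add: tree_edges_def pos_edges_def\<close>)
      then have "path (tree_edges (\<tau> (\<rho> k))) (\<lambda>i. \<pi> (i + k))" by (simp add: path_def)
      then have "ereal c \<le> mean_payoff (weight0 G) (\<lambda>i. \<pi> (i + k))"
        using neg[OF \<rho>U[of k]] gt u by (intro punishing) (auto simp: mean_payoff_shift)
      then show ?thesis by (simp add: mean_payoff_shift)
    qed
  qed
  also have "\<dots> \<le> ASV G v" unfolding ASV_def using s0 by (rule SUP_upper)
  finally show ?thesis .
qed

section \<open>From a good strategy of Player 0 to pieces\<close>

lemma linear_not_nonneg:
  assumes "ereal c < mean_payoff w \<pi>" and nn: "nonneg_mean (\<lambda>e. c - real_of_int (w e)) \<pi>"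
  shows False
proof -
  obtain \<epsilon> K where e: "\<epsilon> > 0" and K: "\<And>k. psum (shifted w c) \<pi> k \<ge> \<epsilon> * real k - K"
    using mean_payoff_gt_linear[OF assms(1)] by blast
  obtain K' where K': "\<And>k. psum (\<lambda>e. c - real_of_int (w e)) \<pi> k \<ge> - (\<epsilon> / 2) * real k - K'"
    using nn e unfolding nonneg_mean_def by (metis half_gt_zero)
  obtain k :: nat where k: "real k * (\<epsilon> / 2) > K + K'"
    using reals_Archimedean3[of "\<epsilon> / 2"] e half_gt_zero by blast
  have "psum (\<lambda>e. c - real_of_int (w e)) \<pi> k = - psum (shifted w c) \<pi> k"
    by (simp add: psum_def sum_subtractf)
  then show False using K[of k] K'[of k] k by (simp add: algebra_simps)
qed

text \<open>A strategy of Player 1 that wins from \<open>\<pi> k\<close> could be used as a deviation from \<open>\<pi>\<close> at time \<open>k\<close>.\<close>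

lemma positional_punishment:
  assumes s0: "\<sigma>0 \<in> strategies G (owned0 G)" and \<pi>: "\<pi> \<in> plays_of G \<sigma>0 v"
    and all: "\<And>\<pi>'. \<pi>' \<in> plays_of G \<sigma>0 v \<Longrightarrow> ereal d \<le> mean_payoff (weight1 G) \<pi>' \<Longrightarrow> ereal c < mean_payoff (weight0 G) \<pi>'"
  shows "\<exists>\<tau>. (\<forall>a\<in>owned0 G. (a, \<tau> a) \<in> edges G) \<and>
    (\<forall>\<rho>. path (tree_edges \<tau>) \<rho> \<longrightarrow> \<rho> 0 = \<pi> k \<longrightarrow>
       \<not> (nonneg_mean (\<lambda>e. c - real_of_int (weight0 G e)) \<rho> \<and> nonneg_mean (shifted (weight1 G) d) \<rho>))"
proof -
  \<comment> \<open>The first weight expresses that the upper mean for Player 0 is at most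
    \<open>c\<close>. This is stronger than a lower mean of at most \<open>c\<close>, but closed
    under interleaving.\<close>
  let ?W = "{\<lambda>e. c - real_of_int (weight0 G e), shifted (weight1 G) d}"
  let ?O = "\<lambda>\<rho>. \<forall>w\<in>?W. nonneg_mean w \<rho>"
  have own: "owned0 G \<inter> owned1 G = {}" "owned0 G \<union> owned1 G = verts G"
    using arena by (auto simp: arena_def)
  have \<pi>E: "(\<pi> i, \<pi> (Suc i)) \<in> edges G" for i using \<pi> by (simp add: plays_of_def play_def)
  have "\<not> wins1 (owned1 G) ?O (edges G) (\<pi> k)"
  proof
    assume "wins1 (owned1 G) ?O (edges G) (\<pi> k)"
    then obtain s where s: "\<And>h. h \<noteq> [] \<Longrightarrow> last h \<in> owned1 G \<Longrightarrow> (last h, s h) \<in> edges G"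
      and win: "\<And>\<rho>. path (edges G) \<rho> \<Longrightarrow> \<rho> 0 = \<pi> k \<Longrightarrow> follows (owned1 G) s \<rho> \<Longrightarrow> ?O \<rho>"
      unfolding wins1_def by blast
    \<comment> \<open>\<sigma>0 continues to see the whole history, while \<open>s\<close> sees only
      the part from time \<open>k\<close> on.\<close>
    let ?f = "\<lambda>h. if last h \<in> owned0 G then \<sigma>0 h else s (drop k h)"
    obtain \<pi>' where p1: "\<forall>i\<le>k. \<pi>' i = \<pi> i" and p2: "\<forall>i\<ge>k. \<pi>' (Suc i) = ?f (play_prefix \<pi>' i)"
      using run_extend[of k \<pi> ?f] by blast
    have pre: "play_prefix \<pi>' i = play_prefix \<pi> i" if "i \<le> k" for i
      using that p1 by (intro play_prefix_cong) simp
    have drop: "drop k (play_prefix \<pi>' (k + i)) = play_prefix (\<lambda>i. \<pi>' (i + k)) i" for i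
      unfolding play_prefix_shift by simp
    have E: "(\<pi>' i, \<pi>' (Suc i)) \<in> edges G" for i
    proof (induction i rule: less_induct)
      case (less i)
      show ?case
      proof (cases "i < k")
        case True
        then show ?thesis using p1 \<pi>E by simp
      next
        case False
        have iv: "\<pi>' i \<in> verts G"
        proof (cases i)
          case 0
          then show ?thesis using p1 \<pi>E[of 0] edges_in_verts by auto
        next
          case (Suc l)
          then show ?thesis using less[of l] edges_in_verts by auto
        qed
        then have h: "history G (play_prefix \<pi>' i)" using less by (intro history_of_edges)
        have step: "\<pi>' (Suc i) = ?f (play_prefix \<pi>' i)" using p2 False by simp
        show ?thesis
        proof (cases "\<pi>' i \<in> owned0 G")
          case True
          have "\<forall>h. history G h \<and> last h \<in> owned0 G \<longrightarrow> (last h, \<sigma>0 h) \<in> edges G"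
            using s0 by (simp add: strategies_def)
          from this[rule_format, of "play_prefix \<pi>' i"] show ?thesis using step True h by simp
        next
          case F: False
          then have "\<pi>' i \<in> owned1 G" using iv own by blast
          moreover obtain l where "i = k + l" using False by (metis le_add_diff_inverse not_le)
          ultimately show ?thesis using step F s[of "drop k (play_prefix \<pi>' i)"] drop[of l]
            by (simp add: add.commute)
        qed
      qed
    qed
    have "follows (owned0 G) \<sigma>0 \<pi>'"
      unfolding follows_def
    proof (intro allI impI)
      fix i assume i: "\<pi>' i \<in> owned0 G"
      show "\<pi>' (Suc i) = \<sigma>0 (play_prefix \<pi>' i)"
      proof (cases "i < k")
        case True
        then show ?thesis using \<pi> p1 pre[of i] i by (simp add: plays_of_def follows_def)
      next
        case False
        then show ?thesis using p2 i by simp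
      qed
    qed
    then have mem: "\<pi>' \<in> plays_of G \<sigma>0 v"
      using E p1 \<pi> by (simp add: plays_of_def play_def)
    have "follows (owned1 G) s (\<lambda>i. \<pi>' (i + k))"
      unfolding follows_def
    proof (intro allI impI)
      fix i assume "\<pi>' (i + k) \<in> owned1 G"
      then have "\<pi>' (k + i) \<notin> owned0 G" using own by (metis IntI add.commute empty_iff)
      moreover have "\<pi>' (Suc (k + i)) = ?f (play_prefix \<pi>' (k + i))" using p2 by simp
      ultimately show "\<pi>' (Suc i + k) = s (play_prefix (\<lambda>i. \<pi>' (i + k)) i)"
        using drop[of i] by (simp add: add.commute)
    qed
    then have "?O (\<lambda>i. \<pi>' (i + k))"
      using win[of "\<lambda>i. \<pi>' (i + k)"] E p1 by (simp add: path_def)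
    then have "nonneg_mean (\<lambda>e. c - real_of_int (weight0 G e)) \<pi>'" "nonneg_mean (shifted (weight1 G) d) \<pi>'"
      unfolding nonneg_mean_shift by blast+
    then have "nonneg_mean (\<lambda>e. c - real_of_int (weight0 G e)) \<pi>'" "ereal d \<le> mean_payoff (weight1 G) \<pi>'"
      unfolding mean_payoff_ge_iff by blast+
    then show False using linear_not_nonneg all[OF mem] by blast
  qed
  moreover have "wins0 (owned0 G) ?O (edges G) (\<pi> k) \<or> wins1 (owned1 G) ?O (edges G) (\<pi> k)"
    by (rule half_positional_determinacy[OF finite_edges own(1), unfolded own(2), OF edges_in_verts successor])
  ultimately show ?thesis unfolding wins0_def tree_edges_def by auto
qed

text \<open>A piece of nonnegative excess would yield a closed walk, and by repetition a play, on
  which Player 1 achieves both objectives. The slack \<open>c' - c\<close> makes cycles that are low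
  at \<open>c\<close> strictly favourable at \<open>c'\<close>.\<close>

lemma negative_piece:
  assumes cc: "c < c'"
    and lose: "\<And>\<rho>. path E \<rho> \<Longrightarrow> \<rho> 0 = u \<Longrightarrow>
      \<not> (nonneg_mean (\<lambda>e. c' - real_of_int (weight0 G e)) \<rho> \<and> nonneg_mean (shifted (weight1 G) d) \<rho>)"
    and Q: "Q \<in> points False E u c \<union> lines E u c"
  shows "excess Q c d < 0"
proof (rule ccontr)
  assume "\<not> excess Q c d < 0"
  then have ge: "excess Q c d \<ge> 0" by simp
  let ?x = "wsum (\<lambda>e. c' - real_of_int (weight0 G e))" and ?y = "wsum (shifted (weight1 G) d)"
  let ?z = "wsum (shifted (weight0 G) c)"
  have no: "\<not> (?x r \<ge> 0 \<and> ?y r \<ge> 0)" if r: "(u, a) \<in> E\<^sup>*" "walk E a r a" "r \<noteq> []" for a r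
  proof -
    obtain \<rho> where \<rho>: "path E \<rho>" "\<rho> 0 = u" "\<And>w :: 'v \<times> 'v \<Rightarrow> real. wsum w r \<ge> 0 \<Longrightarrow> nonneg_mean w \<rho>"
      using lasso[OF r(2,3,1)] by blast
    show ?thesis using lose[OF \<rho>(1,2)] \<rho>(3) by blast
  qed
  have x: "?x p = (c' - c) * real (length p) - ?z p" for p
    by (simp add: wsum_shifted wsum_coshifted algebra_simps)
  show False
  proof (cases "Q \<in> points False E u c")
    case True
    then obtain p a where p: "Q = point p" "linked E u a a" "p \<in> cycles E n a" "\<not> high p c"
      unfolding points_def by blast
    have "0 \<le> (c' - c) * real (length p)" using cc by simp
    then have "?x p \<ge> 0" using p(4) x[of p] by (simp add: high_iff)
    moreover have "?y p \<ge> 0" using ge p(1) by (simp add: excess_point)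
    ultimately show False using no[of a p] p(2,3) by (simp add: linked_def cycles_def)
  next
    case False
    then obtain p q a b where Q: "Q = line p q" and l: "linked E u a b"
      and p: "p \<in> cycles E n a" "\<not> high p c" and q: "q \<in> cycles E n b" "high q c"
      using Q unfolding lines_def by blast
    have r: "(u, a) \<in> E\<^sup>*" "(u, b) \<in> E\<^sup>*" and w: "walk E a p a" "walk E b q b" "p \<noteq> []" "q \<noteq> []"
      using l linked_sym[OF l] p q by (auto simp: linked_def cycles_def)
    have x0: "?z p \<le> 0" "?z q > 0" using p q by (simp_all add: high_iff)
    have pos: "(c' - c) * real (length p) > 0" "(c' - c) * real (length q) > 0" using cc w by simp_all
    have e: "?z p * ?y q \<le> ?z q * ?y p" using ge by (simp only: Q excess_line diff_ge_0_iff_ge)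
    have xp: "?x p > 0" using x[of p] pos x0 by linarith
    then have yp: "?y p < 0" using no[OF r(1) w(1,3)] by linarith
    then have "?z q * ?y p < 0" using x0 by (simp add: mult_pos_neg)
    then have "?z p * ?y q < 0" using e by linarith
    then have yq: "?y q > 0" using x0(1) by (simp add: mult_less_0_iff)
    then have xq: "?x q < 0" using no[OF r(2) w(2,4)] by linarith
    \<comment> \<open>Passing from \<open>c\<close> to \<open>c'\<close> adds a negative term on one
      side and a positive one on the other, so the weak inequality \<open>e\<close> between cross
      terms becomes strict.\<close>
    have "?x q * ?y p = (c' - c) * real (length q) * ?y p - ?z q * ?y p"
      "?x p * ?y q = (c' - c) * real (length p) * ?y q - ?z p * ?y q"
      by (simp_all only: x left_diff_distrib)
    moreover have "(c' - c) * real (length q) * ?y p < 0" using pos yp by (simp add: mult_pos_neg)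
    moreover have "(c' - c) * real (length p) * ?y q > 0" using pos yq by simp
    ultimately have "?x q * ?y p < ?x p * ?y q" using e by linarith
    then obtain rr where "walk E a rr a" "?x rr > 0" "?y rr > 0"
      using combine_cycles[OF w(1,2) l xp _ _ yq] yp xq by (meson less_imp_le)
    moreover from this have "rr \<noteq> []" by auto
    ultimately show False using no[OF r(1), of rr] by simp
  qed
qed

text \<open>If all excesses were nonpositive, the cycle weights would be separated from the open
  quadrant, although both payoffs of the play lie strictly above their thresholds.\<close>

lemma positive_piece:
  assumes path: "path E \<pi>" "\<pi> 0 = u" "E \<subseteq> edges G"
    and c: "ereal c < mean_payoff (weight0 G) \<pi>" and d: "ereal d < mean_payoff (weight1 G) \<pi>"
  shows "\<exists>P \<in> points True E u c \<union> lines E u c. excess P c d > 0"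
proof (rule ccontr)
  assume no: "\<not> (\<exists>P \<in> points True E u c \<union> lines E u c. excess P c d > 0)"
  obtain \<epsilon> K where lin: "\<epsilon> > 0" "\<And>k. psum (shifted (weight1 G) d) \<pi> k \<ge> \<epsilon> * real k - K"
    using mean_payoff_gt_linear[OF d] by blast
  have st: "steep (shifted (weight0 G) c) \<pi>"
    using mean_payoff_gt_linear[OF c] linear_steep by blast
  let ?x = "wsum (shifted (weight0 G) c)" and ?y = "wsum (shifted (weight1 G) d)"
  have E: "E \<subseteq> verts G \<times> verts G" using path(3) edges_in_verts by blast
  have "\<exists>\<alpha> \<beta> K. 0 \<le> \<alpha> \<and> 0 \<le> \<beta> \<and> 0 < \<alpha> + \<beta> \<and>
    (\<forall>k. \<alpha> * psum (shifted (weight0 G) c) \<pi> k + \<beta> * psum (shifted (weight1 G) d) \<pi> k \<le> K)"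
  proof (rule path_separated[OF finite_verts E card_le path(1)])
    fix a p assume p: "linked E (\<pi> 0) a a" "p \<in> cycles E n a"
    show "\<not> (?x p > 0 \<and> ?y p > 0)"
    proof
      assume xy: "?x p > 0 \<and> ?y p > 0"
      then have "point p \<in> points True E u c" using p path(2) unfolding points_def high_iff by fastforce
      then show False using no xy excess_point by (metis UnI1)
    qed
  next
    fix a b p q
    assume l: "linked E (\<pi> 0) a b" and p: "p \<in> cycles E n a" and q: "q \<in> cycles E n b"
      and s: "?x p > 0" "?x q \<le> 0" "?y q > 0"
    \<comment> \<open>Here \<open>p\<close> is the high cycle, while \<open>line\<close> takes the
      low one first; hence the exchange.\<close>
    have "linked E u b a" "\<not> high q c" "high p c" using linked_sym[OF l] s path(2) by (simp_all add: high_iff)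
    then have "line q p \<in> lines E u c" using p q unfolding lines_def by blast
    then have "excess (line q p) c d \<le> 0" using no by (meson UnI2 not_le)
    then show "?x p * ?y q \<le> ?x q * ?y p" unfolding excess_line by simp
  qed
  then show False using not_separated st lin by meson
qed

lemma ASV_gt_imp_exceeds:
  assumes v: "v \<in> verts G" and gt: "ereal c' < ASV G v" and cc: "c < c'"
  shows "exceeds v c"
proof -
  obtain \<sigma>0 where s0: "\<sigma>0 \<in> strategies G (owned0 G)" and "ereal c' < ASV_of G \<sigma>0 v"
    using gt unfolding ASV_def less_SUP_iff by blast
  from ASV_of_gtD[OF v this] obtain \<pi> d where \<pi>: "\<pi> \<in> plays_of G \<sigma>0 v"
    and d: "ereal d \<le> mean_payoff (weight1 G) \<pi>" and c': "ereal c' < mean_payoff (weight0 G) \<pi>"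
    and all: "\<And>\<pi>'. \<pi>' \<in> plays_of G \<sigma>0 v \<Longrightarrow> ereal d \<le> mean_payoff (weight1 G) \<pi>' \<Longrightarrow> ereal c' < mean_payoff (weight0 G) \<pi>'"
    by blast
  have \<pi>E: "play G \<pi>" "\<pi> 0 = v" using \<pi> by (simp_all add: plays_of_def)
  have "\<forall>u\<in>range \<pi>. \<exists>\<tau>. (\<forall>a\<in>owned0 G. (a, \<tau> a) \<in> edges G) \<and> (\<forall>\<rho>. path (tree_edges \<tau>) \<rho> \<longrightarrow> \<rho> 0 = u \<longrightarrow>
     \<not> (nonneg_mean (\<lambda>e. c' - real_of_int (weight0 G e)) \<rho> \<and> nonneg_mean (shifted (weight1 G) d) \<rho>))"
    using positional_punishment[OF s0 \<pi> all] by blast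
  from bchoice[OF this] obtain \<tau> where legal: "\<And>u a. u \<in> range \<pi> \<Longrightarrow> a \<in> owned0 G \<Longrightarrow> (a, \<tau> u a) \<in> edges G"
    and lose: "\<And>u \<rho>. u \<in> range \<pi> \<Longrightarrow> path (tree_edges (\<tau> u)) \<rho> \<Longrightarrow> \<rho> 0 = u \<Longrightarrow>
      \<not> (nonneg_mean (\<lambda>e. c' - real_of_int (weight0 G e)) \<rho> \<and> nonneg_mean (shifted (weight1 G) d) \<rho>)"
    by blast
  have U: "range \<pi> \<subseteq> verts G" "v \<in> range \<pi>" using play_in_verts[OF \<pi>E(1)] \<pi>E(2) by auto
  let ?Q = "\<lambda>u. points False (tree_edges (\<tau> u)) u c \<union> lines (tree_edges (\<tau> u)) u c"
  have denom: "slope_denom R > 0" if "R \<in> points h E u c \<union> lines E u c" for R h E u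
    using that points_denom lines_denom by blast
  have fin: "finite ((\<lambda>Q. piece_value Q c) ` (\<Union>u\<in>range \<pi>. ?Q u))"
    using finite_lines[OF edges_subset(2)] finite_subset[OF U(1) finite_verts] by blast
  have lt: "a < d" if a: "a \<in> (\<lambda>Q. piece_value Q c) ` (\<Union>u\<in>range \<pi>. ?Q u)" for a
  proof -
    obtain u Q where Q: "u \<in> range \<pi>" "Q \<in> ?Q u" "a = piece_value Q c" using a by blast
    show ?thesis
      using negative_piece[OF cc lose[OF Q(1)] Q(2)] excess_neg_iff[OF denom[OF Q(2)]] Q(3) by simp
  qed
  \<comment> \<open>\<pi> is only known to reach \<open>d\<close>, not to exceed it;
    \<open>d'\<close> is exceeded and still lies above all punishment values.\<close>
  obtain d' where d': "d' < d" "\<forall>a\<in>(\<lambda>Q. piece_value Q c) ` (\<Union>u\<in>range \<pi>. ?Q u). a < d'"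
    using between_finite[OF fin lt] by blast
  have "path (sub_edges (range \<pi>)) \<pi>" using \<pi>E(1) by (simp add: path_def play_def sub_edges_def)
  moreover have "ereal c < mean_payoff (weight0 G) \<pi>" "ereal d' < mean_payoff (weight1 G) \<pi>"
    using c' cc d d'(1) by (meson ereal_less_eq(3) le_less_trans less_imp_le, meson less_ereal.simps(1) less_le_trans)
  ultimately obtain P where P: "P \<in> points True (sub_edges (range \<pi>)) v c \<union> lines (sub_edges (range \<pi>)) v c"
    and ex: "excess P c d' > 0"
    using positive_piece[of "sub_edges (range \<pi>)" \<pi> v c d'] \<pi>E(2) edges_subset(1) by blast
  have "beats c P Q" if u: "u \<in> range \<pi>" and Q: "Q \<in> ?Q u" for u Q
  proof -
    have "piece_value Q c < d'" using d'(2) u Q by blast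
    also have "\<dots> < piece_value P c" using ex excess_pos_iff[OF denom[OF P]] by simp
    finally show ?thesis using beats_iff[OF denom[OF P] denom[OF Q]] by simp
  qed
  then have "\<exists>\<tau>. (\<forall>a\<in>owned0 G. (a, \<tau> a) \<in> edges G) \<and>
      (\<forall>Q \<in> points False (tree_edges \<tau>) u c \<union> lines (tree_edges \<tau>) u c. beats c P Q)"
    if "u \<in> range \<pi>" for u
    using that legal by (intro exI[of _ "\<tau> u"] conjI ballI)
  then show ?thesis
    unfolding exceeds_def using U P by (intro exI[of _ "range \<pi>"] conjI bexI[of _ P] ballI)
qed

end

section \<open>Rationality of the value\<close>

text \<open>The sign of \<open>A + B c\<close> changes only at \<open>- A / B\<close>, which is a multiple of \<open>1 / M!\<close>.\<close>

lemma affine_sign_invariant: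
  assumes c: "c1 < c2" and no: "\<And>j :: int. \<not> (c1 * fact M \<le> real_of_int j \<and> real_of_int j \<le> c2 * fact M)"
    and B: "\<bar>B\<bar> \<le> int M"
  shows "0 < real_of_int A + real_of_int B * c1 \<longleftrightarrow> 0 < real_of_int A + real_of_int B * c2"
proof (cases "B = 0")
  case False
  have "nat \<bar>B\<bar> dvd fact M" using B False by (intro dvd_fact) auto
  then have "int (nat \<bar>B\<bar>) dvd int (fact M)" by (simp only: int_dvd_int_iff)
  then obtain k where k: "int (fact M) = B * k" using False by (auto simp: abs_dvd_iff elim: dvdE)
  define z where "z = - real_of_int A / real_of_int B"
  have fk: "(fact M :: real) = real_of_int B * real_of_int k"
    using k by (metis of_int_mult of_int_of_nat_eq of_nat_fact)
  have zf: "z * fact M = real_of_int (- A * k)" using False by (simp add: z_def fk)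
  have f: "(fact M :: real) > 0" by simp
  have "\<not> (c1 \<le> z \<and> z \<le> c2)"
    using no[of "- A * k"] f unfolding zf[symmetric] by (simp only: mult_le_cancel_right_pos not_False_eq_True)
  then have z: "z < c1 \<or> c2 < z" using c by linarith
  have e: "real_of_int A + real_of_int B * c = real_of_int B * (c - z)" for c
    using False by (simp add: z_def field_simps)
  show ?thesis unfolding e using z c by (auto simp: zero_less_mult_iff)
qed simp

context bounded_game
begin

section \<open>Bounds on the slopes\<close>

lemma cycle_bounds:
  assumes "E \<subseteq> edges G" "p \<in> cycles E n a"
  shows "\<bar>L p\<bar> \<le> int n" "\<bar>X p\<bar> \<le> int n * int n" "\<bar>Y p\<bar> \<le> int n * int n"
proof -
  have len: "length p \<le> n" using assms(2) by (simp add: cycles_def)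
  then show "\<bar>L p\<bar> \<le> int n" by simp
  have sub: "set p \<subseteq> edges G" using assms walk_subset by (fastforce simp: cycles_def)
  have "\<bar>wsum w p\<bar> \<le> int n * int n" if w: "\<And>e. e \<in> edges G \<Longrightarrow> \<bar>w e\<bar> \<le> int n" for w :: "'v \<times> 'v \<Rightarrow> int"
  proof -
    have "\<bar>wsum w p\<bar> \<le> wsum (\<lambda>e. \<bar>w e\<bar>) p" using sum_list_abs[of "map w p"] by (simp add: comp_def)
    also have "\<dots> \<le> wsum (\<lambda>_. int n) p" using sub w by (intro sum_list_mono) auto
    also have "\<dots> = L p * int n" by (simp add: sum_list_triv)
    also have "\<dots> \<le> int n * int n" using len by (intro mult_right_mono) auto
    finally show ?thesis .
  qed
  then show "\<bar>X p\<bar> \<le> int n * int n" "\<bar>Y p\<bar> \<le> int n * int n" using weight_le by blast+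
qed

lemma abs_cross_le:
  fixes a b c d :: int
  assumes "\<bar>a\<bar> \<le> A" "\<bar>b\<bar> \<le> B" "\<bar>c\<bar> \<le> A" "\<bar>d\<bar> \<le> B"
  shows "\<bar>a * b - c * d\<bar> \<le> 2 * (A * B)"
proof -
  have "\<bar>a * b\<bar> \<le> A * B" "\<bar>c * d\<bar> \<le> A * B"
    using assms by (auto simp: abs_mult intro!: mult_mono order_trans[OF abs_ge_zero])
  then show ?thesis by linarith
qed

text \<open>The slopes in \<open>c\<close> of the affine functions compared: \<open>n\<close> bounds
  the cycle length in \<open>high\<close>, and a comparison of two pieces has slope at most
  \<open>2 * (2 * n^3)^2\<close>.\<close>

definition slope_max :: nat where "slope_max = 8 * n ^ 6 + n"

lemma piece_bounds:
  assumes E: "E \<subseteq> edges G" and P: "(a, b, e) \<in> points h E u c \<union> lines E u c"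
  shows "\<bar>b\<bar> \<le> 2 * (int n * (int n * int n))" "\<bar>e\<bar> \<le> 2 * (int n * (int n * int n))"
proof -
  have "\<bar>b\<bar> \<le> 2 * (int n * (int n * int n)) \<and> \<bar>e\<bar> \<le> 2 * (int n * (int n * int n))"
  proof (cases "(a, b, e) \<in> points h E u c")
    case True
    then obtain p a' where p: "b = 0" "e = L p" "p \<in> cycles E n a'" by (auto simp: points_def point_def)
    have "1 \<le> n" using p(3) by (cases p) (auto simp: cycles_def)
    then have "n * 1 \<le> n * (n * n)" by (intro mult_left_mono) auto
    then have "int n \<le> int n * (int n * int n)" by (metis mult.right_neutral of_nat_le_iff of_nat_mult)
    then show ?thesis using p cycle_bounds(1)[OF E p(3)] by simp
  next
    case False
    then obtain p q a' b' where pq: "b = L p * Y q - L q * Y p" "e = X q * L p - X p * L q"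
      and C: "p \<in> cycles E n a'" "q \<in> cycles E n b'"
      using P by (auto simp: lines_def line_def)
    have "e = L p * X q - L q * X p" using pq(2) by simp
    then show ?thesis
      using pq(1) abs_cross_le cycle_bounds[OF E C(1)] cycle_bounds[OF E C(2)] by simp
  qed
  then show "\<bar>b\<bar> \<le> 2 * (int n * (int n * int n))" "\<bar>e\<bar> \<le> 2 * (int n * (int n * int n))" by blast+
qed

text \<open>The threshold enters only through \<open>high\<close> and \<open>beats\<close>, that is,
  through signs of affine functions whose slopes are bounded by \<open>slope_max\<close>.\<close>

lemma exceeds_invariant:
  assumes c: "c1 < c2" and no: "\<And>j :: int. \<not> (c1 * fact slope_max \<le> real_of_int j \<and> real_of_int j \<le> c2 * fact slope_max)"
    and ex: "exceeds v c1"
  shows "exceeds v c2"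
proof -
  note sign = affine_sign_invariant[OF c no]
  have high: "high p c1 \<longleftrightarrow> high p c2" if "E \<subseteq> edges G" "p \<in> cycles E n a" for E p a
  proof -
    have h: "high p c \<longleftrightarrow> 0 < real_of_int (X p) + real_of_int (- L p) * c" for c
      by (auto simp: high_def algebra_simps)
    have "int n \<le> int slope_max" by (simp add: slope_max_def)
    then have "\<bar>- L p\<bar> \<le> int slope_max" using cycle_bounds(1)[OF that] by linarith
    from sign[OF this] show ?thesis unfolding h .
  qed
  have pts: "points h E u c1 = points h E u c2" and lns: "lines E u c1 = lines E u c2" if "E \<subseteq> edges G" for E u h
    unfolding points_def lines_def using high[OF that] by blast+
  have bt: "beats c1 P Q \<longleftrightarrow> beats c2 P Q"
    if P: "P \<in> points h E u c \<union> lines E u c" and Q: "Q \<in> points h' E' u' c' \<union> lines E' u' c'"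
      and E: "E \<subseteq> edges G" "E' \<subseteq> edges G" for P Q h h' E E' u u' c c'
  proof -
    obtain a b e a' b' e' where eq: "P = (a, b, e)" "Q = (a', b', e')" by (metis prod_cases3)
    have be: "beats c P Q \<longleftrightarrow> 0 < real_of_int (e' * a - e * a') + real_of_int (e' * b - e * b') * c" for c
      by (auto simp: beats_def eq algebra_simps)
    let ?A = "2 * (int n * (int n * int n))"
    have "\<bar>e' * b - e * b'\<bar> \<le> 2 * (?A * ?A)"
      by (intro abs_cross_le piece_bounds[OF E(1) P[unfolded eq(1)]] piece_bounds[OF E(2) Q[unfolded eq(2)]])
    also have "\<dots> = int (8 * n ^ 6)" by (simp add: eval_nat_numeral)
    also have "\<dots> \<le> int slope_max" by (simp add: slope_max_def)
    finally show ?thesis unfolding be by (rule sign)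
  qed
  obtain U P where U: "U \<subseteq> verts G" "v \<in> U"
    and P: "P \<in> points True (sub_edges U) v c1 \<union> lines (sub_edges U) v c1"
    and \<tau>: "\<And>u. u \<in> U \<Longrightarrow> \<exists>\<tau>. (\<forall>a\<in>owned0 G. (a, \<tau> a) \<in> edges G) \<and>
      (\<forall>Q \<in> points False (tree_edges \<tau>) u c1 \<union> lines (tree_edges \<tau>) u c1. beats c1 P Q)"
    using ex unfolding exceeds_def by blast
  have "\<exists>\<tau>. (\<forall>a\<in>owned0 G. (a, \<tau> a) \<in> edges G) \<and>
      (\<forall>Q \<in> points False (tree_edges \<tau>) u c2 \<union> lines (tree_edges \<tau>) u c2. beats c2 P Q)" if uU: "u \<in> U" for u
  proof -
    obtain \<tau> where t: "\<forall>a\<in>owned0 G. (a, \<tau> a) \<in> edges G"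
      "\<And>Q. Q \<in> points False (tree_edges \<tau>) u c1 \<union> lines (tree_edges \<tau>) u c1 \<Longrightarrow> beats c1 P Q"
      using \<tau>[OF uU] by blast
    have "beats c2 P Q" if "Q \<in> points False (tree_edges \<tau>) u c2 \<union> lines (tree_edges \<tau>) u c2" for Q
    proof -
      have Q: "Q \<in> points False (tree_edges \<tau>) u c1 \<union> lines (tree_edges \<tau>) u c1"
        using that unfolding pts[OF edges_subset(2)] lns[OF edges_subset(2)] .
      show ?thesis using t(2)[OF Q] bt[OF P Q edges_subset] by simp
    qed
    then show ?thesis using t(1) by blast
  qed
  moreover have "P \<in> points True (sub_edges U) v c2 \<union> lines (sub_edges U) v c2"
    using P unfolding pts[OF edges_subset(1)] lns[OF edges_subset(1)] .
  ultimately show ?thesis unfolding exceeds_def using U by blast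
qed

text \<open>Otherwise the value lies strictly between two neighbouring multiples of
  \<open>1 / fact slope_max\<close>, and \<open>exceeds\<close> would change from true to false
  inside an interval where it is constant.\<close>

lemma ASV_rational:
  assumes v: "v \<in> verts G"
  shows "\<exists>z :: int. ASV G v = ereal (real_of_int z / fact slope_max)"
proof -
  let ?D = "fact slope_max :: real"
  have D: "?D > 0" by simp
  obtain q where q: "ASV G v = ereal q"
    using ASV_bounded[OF v] by (cases "ASV G v") auto
  have "real_of_int \<lfloor>q * ?D\<rfloor> = q * ?D"
  proof (rule ccontr)
    assume ne: "real_of_int \<lfloor>q * ?D\<rfloor> \<noteq> q * ?D"
    define f where "f = real_of_int \<lfloor>q * ?D\<rfloor>"
    have f: "f < q * ?D" "q * ?D < f + 1" using ne unfolding f_def by linarith+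
    obtain x1 x2 where x: "f < x1" "x1 < q * ?D" "q * ?D < x2" "x2 < f + 1"
      using dense[OF f(1)] dense[OF f(2)] by blast
    define c1 c2 where "c1 = x1 / ?D" and "c2 = x2 / ?D"
    have c: "c1 * ?D = x1" "c2 * ?D = x2" using D by (simp_all add: c1_def c2_def)
    have cq: "c1 < q" "q < c2" using x D by (simp_all add: c1_def c2_def pos_divide_less_eq pos_less_divide_eq)
    have no: "\<not> (c1 * ?D \<le> real_of_int j \<and> real_of_int j \<le> c2 * ?D)" for j
    proof
      assume "c1 * ?D \<le> real_of_int j \<and> real_of_int j \<le> c2 * ?D"
      then have "real_of_int \<lfloor>q * ?D\<rfloor> < real_of_int j" "real_of_int j < real_of_int (\<lfloor>q * ?D\<rfloor> + 1)"
        using x unfolding c f_def by simp_all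
      then show False unfolding of_int_less_iff by simp
    qed
    obtain c' where "c1 < c'" "c' < q" using dense[OF cq(1)] by blast
    then have "exceeds v c1" using ASV_gt_imp_exceeds[OF v, of c' c1] q by simp
    then have "exceeds v c2" using cq by (intro exceeds_invariant[OF _ no]) simp_all
    then have "c2 \<le> q" using exceeds_imp_ASV_ge[OF v] q by fastforce
    then show False using cq by simp
  qed
  moreover have "q = q * ?D / ?D" using D by simp
  ultimately have "q = real_of_int \<lfloor>q * ?D\<rfloor> / ?D" by metis
  then show ?thesis using q by metis
qed

text \<open>The two arguments are \<open>a / b\<close> minus and plus
  \<open>1 / (2 * fact slope_max)\<close>, over the common denominator
  \<open>2 * b * fact slope_max\<close>.\<close>

definition separates :: "'v \<Rightarrow> int \<Rightarrow> nat \<Rightarrow> bool" where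
  "separates v a b \<longleftrightarrow>
     exceeds v (real_of_int (2 * a * fact slope_max - int b) / real (2 * b * fact slope_max)) \<and>
     \<not> exceeds v (real_of_int (2 * a * fact slope_max + int b) / real (2 * b * fact slope_max))"

lemma separates_iff:
  assumes v: "v \<in> verts G" and b: "b > 0" "b dvd fact slope_max"
  shows "separates v a b \<longleftrightarrow> ASV G v = ereal (real_of_int a / real b)"
proof -
  let ?D = "fact slope_max :: real"
  have D: "?D > 0" by simp
  define q \<delta> where "q = real_of_int a / real b" and "\<delta> = 1 / (2 * ?D)"
  have \<delta>: "\<delta> > 0" using D by (simp add: \<delta>_def)
  have eq: "real_of_int (2 * a * fact slope_max - int b) / real (2 * b * fact slope_max) = q - \<delta>"
    "real_of_int (2 * a * fact slope_max + int b) / real (2 * b * fact slope_max) = q + \<delta>"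
    using b D by (simp_all add: q_def \<delta>_def field_simps)
  obtain z where z: "ASV G v = ereal (real_of_int z / ?D)" using ASV_rational[OF v] by blast
  obtain k where k: "fact slope_max = b * k" using b(2) by (auto elim: dvdE)
  have Dk: "?D = real b * real k" using k by (metis of_nat_fact of_nat_mult)
  have "k \<noteq> 0" using k by (metis fact_nonzero mult_0_right)
  then have qk: "q = real_of_int (a * int k) / ?D" using b Dk by (simp add: q_def)
  show ?thesis
    unfolding separates_def eq
  proof
    assume L: "exceeds v (q - \<delta>) \<and> \<not> exceeds v (q + \<delta>)"
    then have lo: "q - \<delta> \<le> real_of_int z / ?D" using exceeds_imp_ASV_ge[OF v] z by fastforce
    have hi: "real_of_int z / ?D \<le> q + \<delta>"
    proof (rule ccontr)
      assume "\<not> real_of_int z / ?D \<le> q + \<delta>"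
      then have "q + \<delta> < real_of_int z / ?D" by simp
      from dense[OF this] obtain c' where "q + \<delta> < c'" "c' < real_of_int z / ?D" by blast
      then show False using ASV_gt_imp_exceeds[OF v, of c' "q + \<delta>"] z L by simp
    qed
    \<comment> \<open>Both numbers are multiples of \<open>1 / ?D\<close>, and \<delta> is half of
      this spacing, so they coincide.\<close>
    have "\<bar>real_of_int z / ?D - q\<bar> \<le> \<delta>" using lo hi by linarith
    then have "\<bar>real_of_int z / ?D - q\<bar> * ?D \<le> \<delta> * ?D" using D by (intro mult_right_mono) simp_all
    moreover have "\<bar>real_of_int z / ?D - q\<bar> * ?D = \<bar>(real_of_int z / ?D - q) * ?D\<bar>"
      by (simp only: abs_mult abs_of_pos[OF D])
    moreover have "(real_of_int z / ?D - q) * ?D = real_of_int (z - a * int k)"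
      unfolding qk left_diff_distrib using D by simp
    moreover have "\<delta> * ?D = 1 / 2" using D by (simp add: \<delta>_def)
    ultimately have "\<bar>real_of_int (z - a * int k)\<bar> \<le> 1 / 2" by simp
    then have "z = a * int k" by linarith
    then show "ASV G v = ereal (real_of_int a / real b)" using z qk by (simp add: q_def)
  next
    assume R: "ASV G v = ereal (real_of_int a / real b)"
    have "exceeds v (q - \<delta>)"
      using ASV_gt_imp_exceeds[OF v, of "q - \<delta> / 2" "q - \<delta>"] R \<delta> by (simp add: q_def)
    moreover have "\<not> exceeds v (q + \<delta>)"
      using exceeds_imp_ASV_ge[OF v, of "q + \<delta>"] R \<delta> by (auto simp: q_def)
    ultimately show "exceeds v (q - \<delta>) \<and> \<not> exceeds v (q + \<delta>)" by blast
  qed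
qed

lemma wmax_le: "wmax \<le> 2 * real n ^ 3"
proof -
  have "card (edges G) \<le> card (verts G) * card (verts G)"
    using card_mono[OF _ edges_in_verts] finite_verts by (simp add: card_cartesian_product)
  also have "\<dots> \<le> n * n" using card_le by (intro mult_mono) auto
  finally have E: "real (card (edges G)) \<le> real n * real n" by (metis of_nat_le_iff of_nat_mult)
  have "\<bar>real_of_int (weight0 G e)\<bar> + \<bar>real_of_int (weight1 G e)\<bar> \<le> 2 * real n" if "e \<in> edges G" for e
    using weight_le[OF that] by linarith
  then have "wmax \<le> real (card (edges G)) * (2 * real n)"
    unfolding wmax_def by (rule sum_bounded_above)
  also have "\<dots> \<le> (real n * real n) * (2 * real n)" using E by (intro mult_right_mono) auto
  finally show ?thesis by (simp add: power3_eq_cube)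
qed

text \<open>In lowest terms the denominator still divides \<open>fact slope_max\<close>; the
  numerator is bounded because the value is. This delimits the search.\<close>

lemma ASV_quotient:
  assumes v: "v \<in> verts G"
  shows "\<exists>a b. ASV G v = ereal (real_of_int a / real b) \<and> coprime a (int b) \<and> 0 < b \<and> b dvd fact slope_max \<and>
    b \<le> fact slope_max \<and> \<bar>a\<bar> \<le> int (2 * n ^ 3 * fact slope_max)"
proof -
  let ?D = "fact slope_max :: nat"
  obtain z where z: "ASV G v = ereal (real_of_int z / fact slope_max)" using ASV_rational[OF v] by blast
  obtain a b' where q: "quotient_of (Fract z (int ?D)) = (a, b')" by (cases "quotient_of (Fract z (int ?D))")
  have b': "b' > 0" "coprime a b'" using q quotient_of_denom_pos quotient_of_coprime by blast+
  have "Fract z (int ?D) = Fract a b'" using q by (metis quotient_of_div Fract_of_int_quotient)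
  then have e: "z * b' = a * int ?D" using b' by (simp add: eq_rat)
  define b where "b = nat b'"
  have b: "int b = b'" "b > 0" using b' by (simp_all add: b_def)
  have "b' dvd a * int ?D" using e by (metis dvd_triv_right)
  then have "b' dvd int ?D" using b'(2) by (metis coprime_commute coprime_dvd_mult_right_iff)
  then have d: "b dvd ?D" using b(1) by (metis int_dvd_int_iff)
  then have le: "b \<le> ?D" by (intro dvd_imp_le) auto
  have "real_of_int (z * b') = real_of_int (a * int ?D)" using e by simp
  then have "real_of_int z * real b = real_of_int a * fact slope_max"
    using b(1) by (metis of_int_mult of_int_of_nat_eq of_nat_fact)
  then have val: "real_of_int z / fact slope_max = real_of_int a / real b"
    using b(2) by (simp add: field_simps)
  have "\<bar>real_of_int a / real b\<bar> \<le> 2 * real n ^ 3"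
    using ASV_bounded[OF v] wmax_le z unfolding val by (simp add: abs_le_iff)
  then have "\<bar>real_of_int a\<bar> \<le> 2 * real n ^ 3 * real b" using b(2) by (simp add: abs_divide pos_divide_le_eq)
  also have "\<dots> \<le> 2 * real n ^ 3 * real ?D" using le by (intro mult_left_mono) (simp_all only: of_nat_le_iff, simp)
  finally have "real_of_int \<bar>a\<bar> \<le> real_of_int (int (2 * n ^ 3 * ?D))" by simp
  then have "\<bar>a\<bar> \<le> int (2 * n ^ 3 * ?D)" by (simp only: of_int_le_iff)
  then show ?thesis using z b b'(2) d le unfolding val by blast
qed

end

section \<open>The algorithm\<close>

lemma rec_power [rec_intros]: "total_recursive f \<Longrightarrow> total_recursive (\<lambda>n. f n ^ k)"
  by (induction k) (auto intro: rec_intros)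

lemma rec_int_comp: "rec_int f \<Longrightarrow> total_recursive g \<Longrightarrow> rec_int (\<lambda>n. f (g n))"
  unfolding rec_int_def using total_recursive.comp by meson

lemma rec_int_if [rec_intros]:
  assumes P: "decidable P" and "rec_int f" "rec_int g" shows "rec_int (\<lambda>n. if P n then f n else g n)"
proof -
  obtain p q p' q' where r: "total_recursive p" "total_recursive q" "total_recursive p'" "total_recursive q'"
    and f: "\<And>n. f n = int (p n) - int (q n)" "\<And>n. g n = int (p' n) - int (q' n)"
    using assms unfolding rec_int_def by metis
  show ?thesis
    by (rule rec_intI[OF rec_if[OF P r(1,3)] rec_if[OF P r(2,4)]]) (simp add: f)
qed

text \<open>Below, \<open>n\<close> codes an arena and a start vertex; a vertex is its position in the enumeration.
  In mode \<open>0\<close> the number \<open>t\<close> codes a set of vertices, in mode \<open>1\<close> a positional strategy of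
  Player 0.\<close>

definition adj :: "nat \<Rightarrow> nat \<Rightarrow> nat \<Rightarrow> nat" where
  "adj n a b = entry (psnd (entry (pfst n) a)) b"

definition owner :: "nat \<Rightarrow> nat \<Rightarrow> nat" where
  "owner n a = pfst (entry (pfst n) a)"

definition edge :: "nat \<Rightarrow> nat \<Rightarrow> nat \<Rightarrow> nat \<Rightarrow> nat \<Rightarrow> bool" where
  "edge m t n a b \<longleftrightarrow> adj n a b \<noteq> 0 \<and>
     (m = 0 \<and> entry t a \<noteq> 0 \<and> entry t b \<noteq> 0 \<or> m \<noteq> 0 \<and> (owner n a = 0 \<longrightarrow> b = entry t a))"

text \<open>The redundant-looking range fits the closure rule for bounded quantifiers, which is
  stated for \<open>\<le>\<close>.\<close>

definition is_walk :: "nat \<Rightarrow> nat \<Rightarrow> nat \<Rightarrow> nat \<Rightarrow> nat \<Rightarrow> bool" where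
  "is_walk m t n s l \<longleftrightarrow> (\<forall>i\<le>l. i < l \<longrightarrow> edge m t n (entry s i) (entry s (Suc i)))"

text \<open>Reachability needs at most as many steps as there are edges, and a graph with
  \<open>N\<close> vertices has at most \<open>N * N\<close>; as \<open>N \<le> n\<close>, this
  explains the bound \<open>n * n\<close>.\<close>

definition reaches :: "nat \<Rightarrow> nat \<Rightarrow> nat \<Rightarrow> nat \<Rightarrow> nat \<Rightarrow> bool" where
  "reaches m t n a b \<longleftrightarrow> (\<exists>s\<le>code_bound (n * n). \<exists>l\<le>n * n.
     entry s 0 = a \<and> entry s l = b \<and> is_walk m t n s l)"

definition is_linked :: "nat \<Rightarrow> nat \<Rightarrow> nat \<Rightarrow> nat \<Rightarrow> nat \<Rightarrow> nat \<Rightarrow> bool" where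
  "is_linked m t n u a b \<longleftrightarrow> reaches m t n u a \<and> reaches m t n a b \<and> reaches m t n b a"

definition is_cycle :: "nat \<Rightarrow> nat \<Rightarrow> nat \<Rightarrow> nat \<Rightarrow> nat \<Rightarrow> nat \<Rightarrow> bool" where
  "is_cycle m t n a s l \<longleftrightarrow> 0 < l \<and> l \<le> n * n \<and> entry s 0 = a \<and> entry s l = a \<and> is_walk m t n s l"

definition sum0 :: "nat \<Rightarrow> nat \<Rightarrow> nat \<Rightarrow> int" where
  "sum0 n s l = (\<Sum>i<l. int_decode (pfst (adj n (entry s i) (entry s (Suc i)) - 1)))"

definition sum1 :: "nat \<Rightarrow> nat \<Rightarrow> nat \<Rightarrow> int" where
  "sum1 n s l = (\<Sum>i<l. int_decode (psnd (adj n (entry s i) (entry s (Suc i)) - 1)))"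

text \<open>Thresholds are passed as \<open>p / q\<close> with positive \<open>q\<close>; all
  comparisons are made with denominators cleared.\<close>

definition is_high :: "nat \<Rightarrow> int \<Rightarrow> nat \<Rightarrow> nat \<Rightarrow> nat \<Rightarrow> bool" where
  "is_high n p q s l \<longleftrightarrow> p * int l < sum0 n s l * int q"

text \<open>A piece is coded by its kind, the base vertices of two cycles, and for each cycle its code and
  its length.\<close>

definition is_piece :: "nat \<Rightarrow> nat \<Rightarrow> nat \<Rightarrow> nat \<Rightarrow> nat \<Rightarrow> int \<Rightarrow> nat \<Rightarrow> nat \<Rightarrow> bool" where
  "is_piece h m t n u p q x \<longleftrightarrow>
     entry x 0 = 0 \<and> is_linked m t n u (entry x 1) (entry x 1) \<and>
       is_cycle m t n (entry x 1) (entry x 3) (entry x 4) \<and>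
       (h = 0 \<and> is_high n p q (entry x 3) (entry x 4) \<or> h \<noteq> 0 \<and> \<not> is_high n p q (entry x 3) (entry x 4)) \<or>
     entry x 0 \<noteq> 0 \<and> is_linked m t n u (entry x 1) (entry x 2) \<and>
       is_cycle m t n (entry x 1) (entry x 3) (entry x 4) \<and> is_cycle m t n (entry x 2) (entry x 5) (entry x 6) \<and>
       \<not> is_high n p q (entry x 3) (entry x 4) \<and> is_high n p q (entry x 5) (entry x 6)"

definition coef_a :: "nat \<Rightarrow> nat \<Rightarrow> int" where
  "coef_a n x = (if entry x 0 = 0 then sum1 n (entry x 3) (entry x 4)
     else sum0 n (entry x 5) (entry x 6) * sum1 n (entry x 3) (entry x 4)
       - sum0 n (entry x 3) (entry x 4) * sum1 n (entry x 5) (entry x 6))"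

definition coef_b :: "nat \<Rightarrow> nat \<Rightarrow> int" where
  "coef_b n x = (if entry x 0 = 0 then 0
     else int (entry x 4) * sum1 n (entry x 5) (entry x 6) - int (entry x 6) * sum1 n (entry x 3) (entry x 4))"

definition coef_e :: "nat \<Rightarrow> nat \<Rightarrow> int" where
  "coef_e n x = (if entry x 0 = 0 then int (entry x 4)
     else sum0 n (entry x 5) (entry x 6) * int (entry x 4) - sum0 n (entry x 3) (entry x 4) * int (entry x 6))"

definition is_beaten :: "nat \<Rightarrow> int \<Rightarrow> nat \<Rightarrow> nat \<Rightarrow> nat \<Rightarrow> bool" where
  "is_beaten n p q x y \<longleftrightarrow>
     coef_e n x * (coef_a n y * int q + coef_b n y * p) < coef_e n y * (coef_a n x * int q + coef_b n x * p)"

text \<open>A piece has seven entries: a kind, vertices, cycle codes and lengths. The sum bounds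
  each of them, and the \<open>7\<close> also covers their indices.\<close>

definition piece_bound :: "nat \<Rightarrow> nat" where
  "piece_bound n = code_bound (code_bound (n * n) + n * n + 7)"

text \<open>Having an outgoing edge is what marks \<open>a\<close> as a vertex; outside the arena
  the default \<open>0\<close> of \<open>entry\<close> would look like a vertex of Player 0.\<close>

definition is_legal :: "nat \<Rightarrow> nat \<Rightarrow> bool" where
  "is_legal n r \<longleftrightarrow> (\<forall>a\<le>n * n. (\<exists>b\<le>n * n. adj n a b \<noteq> 0) \<and> owner n a = 0 \<longrightarrow> adj n a (entry r a) \<noteq> 0)"

definition punishable :: "nat \<Rightarrow> int \<Rightarrow> nat \<Rightarrow> nat \<Rightarrow> nat \<Rightarrow> bool" where
  "punishable n p q x u \<longleftrightarrow> (\<exists>r\<le>code_bound (n * n). is_legal n r \<and>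
     (\<forall>y\<le>piece_bound n. is_piece 1 1 r n u p q y \<longrightarrow> is_beaten n p q x y))"

definition exceeds_code :: "nat \<Rightarrow> int \<Rightarrow> nat \<Rightarrow> bool" where
  "exceeds_code n p q \<longleftrightarrow> (\<exists>t\<le>code_bound (n * n). entry t (psnd n) \<noteq> 0 \<and>
     (\<exists>x\<le>piece_bound n. is_piece 0 0 t n (psnd n) p q x \<and>
       (\<forall>u\<le>n * n. (\<exists>b\<le>n * n. adj n u b \<noteq> 0) \<and> entry t u \<noteq> 0 \<longrightarrow> punishable n p q x u)))"

definition denom :: "nat \<Rightarrow> nat" where
  "denom n = fact (8 * (n * n) ^ 6 + n * n)"

text \<open>The quantifier over \<open>k\<close> tests for lowest terms, so that the number found is
  literally a \<open>rat_code\<close>. Quotients up to \<open>Suc (pfst r)\<close> suffice since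
  decoding \<open>m\<close> gives an absolute value of at most \<open>m + 1\<close>.\<close>

definition is_value :: "nat \<Rightarrow> nat \<Rightarrow> bool" where
  "is_value n r \<longleftrightarrow> 0 < psnd r \<and> (\<exists>k\<le>denom n. denom n = psnd r * k) \<and>
     (\<forall>k\<le>psnd r. (\<exists>i\<le>psnd r. psnd r = k * i) \<and>
        (\<exists>j\<le>Suc (pfst r). int_decode (pfst r) = int k * int j \<or> int_decode (pfst r) = 0 - int k * int j) \<longrightarrow> k = 1) \<and>
     exceeds_code n (2 * int_decode (pfst r) * int (denom n) - int (psnd r)) (2 * psnd r * denom n) \<and>
     \<not> exceeds_code n (2 * int_decode (pfst r) * int (denom n) + int (psnd r)) (2 * psnd r * denom n)"

text \<open>The inner factor \<open>2\<close> comes from the bound on the numerator, the outer one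
  from \<open>int_encode\<close>, which at most doubles an absolute value. \<open>Suc\<close> places
  the true value strictly below the point where the search gives up.\<close>

definition value_bound :: "nat \<Rightarrow> nat" where
  "value_bound n = Suc (prod_encode (2 * (2 * (n * n) ^ 3 * denom n), denom n))"

definition value_code :: "nat \<Rightarrow> nat" where
  "value_code n = (LEAST r. is_value n r \<or> value_bound n \<le> r)"

section \<open>The algorithm is recursive\<close>

lemma rec_adj [rec_intros]:
  "total_recursive n \<Longrightarrow> total_recursive a \<Longrightarrow> total_recursive b \<Longrightarrow> total_recursive (\<lambda>i. adj (n i) (a i) (b i))"
  unfolding adj_def by (intro rec_intros)

lemma rec_owner [rec_intros]:
  "total_recursive n \<Longrightarrow> total_recursive a \<Longrightarrow> total_recursive (\<lambda>i. owner (n i) (a i))"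
  unfolding owner_def by (intro rec_intros)

lemma dec_edge [rec_intros]:
  "total_recursive m \<Longrightarrow> total_recursive t \<Longrightarrow> total_recursive n \<Longrightarrow> total_recursive a \<Longrightarrow> total_recursive b \<Longrightarrow>
    decidable (\<lambda>i. edge (m i) (t i) (n i) (a i) (b i))"
  unfolding edge_def by (intro rec_intros)

lemma dec_is_walk [rec_intros]:
  assumes "total_recursive m" "total_recursive t" "total_recursive n" "total_recursive s" "total_recursive l"
  shows "decidable (\<lambda>i. is_walk (m i) (t i) (n i) (s i) (l i))"
  unfolding is_walk_def by (intro rec_intros assms[THEN total_recursive.comp])

lemma dec_reaches [rec_intros]:
  assumes "total_recursive m" "total_recursive t" "total_recursive n" "total_recursive a" "total_recursive b"
  shows "decidable (\<lambda>i. reaches (m i) (t i) (n i) (a i) (b i))"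
  unfolding reaches_def by (intro rec_intros assms[THEN total_recursive.comp])

lemma dec_is_linked [rec_intros]:
  "total_recursive m \<Longrightarrow> total_recursive t \<Longrightarrow> total_recursive n \<Longrightarrow> total_recursive u \<Longrightarrow> total_recursive a \<Longrightarrow>
    total_recursive b \<Longrightarrow> decidable (\<lambda>i. is_linked (m i) (t i) (n i) (u i) (a i) (b i))"
  unfolding is_linked_def by (intro rec_intros)

lemma dec_is_cycle [rec_intros]:
  "total_recursive m \<Longrightarrow> total_recursive t \<Longrightarrow> total_recursive n \<Longrightarrow> total_recursive a \<Longrightarrow> total_recursive s \<Longrightarrow>
    total_recursive l \<Longrightarrow> decidable (\<lambda>i. is_cycle (m i) (t i) (n i) (a i) (s i) (l i))"
  unfolding is_cycle_def by (intro rec_intros)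

lemma rec_sum0 [rec_intros]:
  assumes "total_recursive n" "total_recursive s" "total_recursive l"
  shows "rec_int (\<lambda>i. sum0 (n i) (s i) (l i))"
  unfolding sum0_def by (intro rec_intros assms[THEN total_recursive.comp])

lemma rec_sum1 [rec_intros]:
  assumes "total_recursive n" "total_recursive s" "total_recursive l"
  shows "rec_int (\<lambda>i. sum1 (n i) (s i) (l i))"
  unfolding sum1_def by (intro rec_intros assms[THEN total_recursive.comp])

lemma dec_is_high [rec_intros]:
  "total_recursive n \<Longrightarrow> rec_int p \<Longrightarrow> total_recursive q \<Longrightarrow> total_recursive s \<Longrightarrow> total_recursive l \<Longrightarrow>
    decidable (\<lambda>i. is_high (n i) (p i) (q i) (s i) (l i))"
  unfolding is_high_def by (intro rec_intros)

lemma dec_is_piece [rec_intros]: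
  "total_recursive h \<Longrightarrow> total_recursive m \<Longrightarrow> total_recursive t \<Longrightarrow> total_recursive n \<Longrightarrow> total_recursive u \<Longrightarrow>
    rec_int p \<Longrightarrow> total_recursive q \<Longrightarrow> total_recursive x \<Longrightarrow>
    decidable (\<lambda>i. is_piece (h i) (m i) (t i) (n i) (u i) (p i) (q i) (x i))"
  unfolding is_piece_def by (intro rec_intros)

lemma rec_coef_a [rec_intros]:
  "total_recursive n \<Longrightarrow> total_recursive x \<Longrightarrow> rec_int (\<lambda>i. coef_a (n i) (x i))"
  unfolding coef_a_def by (intro rec_intros)

lemma rec_coef_b [rec_intros]:
  "total_recursive n \<Longrightarrow> total_recursive x \<Longrightarrow> rec_int (\<lambda>i. coef_b (n i) (x i))"
  unfolding coef_b_def by (intro rec_intros)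

lemma rec_coef_e [rec_intros]:
  "total_recursive n \<Longrightarrow> total_recursive x \<Longrightarrow> rec_int (\<lambda>i. coef_e (n i) (x i))"
  unfolding coef_e_def by (intro rec_intros)

lemma dec_is_beaten [rec_intros]:
  "total_recursive n \<Longrightarrow> rec_int p \<Longrightarrow> total_recursive q \<Longrightarrow> total_recursive x \<Longrightarrow> total_recursive y \<Longrightarrow>
    decidable (\<lambda>i. is_beaten (n i) (p i) (q i) (x i) (y i))"
  unfolding is_beaten_def by (intro rec_intros)

lemma rec_piece_bound [rec_intros]:
  "total_recursive n \<Longrightarrow> total_recursive (\<lambda>i. piece_bound (n i))"
  unfolding piece_bound_def by (intro rec_intros)

lemma dec_is_legal [rec_intros]:
  assumes "total_recursive n" "total_recursive r"
  shows "decidable (\<lambda>i. is_legal (n i) (r i))"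
  unfolding is_legal_def by (intro rec_intros assms[THEN total_recursive.comp])

lemma dec_punishable [rec_intros]:
  assumes "total_recursive n" and p: "rec_int p" and "total_recursive q" "total_recursive x" "total_recursive u"
  shows "decidable (\<lambda>i. punishable (n i) (p i) (q i) (x i) (u i))"
  unfolding punishable_def by (intro rec_intros assms(1,3-)[THEN total_recursive.comp] rec_int_comp[OF p])

lemma dec_exceeds_code [rec_intros]:
  assumes "total_recursive n" and p: "rec_int p" and "total_recursive q"
  shows "decidable (\<lambda>i. exceeds_code (n i) (p i) (q i))"
  unfolding exceeds_code_def by (intro rec_intros assms(1,3)[THEN total_recursive.comp] rec_int_comp[OF p])

lemma rec_denom [rec_intros]: "total_recursive n \<Longrightarrow> total_recursive (\<lambda>i. denom (n i))"
  unfolding denom_def by (intro rec_intros)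

lemma rec_value_code: "total_recursive value_code"
proof -
  have "decidable (\<lambda>m. is_value (pfst m) (psnd m))"
    unfolding is_value_def by (intro rec_intros)
  moreover have "total_recursive (\<lambda>n. value_bound n)"
    unfolding value_bound_def by (intro rec_intros)
  ultimately have "total_recursive (\<lambda>n. LEAST r. is_value n r \<or> value_bound n \<le> r)"
    by (rule rec_search)
  then show ?thesis unfolding value_code_def[abs_def] .
qed

section \<open>Correctness of the algorithm\<close>

lemma abs_le_int_encode: "\<bar>z\<bar> \<le> int (int_encode z) + 1"
  and int_encode_le: "int (int_encode z) \<le> 2 * \<bar>z\<bar>"
  by (auto simp: int_encode_def sum_encode_def)

lemma entry_le: "entry (list_encode xs) k \<le> list_encode xs"
  using nth_less_list_encode[of k xs] by (auto simp: entry_list_encode)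

locale coded_game =
  fixes G :: "'v arena" and vs :: "'v list" and v0 :: nat
  assumes arena: "arena G" and distinct: "distinct vs" and set_vs: "set vs = verts G" and v0: "v0 < length vs"
begin

definition code :: nat where "code = prod_encode (arena_code vs G, v0)"

abbreviation N :: nat where "N \<equiv> length vs"

definition idx :: "'v \<Rightarrow> nat" where "idx x = (SOME a. a < N \<and> vs ! a = x)"

lemma idx: "x \<in> verts G \<Longrightarrow> idx x < N" "x \<in> verts G \<Longrightarrow> vs ! idx x = x"
proof -
  have "idx x < N \<and> vs ! idx x = x" if "x \<in> verts G"
    unfolding idx_def using that by (intro someI_ex[of "\<lambda>a. a < N \<and> vs ! a = x"]) (metis in_set_conv_nth set_vs)
  then show "x \<in> verts G \<Longrightarrow> idx x < N" "x \<in> verts G \<Longrightarrow> vs ! idx x = x" by blast+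
qed

lemma nth_in_verts: "a < N \<Longrightarrow> vs ! a \<in> verts G"
  using set_vs nth_mem by blast

lemma nth_inject: "a < N \<Longrightarrow> b < N \<Longrightarrow> vs ! a = vs ! b \<longleftrightarrow> a = b"
  using distinct nth_eq_iff_index_eq by blast

lemma idx_nth: "a < N \<Longrightarrow> idx (vs ! a) = a"
  using idx nth_in_verts nth_inject by metis

lemma vertex_entry:
  "entry (pfst code) a = (if a < N then prod_encode (if vs ! a \<in> owned0 G then 0 else 1,
     list_encode (map (\<lambda>u'. edge_code G (vs ! a, u')) vs)) else 0)"
  by (simp add: code_def arena_code_def entry_list_encode)

lemma adj_code: "adj code a b = (if a < N \<and> b < N then edge_code G (vs ! a, vs ! b) else 0)"
proof -
  have "entry 0 b = 0" using entry_list_encode[of "[]" b] by simp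
  then show ?thesis by (simp add: adj_def vertex_entry entry_list_encode)
qed

lemma adj_nonzero_iff: "adj code a b \<noteq> 0 \<longleftrightarrow> a < N \<and> b < N \<and> (vs ! a, vs ! b) \<in> edges G"
  by (auto simp: adj_code edge_code_def)

lemma owner_code: "a < N \<Longrightarrow> owner code a = 0 \<longleftrightarrow> vs ! a \<in> owned0 G"
  by (simp add: owner_def vertex_entry)

lemma N_le_code: "N \<le> code" and N_le: "N \<le> code * code" and code_pos: "0 < code * code" and code_le_square: "code \<le> code * code"
proof -
  have "N \<le> arena_code vs G"
    using length_le_list_encode[of "map (\<lambda>u. prod_encode (if u \<in> owned0 G then 0 else 1,
                 list_encode (map (\<lambda>u'. edge_code G (u, u')) vs))) vs"] by (simp add: arena_code_def)
  also have "\<dots> \<le> code" unfolding code_def by (rule le_prod_encode_1)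
  finally show N: "N \<le> code" .
  show "code \<le> code * code" by (rule le_square)
  then show "N \<le> code * code" using N by (rule order_trans[rotated])
  show "0 < code * code" using N v0 by (cases code) auto
qed

lemma weight_code_le:
  assumes "e \<in> edges G"
  shows "\<bar>weight0 G e\<bar> \<le> int (code * code)" "\<bar>weight1 G e\<bar> \<le> int (code * code)"
proof -
  obtain x y where e: "e = (x, y)" by (cases e)
  then have xy: "x \<in> verts G" "y \<in> verts G" using assms arena by (auto simp: arena_def)
  let ?a = "idx x" and ?b = "idx y"
  let ?row = "list_encode (map (\<lambda>u'. edge_code G (vs ! ?a, u')) vs)"
  \<comment> \<open>Whatever is stored inside a code is at most the code itself, so the code bounds
    all weights.\<close>
  have "adj code ?a ?b \<le> ?row"
    using idx(1)[OF xy(1)] entry_le by (simp add: adj_def vertex_entry)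
  also have "\<dots> \<le> entry (pfst code) ?a" using idx(1)[OF xy(1)] by (simp add: vertex_entry le_prod_encode_2)
  also have "\<dots> \<le> pfst code" unfolding code_def arena_code_def using entry_le by simp
  also have "\<dots> \<le> code" by (rule pfst_le)
  finally have "Suc (prod_encode (int_encode (weight0 G e), int_encode (weight1 G e))) \<le> code"
    using assms e idx[OF xy(1)] idx[OF xy(2)] by (simp add: adj_code edge_code_def)
  then have "int_encode (weight0 G e) < code" "int_encode (weight1 G e) < code"
    by (meson Suc_le_eq le_less_trans le_prod_encode_1, meson Suc_le_eq le_less_trans le_prod_encode_2)
  then have "\<bar>weight0 G e\<bar> \<le> int code" "\<bar>weight1 G e\<bar> \<le> int code"
    using abs_le_int_encode[of "weight0 G e"] abs_le_int_encode[of "weight1 G e"] by linarith+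
  then show "\<bar>weight0 G e\<bar> \<le> int (code * code)" "\<bar>weight1 G e\<bar> \<le> int (code * code)"
    using code_le_square by linarith+
qed

text \<open>The square is used as the bound because it also limits the walks searched by
  \<open>reaches\<close>.\<close>

sublocale bounded_game G "code * code"
proof
  show "arena G" by (rule arena)
  have "card (verts G) = N" using distinct_card[OF distinct] set_vs by simp
  then show "card (verts G) \<le> code * code" using N_le by simp
qed (use weight_code_le in blast)+

text \<open>Treats the two modes uniformly: walks, cycles and pieces are decoded once, for both the
  intended play and the punishment.\<close>

definition represents :: "nat \<Rightarrow> nat \<Rightarrow> ('v \<times> 'v) set \<Rightarrow> bool" where
  "represents m t E \<longleftrightarrow> E \<subseteq> edges G \<and> (\<forall>a b. edge m t code a b \<longleftrightarrow> a < N \<and> b < N \<and> (vs ! a, vs ! b) \<in> E)"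

section \<open>Walks and cycles\<close>

lemma walk_encode:
  assumes E: "represents m t E" and f: "f 0 \<in> verts G" "\<And>j. j < l \<Longrightarrow> (f j, f (Suc j)) \<in> E" and l: "l \<le> code * code"
  shows "\<exists>s\<le>code_bound (code * code). is_walk m t code s l \<and> (\<forall>j\<le>l. entry s j = idx (f j))"
proof -
  have fV: "f j \<in> verts G" if "j \<le> l" for j
  proof (cases j)
    case (Suc k)
    then show ?thesis using f(2)[of k] that E edges_in_verts by (auto simp: represents_def)
  qed (use f in simp)
  have "idx (f k) \<le> code * code" if "k \<le> l" for k
    using idx(1)[OF fV[OF that]] N_le by simp
  then have "(if k \<le> l then idx (f k) else 0) \<le> code * code" for k by simp
  then obtain s where s: "s \<le> code_bound (code * code)" "\<And>k. k \<le> code * code \<Longrightarrow> entry s k = (if k \<le> l then idx (f k) else 0)"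
    using code_boundE[of "code * code" "\<lambda>k. if k \<le> l then idx (f k) else 0"] by blast
  have e: "entry s j = idx (f j)" if "j \<le> l" for j using s(2)[of j] that l by simp
  have "edge m t code (entry s j) (entry s (Suc j))" if "j < l" for j
    using that f(2)[OF that] e[of j] e[of "Suc j"] idx[OF fV[of j]] idx[OF fV[of "Suc j"]] E
    by (simp add: represents_def)
  then have "is_walk m t code s l" by (simp add: is_walk_def)
  then show ?thesis using s(1) e by blast
qed

lemma walk_decode:
  assumes E: "represents m t E" and s: "is_walk m t code s l" "entry s 0 < N"
  shows "\<And>j. j < l \<Longrightarrow> (vs ! entry s j, vs ! entry s (Suc j)) \<in> E" "\<And>j. j \<le> l \<Longrightarrow> entry s j < N"
proof -
  have e: "entry s j < N \<and> entry s (Suc j) < N \<and> (vs ! entry s j, vs ! entry s (Suc j)) \<in> E" if "j < l" for j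
    using s(1) that E by (simp add: is_walk_def represents_def)
  show "\<And>j. j < l \<Longrightarrow> (vs ! entry s j, vs ! entry s (Suc j)) \<in> E" using e by blast
  show "entry s j < N" if "j \<le> l" for j
  proof (cases j)
    case (Suc k)
    then show ?thesis using e[of k] that by simp
  qed (use s in simp)
qed

lemma reaches_iff:
  assumes E: "represents m t E" and a: "a < N"
  shows "reaches m t code a b \<longleftrightarrow> b < N \<and> (vs ! a, vs ! b) \<in> E\<^sup>*"
proof
  assume "reaches m t code a b"
  then obtain s l where s: "entry s 0 = a" "entry s l = b" "is_walk m t code s l" by (auto simp: reaches_def)
  have "(vs ! a, vs ! b) \<in> E ^^ l"
    unfolding relpow_fun_conv using walk_decode(1)[OF E s(3)] s a
    by (intro exI[of _ "\<lambda>j. vs ! entry s j"]) simp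
  then show "b < N \<and> (vs ! a, vs ! b) \<in> E\<^sup>*"
    using walk_decode(2)[OF E s(3), of l] s a relpow_imp_rtrancl by auto
next
  assume b: "b < N \<and> (vs ! a, vs ! b) \<in> E\<^sup>*"
  have sub: "E \<subseteq> edges G" using E by (simp add: represents_def)
  then have "finite E" using finite_edges finite_subset by blast
  then obtain l where l: "l \<le> card E" "(vs ! a, vs ! b) \<in> E ^^ l"
    using b rtrancl_finite_eq_relpow by blast
  have "card E \<le> card (verts G \<times> verts G)"
    using sub edges_in_verts finite_verts by (intro card_mono) auto
  also have "\<dots> \<le> N * N" using distinct_card[OF distinct] set_vs by (simp add: card_cartesian_product)
  also have "N * N \<le> code * code" using N_le_code by (intro mult_le_mono)
  finally have lc: "l \<le> code * code" using l(1) by simp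
  obtain f where f: "f 0 = vs ! a" "f l = vs ! b" "\<And>j. j < l \<Longrightarrow> (f j, f (Suc j)) \<in> E"
    using l(2) unfolding relpow_fun_conv by blast
  have "f 0 \<in> verts G" using f(1) nth_in_verts[OF a] by simp
  from walk_encode[OF E this f(3) lc] obtain s where
    "s \<le> code_bound (code * code)" "is_walk m t code s l" "\<forall>j\<le>l. entry s j = idx (f j)" by blast
  moreover from this have "entry s 0 = a" "entry s l = b" using f a b by (simp_all add: idx_nth)
  ultimately show "reaches m t code a b" unfolding reaches_def using lc by blast
qed

lemma is_linked_iff:
  assumes E: "represents m t E" and u: "u < N"
  shows "is_linked m t code u a b \<longleftrightarrow> a < N \<and> b < N \<and> linked E (vs ! u) (vs ! a) (vs ! b)"
  unfolding is_linked_def linked_def reaches_iff[OF E u] using reaches_iff[OF E] by blast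

lemma edge_weights:
  assumes "a < N" "b < N" "(vs ! a, vs ! b) \<in> edges G"
  shows "int_decode (pfst (adj code a b - 1)) = weight0 G (vs ! a, vs ! b)"
    "int_decode (psnd (adj code a b - 1)) = weight1 G (vs ! a, vs ! b)"
  using assms by (simp_all add: adj_code edge_code_def)

lemma sums_code:
  assumes "\<And>j. j < length p \<Longrightarrow> entry s j < N \<and> entry s (Suc j) < N \<and> p ! j = (vs ! entry s j, vs ! entry s (Suc j))"
    and "set p \<subseteq> edges G"
  shows "sum0 code s (length p) = X p" "sum1 code s (length p) = Y p"
proof -
  have e: "(vs ! entry s j, vs ! entry s (Suc j)) \<in> edges G" if "j < length p" for j
    using assms that by (metis nth_mem subsetD)
  show "sum0 code s (length p) = X p"
    unfolding sum0_def sum_list_sum_nth using assms(1) e edge_weights(1)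
    by (simp add: atLeast0LessThan)
  show "sum1 code s (length p) = Y p"
    unfolding sum1_def sum_list_sum_nth using assms(1) e edge_weights(2)
    by (simp add: atLeast0LessThan)
qed

lemma cycle_encode:
  assumes E: "represents m t E" and a: "a < N" and p: "p \<in> cycles E (code * code) (vs ! a)"
  shows "\<exists>s\<le>code_bound (code * code). is_cycle m t code a s (length p) \<and>
    sum0 code s (length p) = X p \<and> sum1 code s (length p) = Y p"
proof -
  have w: "walk E (vs ! a) p (vs ! a)" "p \<noteq> []" "length p \<le> code * code" using p by (auto simp: cycles_def)
  define f where "f = (\<lambda>j. if j < length p then fst (p ! j) else vs ! a)"
  have pj: "p ! j \<in> E" "p ! j = (f j, f (Suc j))" if "j < length p" for j
    using walk_nth[OF w(1) that] that by (auto simp: f_def prod_eq_iff)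
  have f0: "f 0 = vs ! a" using w by (cases p) (auto simp: f_def)
  have fl: "f (length p) = vs ! a" by (simp add: f_def)
  have "f 0 \<in> verts G" using f0 nth_in_verts[OF a] by simp
  moreover have "(f j, f (Suc j)) \<in> E" if "j < length p" for j using pj[OF that] by simp
  ultimately obtain s where s: "s \<le> code_bound (code * code)" "is_walk m t code s (length p)"
    "\<forall>j\<le>length p. entry s j = idx (f j)"
    using walk_encode[OF E _ _ w(3)] by blast
  have s0: "entry s 0 = a" "entry s (length p) = a" using s(3) f0 fl idx_nth[OF a] by simp_all
  have fV: "f j \<in> verts G" if "j \<le> length p" for j
  proof (cases "j < length p")
    case True
    then show ?thesis using pj[OF True] E edges_in_verts by (auto simp: represents_def)
  next
    case False
    then show ?thesis using nth_in_verts[OF a] by (simp add: f_def)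
  qed
  have "entry s j < N \<and> entry s (Suc j) < N \<and> p ! j = (vs ! entry s j, vs ! entry s (Suc j))" if "j < length p" for j
    using s(3) idx[OF fV[of j]] idx[OF fV[of "Suc j"]] that pj(2)[OF that] by simp
  moreover have "set p \<subseteq> edges G" using walk_subset[OF w(1)] E by (auto simp: represents_def)
  ultimately have "sum0 code s (length p) = X p" "sum1 code s (length p) = Y p" using sums_code by blast+
  then show ?thesis using s s0 w by (auto simp: is_cycle_def)
qed

lemma cycle_decode:
  assumes E: "represents m t E" and c: "is_cycle m t code a s l"
  shows "\<exists>p\<in>cycles E (code * code) (vs ! a). length p = l \<and> X p = sum0 code s l \<and> Y p = sum1 code s l"
proof -
  have s: "0 < l" "l \<le> code * code" "entry s 0 = a" "entry s l = a" "is_walk m t code s l"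
    using c by (auto simp: is_cycle_def)
  have "edge m t code (entry s 0) (entry s (Suc 0))" using s(1,5) by (simp add: is_walk_def)
  then have "entry s 0 < N" using E by (simp add: represents_def)
  note d = walk_decode[OF E s(5) this]
  define p where "p = map (\<lambda>j. (vs ! entry s j, vs ! entry s (Suc j))) [0..<l]"
  have len: "length p = l" by (simp add: p_def)
  have "walk E (vs ! entry s 0) (map (\<lambda>j. (vs ! entry s j, vs ! entry s (Suc j))) [0..<k]) (vs ! entry s k)"
    if "k \<le> l" for k
    using that by (induction k) (auto simp: walk_append d(1))
  then have w: "walk E (vs ! a) p (vs ! a)" using s(3,4) unfolding p_def by force
  then have cyc: "p \<in> cycles E (code * code) (vs ! a)" using s(1,2) len by (auto simp: cycles_def)
  have "set p \<subseteq> edges G" using walk_subset[OF w] E by (auto simp: represents_def)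
  moreover have "entry s j < N \<and> entry s (Suc j) < N \<and> p ! j = (vs ! entry s j, vs ! entry s (Suc j))" if "j < length p" for j
    using that d(2) len by (simp add: p_def)
  ultimately have "sum0 code s (length p) = X p" "sum1 code s (length p) = Y p" using sums_code by blast+
  then show ?thesis using cyc len by auto
qed

lemma is_high_iff:
  assumes "q > 0" "length c = l" "X c = sum0 code s l"
  shows "is_high code p q s l \<longleftrightarrow> high c (real_of_int p / real q)"
proof -
  have "is_high code p q s l \<longleftrightarrow> real_of_int (p * int l) < real_of_int (sum0 code s l * int q)"
    unfolding is_high_def of_int_less_iff ..
  also have "\<dots> \<longleftrightarrow> high c (real_of_int p / real q)"
    unfolding high_def assms(2,3) using assms(1) by (simp add: pos_divide_less_eq)
  finally show ?thesis .
qed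

section \<open>Pieces and the condition \<open>exceeds\<close>\<close>

definition coefs :: "nat \<Rightarrow> int \<times> int \<times> int" where
  "coefs x = (coef_a code x, coef_b code x, coef_e code x)"

lemma piece_decode:
  assumes E: "represents m t E" and u: "u < N" and q: "q > 0" and x: "is_piece h m t code u p q x"
  shows "coefs x \<in> points (h = 0) E (vs ! u) (real_of_int p / real q) \<union> lines E (vs ! u) (real_of_int p / real q)"
proof (cases "entry x 0 = 0")
  case True
  then have l: "linked E (vs ! u) (vs ! entry x 1) (vs ! entry x 1)"
    and c: "is_cycle m t code (entry x 1) (entry x 3) (entry x 4)"
    and h: "is_high code p q (entry x 3) (entry x 4) = (h = 0)"
    using x is_linked_iff[OF E u] by (auto simp: is_piece_def)
  obtain r where r: "r \<in> cycles E (code * code) (vs ! entry x 1)" "length r = entry x 4"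
    "X r = sum0 code (entry x 3) (entry x 4)" "Y r = sum1 code (entry x 3) (entry x 4)"
    using cycle_decode[OF E c] by blast
  have "coefs x = point r" using True r by (simp add: coefs_def coef_a_def coef_b_def coef_e_def point_def)
  then show ?thesis using l r h is_high_iff[OF q r(2,3)] unfolding points_def by blast
next
  case False
  then have l: "linked E (vs ! u) (vs ! entry x 1) (vs ! entry x 2)"
    and c: "is_cycle m t code (entry x 1) (entry x 3) (entry x 4)" "is_cycle m t code (entry x 2) (entry x 5) (entry x 6)"
    and h: "\<not> is_high code p q (entry x 3) (entry x 4)" "is_high code p q (entry x 5) (entry x 6)"
    using x is_linked_iff[OF E u] by (auto simp: is_piece_def)
  obtain r where r: "r \<in> cycles E (code * code) (vs ! entry x 1)" "length r = entry x 4"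
    "X r = sum0 code (entry x 3) (entry x 4)" "Y r = sum1 code (entry x 3) (entry x 4)"
    using cycle_decode[OF E c(1)] by blast
  obtain r' where r': "r' \<in> cycles E (code * code) (vs ! entry x 2)" "length r' = entry x 6"
    "X r' = sum0 code (entry x 5) (entry x 6)" "Y r' = sum1 code (entry x 5) (entry x 6)"
    using cycle_decode[OF E c(2)] by blast
  have "coefs x = line r r'" using False r r' by (simp add: coefs_def coef_a_def coef_b_def coef_e_def line_def)
  then show ?thesis using l r r' h is_high_iff[OF q r(2,3)] is_high_iff[OF q r'(2,3)] unfolding lines_def by blast
qed

lemma pack_piece:
  assumes "k0 \<le> 1" "a < N" "b < N" "s \<le> code_bound (code * code)" "l \<le> code * code"
    "s' \<le> code_bound (code * code)" "l' \<le> code * code"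
  shows "\<exists>x\<le>piece_bound code. entry x 0 = k0 \<and> entry x 1 = a \<and> entry x 2 = b \<and> entry x 3 = s \<and>
    entry x 4 = l \<and> entry x 5 = s' \<and> entry x 6 = l'"
proof -
  let ?B = "code_bound (code * code) + code * code + 7"
  let ?xs = "[k0, a, b, s, l, s', l']"
  have "(if k < length ?xs then ?xs ! k else 0) \<le> ?B" for k
  proof (cases "k < length ?xs")
    case True
    then have "?xs ! k \<in> set ?xs" by (rule nth_mem)
    moreover have "z \<le> ?B" if "z \<in> set ?xs" for z using that assms N_le by auto
    ultimately show ?thesis using True by presburger
  qed simp
  then obtain x where x: "x \<le> code_bound ?B" "\<And>k. k \<le> ?B \<Longrightarrow> entry x k = (if k < length ?xs then ?xs ! k else 0)"
    using code_boundE[of ?B "\<lambda>k. if k < length ?xs then ?xs ! k else 0"] by blast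
  have "entry x k = ?xs ! k" if "k < 7" for k using x(2)[of k] that by simp
  from this[of 0] this[of 1] this[of 2] this[of 3] this[of 4] this[of 5] this[of 6]
  show ?thesis using x(1) by (intro exI[of _ x]) (simp add: piece_bound_def)
qed

lemma piece_encode:
  assumes E: "represents m t E" and u: "u < N" and q: "q > 0"
    and P: "P \<in> points (h = 0) E (vs ! u) (real_of_int p / real q) \<union> lines E (vs ! u) (real_of_int p / real q)"
  shows "\<exists>x\<le>piece_bound code. is_piece h m t code u p q x \<and> coefs x = P"
proof -
  have base: "a \<in> verts G" if r: "r \<in> cycles E (code * code) a" for r a
  proof -
    obtain e r' where e: "r = e # r'" using r by (cases r) (simp_all add: cycles_def)
    then have "e \<in> E" "fst e = a" using r by (simp_all add: cycles_def)
    then show ?thesis using E edges_in_verts by (auto simp: represents_def)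
  qed
  show ?thesis
  proof (cases "P \<in> points (h = 0) E (vs ! u) (real_of_int p / real q)")
    case True
    then obtain r a' where r: "P = point r" "linked E (vs ! u) a' a'" "r \<in> cycles E (code * code) a'"
      "high r (real_of_int p / real q) = (h = 0)" unfolding points_def by blast
    obtain a where a: "a < N" "vs ! a = a'" using idx[OF base[OF r(3)]] by blast
    obtain s where s: "s \<le> code_bound (code * code)" "is_cycle m t code a s (length r)"
      "sum0 code s (length r) = X r" "sum1 code s (length r) = Y r"
      using cycle_encode[OF E a(1)] r(3) a(2) by blast
    have len: "length r \<le> code * code" using s(2) by (simp add: is_cycle_def)
    obtain x where x: "x \<le> piece_bound code" "entry x 0 = 0" "entry x 1 = a" "entry x 3 = s" "entry x 4 = length r"
      using pack_piece[OF _ a(1) a(1) s(1) len s(1) len, of 0] by auto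
    have "is_linked m t code u a a" using is_linked_iff[OF E u] a r(2) by simp
    moreover have "is_high code p q s (length r) = (h = 0)" using is_high_iff[OF q refl s(3)[symmetric]] r(4) by simp
    ultimately have "is_piece h m t code u p q x" using x s(2) by (auto simp: is_piece_def)
    moreover have "coefs x = P" using x s r(1) by (simp add: coefs_def coef_a_def coef_b_def coef_e_def point_def)
    ultimately show ?thesis using x(1) by blast
  next
    case False
    then obtain r r' a' b' where r: "P = line r r'" "linked E (vs ! u) a' b'" "r \<in> cycles E (code * code) a'"
      "r' \<in> cycles E (code * code) b'" "\<not> high r (real_of_int p / real q)" "high r' (real_of_int p / real q)"
      using P unfolding lines_def by blast
    obtain a where a: "a < N" "vs ! a = a'" using idx[OF base[OF r(3)]] by blast
    obtain b where b: "b < N" "vs ! b = b'" using idx[OF base[OF r(4)]] by blast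
    obtain s where s: "s \<le> code_bound (code * code)" "is_cycle m t code a s (length r)"
      "sum0 code s (length r) = X r" "sum1 code s (length r) = Y r"
      using cycle_encode[OF E a(1)] r(3) a(2) by blast
    obtain s' where s': "s' \<le> code_bound (code * code)" "is_cycle m t code b s' (length r')"
      "sum0 code s' (length r') = X r'" "sum1 code s' (length r') = Y r'"
      using cycle_encode[OF E b(1)] r(4) b(2) by blast
    have len: "length r \<le> code * code" "length r' \<le> code * code" using s(2) s'(2) by (simp_all add: is_cycle_def)
    obtain x where x: "x \<le> piece_bound code" "entry x 0 = 1" "entry x 1 = a" "entry x 2 = b"
      "entry x 3 = s" "entry x 4 = length r" "entry x 5 = s'" "entry x 6 = length r'"
      using pack_piece[OF _ a(1) b(1) s(1) len(1) s'(1) len(2), of 1] by auto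
    have "is_linked m t code u a b" using is_linked_iff[OF E u] a b r(2) by simp
    moreover have "\<not> is_high code p q s (length r)" "is_high code p q s' (length r')"
      using is_high_iff[OF q refl s(3)[symmetric]] is_high_iff[OF q refl s'(3)[symmetric]] r(5,6) by simp_all
    ultimately have "is_piece h m t code u p q x" using x s(2) s'(2) by (auto simp: is_piece_def)
    moreover have "coefs x = P" using x s s' r(1) by (simp add: coefs_def coef_a_def coef_b_def coef_e_def line_def)
    ultimately show ?thesis using x(1) by blast
  qed
qed

lemma is_beaten_iff:
  assumes q: "q > 0" shows "is_beaten code p q x y \<longleftrightarrow> beats (real_of_int p / real q) (coefs x) (coefs y)"
proof -
  let ?c = "real_of_int p / real q"
  let ?f = "\<lambda>z. real_of_int (coef_a code z) + real_of_int (coef_b code z) * ?c"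
  have f: "real_of_int (coef_a code z * int q + coef_b code z * p) = real q * ?f z" for z
    using q by (simp add: field_simps)
  have "is_beaten code p q x y \<longleftrightarrow>
    real_of_int (coef_e code x * (coef_a code y * int q + coef_b code y * p))
      < real_of_int (coef_e code y * (coef_a code x * int q + coef_b code x * p))"
    unfolding is_beaten_def of_int_less_iff ..
  also have "\<dots> \<longleftrightarrow> real q * (real_of_int (coef_e code x) * ?f y) < real q * (real_of_int (coef_e code y) * ?f x)"
    unfolding of_int_mult[of "coef_e code _"] f by (simp only: mult.left_commute)
  also have "\<dots> \<longleftrightarrow> beats ?c (coefs x) (coefs y)"
    unfolding beats_def coefs_def using q by simp
  finally show ?thesis .
qed

lemma represents_sub_edges:
  assumes "U = {vs ! a | a. a < N \<and> entry t a \<noteq> 0}"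
  shows "represents 0 t (sub_edges U)"
proof -
  have "vs ! a \<in> U \<longleftrightarrow> entry t a \<noteq> 0" if "a < N" for a
    using that nth_inject assms by auto
  then show ?thesis
    using edges_subset(1)
    by (auto simp: represents_def edge_def adj_nonzero_iff sub_edges_def simp del: neq0_conv)
qed

lemma represents_tree_edges:
  assumes "\<And>a. a < N \<Longrightarrow> vs ! a \<in> owned0 G \<Longrightarrow> entry r a < N \<and> vs ! entry r a = \<tau> (vs ! a)"
  shows "represents 1 r (tree_edges \<tau>)"
proof -
  have "b = entry r a \<longleftrightarrow> vs ! b = \<tau> (vs ! a)" if "a < N" "b < N" "vs ! a \<in> owned0 G" for a b
    using assms[OF that(1,3)] nth_inject that(2) by metis
  then have "edge 1 r code a b \<longleftrightarrow> a < N \<and> b < N \<and> (vs ! a, vs ! b) \<in> tree_edges \<tau>" for a b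
    unfolding edge_def adj_nonzero_iff using owner_code[of a]
    by (cases "a < N \<and> b < N") (auto simp: tree_edges_def pos_edges_def simp del: neq0_conv)
  then show ?thesis using edges_subset(2) by (simp add: represents_def)
qed

text \<open>Every vertex of an arena has a successor, so this decidable test recognises the
  vertices.\<close>

lemma has_edge_iff: "(\<exists>b\<le>code * code. adj code a b \<noteq> 0) \<longleftrightarrow> a < N"
proof
  assume a: "a < N"
  then obtain y where y: "(vs ! a, y) \<in> edges G" using successor nth_in_verts by blast
  then have "y \<in> verts G" using edges_in_verts by auto
  from idx[OF this] have "adj code a (idx y) \<noteq> 0" "idx y \<le> code * code"
    using y a N_le by (simp_all add: adj_nonzero_iff del: neq0_conv)
  then show "\<exists>b\<le>code * code. adj code a b \<noteq> 0" by blast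
qed (use adj_nonzero_iff in blast)

lemma owned0_in_verts: "x \<in> owned0 G \<Longrightarrow> x \<in> verts G"
  using arena by (auto simp: arena_def)

lemma is_legal_iff: "is_legal code r \<longleftrightarrow>
  (\<forall>a<N. vs ! a \<in> owned0 G \<longrightarrow> entry r a < N \<and> (vs ! a, vs ! entry r a) \<in> edges G)"
proof
  assume L: "is_legal code r"
  show "\<forall>a<N. vs ! a \<in> owned0 G \<longrightarrow> entry r a < N \<and> (vs ! a, vs ! entry r a) \<in> edges G"
  proof (intro allI impI)
    fix a assume a: "a < N" "vs ! a \<in> owned0 G"
    then have "adj code a (entry r a) \<noteq> 0"
      using L N_le unfolding is_legal_def has_edge_iff by (simp add: owner_code)
    then show "entry r a < N \<and> (vs ! a, vs ! entry r a) \<in> edges G" unfolding adj_nonzero_iff by blast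
  qed
next
  assume R: "\<forall>a<N. vs ! a \<in> owned0 G \<longrightarrow> entry r a < N \<and> (vs ! a, vs ! entry r a) \<in> edges G"
  show "is_legal code r"
    unfolding is_legal_def has_edge_iff
  proof (intro allI impI)
    fix a assume "a \<le> code * code" "a < N \<and> owner code a = 0"
    then show "adj code a (entry r a) \<noteq> 0" unfolding adj_nonzero_iff using R owner_code by blast
  qed
qed

lemma punishable_iff:
  assumes u: "u < N" and q: "q > 0"
  shows "punishable code p q x u \<longleftrightarrow> (\<exists>\<tau>. (\<forall>a\<in>owned0 G. (a, \<tau> a) \<in> edges G) \<and>
    (\<forall>Q \<in> points False (tree_edges \<tau>) (vs ! u) (real_of_int p / real q) \<union> lines (tree_edges \<tau>) (vs ! u) (real_of_int p / real q).
       beats (real_of_int p / real q) (coefs x) Q))" (is "_ \<longleftrightarrow> (\<exists>\<tau>. ?L \<tau> \<and> (\<forall>Q\<in>?S \<tau>. _ Q))")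
proof
  assume "punishable code p q x u"
  then obtain r where r: "is_legal code r"
    and beat: "\<And>y. y \<le> piece_bound code \<Longrightarrow> is_piece 1 1 r code u p q y \<Longrightarrow> is_beaten code p q x y"
    unfolding punishable_def by blast
  define \<tau> where "\<tau> = (\<lambda>x. vs ! entry r (idx x))"
  have legal: "(a, \<tau> a) \<in> edges G" if "a \<in> owned0 G" for a
    using r[unfolded is_legal_iff, rule_format, of "idx a"] that idx[OF owned0_in_verts[OF that]]
    by (simp add: \<tau>_def)
  have rep: "represents 1 r (tree_edges \<tau>)"
    using r by (intro represents_tree_edges) (simp add: is_legal_iff \<tau>_def idx_nth)
  have "beats (real_of_int p / real q) (coefs x) Q" if "Q \<in> ?S \<tau>" for Q
  proof -
    have "\<exists>y\<le>piece_bound code. is_piece 1 1 r code u p q y \<and> coefs y = Q"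
      using that by (intro piece_encode[OF rep u q]) simp
    then show ?thesis using beat is_beaten_iff[OF q] by blast
  qed
  then show "\<exists>\<tau>. ?L \<tau> \<and> (\<forall>Q\<in>?S \<tau>. beats (real_of_int p / real q) (coefs x) Q)" using legal by blast
next
  assume "\<exists>\<tau>. ?L \<tau> \<and> (\<forall>Q\<in>?S \<tau>. beats (real_of_int p / real q) (coefs x) Q)"
  then obtain \<tau> where legal: "\<And>a. a \<in> owned0 G \<Longrightarrow> (a, \<tau> a) \<in> edges G"
    and beat: "\<And>Q. Q \<in> ?S \<tau> \<Longrightarrow> beats (real_of_int p / real q) (coefs x) Q" by blast
  \<comment> \<open>Only the choices at vertices of Player 0 matter; the default \<open>0\<close>
    keeps all other entries below the bound.\<close>
  let ?f = "\<lambda>k. if k < N \<and> vs ! k \<in> owned0 G then idx (\<tau> (vs ! k)) else 0"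
  have tv: "\<tau> a \<in> verts G" if "a \<in> owned0 G" for a using legal[OF that] edges_in_verts by auto
  have "?f k \<le> code * code" for k using idx(1)[OF tv] N_le by (auto intro: order_trans[OF less_imp_le])
  then obtain r where r: "r \<le> code_bound (code * code)" "\<And>k. k \<le> code * code \<Longrightarrow> entry r k = ?f k"
    using code_boundE[of "code * code" ?f] by blast
  have e: "entry r a = idx (\<tau> (vs ! a))" if "a < N" "vs ! a \<in> owned0 G" for a
    using r(2)[of a] that N_le by simp
  have rep: "represents 1 r (tree_edges \<tau>)"
    by (rule represents_tree_edges) (simp add: e idx[OF tv])
  have "is_legal code r"
    unfolding is_legal_iff using e idx[OF tv] legal by simp
  moreover have "is_beaten code p q x y" if "is_piece 1 1 r code u p q y" for y
    using piece_decode[OF rep u q that] beat is_beaten_iff[OF q] by simp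
  ultimately show "punishable code p q x u" unfolding punishable_def using r(1) by blast
qed

lemma exceeds_code_iff:
  assumes q: "q > 0"
  shows "exceeds_code code p q \<longleftrightarrow> exceeds (vs ! v0) (real_of_int p / real q)"
proof -
  let ?c = "real_of_int p / real q"
  have v: "psnd code = v0" by (simp add: code_def)
  show ?thesis
  proof
    assume "exceeds_code code p q"
    then obtain t x where t: "entry t v0 \<noteq> 0" and x: "is_piece 0 0 t code v0 p q x"
      and pun: "\<And>u. u \<le> code * code \<Longrightarrow> u < N \<Longrightarrow> entry t u \<noteq> 0 \<Longrightarrow> punishable code p q x u"
      unfolding exceeds_code_def has_edge_iff v by blast
    define U where "U = {vs ! a | a. a < N \<and> entry t a \<noteq> 0}"
    have P: "coefs x \<in> points True (sub_edges U) (vs ! v0) ?c \<union> lines (sub_edges U) (vs ! v0) ?c"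
      using piece_decode[OF represents_sub_edges[OF U_def] v0 q x] by simp
    have "U \<subseteq> verts G" "vs ! v0 \<in> U" using nth_in_verts t v0 by (auto simp: U_def)
    moreover have "\<exists>\<tau>. (\<forall>a\<in>owned0 G. (a, \<tau> a) \<in> edges G) \<and>
        (\<forall>Q \<in> points False (tree_edges \<tau>) u ?c \<union> lines (tree_edges \<tau>) u ?c. beats ?c (coefs x) Q)" if uU: "u \<in> U" for u
    proof -
      obtain a where a: "u = vs ! a" "a < N" "entry t a \<noteq> 0" using uU unfolding U_def by blast
      then have "punishable code p q x a" using pun N_le by simp
      then show ?thesis using punishable_iff[OF a(2) q] a(1) by simp
    qed
    ultimately show "exceeds (vs ! v0) ?c"
      unfolding exceeds_def using P by (intro exI[of _ U] conjI bexI[of _ "coefs x"] ballI)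
  next
    assume "exceeds (vs ! v0) ?c"
    then obtain U P where U: "U \<subseteq> verts G" "vs ! v0 \<in> U"
      and P: "P \<in> points True (sub_edges U) (vs ! v0) ?c \<union> lines (sub_edges U) (vs ! v0) ?c"
      and pun: "\<And>u. u \<in> U \<Longrightarrow> \<exists>\<tau>. (\<forall>a\<in>owned0 G. (a, \<tau> a) \<in> edges G) \<and>
        (\<forall>Q \<in> points False (tree_edges \<tau>) u ?c \<union> lines (tree_edges \<tau>) u ?c. beats ?c P Q)"
      unfolding exceeds_def by blast
    let ?f = "\<lambda>k. if k < N \<and> vs ! k \<in> U then 1 else 0 :: nat"
    have "?f k \<le> code * code" for k using code_pos by auto
    then obtain t where t: "t \<le> code_bound (code * code)" "\<And>k. k \<le> code * code \<Longrightarrow> entry t k = ?f k"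
      using code_boundE[of "code * code" ?f] by blast
    have e: "entry t a \<noteq> 0 \<longleftrightarrow> vs ! a \<in> U" if "a < N" for a using t(2)[of a] that N_le by simp
    have "U = {vs ! a | a. a < N \<and> entry t a \<noteq> 0}"
    proof (intro equalityI subsetI)
      fix y assume "y \<in> U"
      then have "idx y < N \<and> vs ! idx y = y" using U(1) idx by blast
      then show "y \<in> {vs ! a | a. a < N \<and> entry t a \<noteq> 0}" using e \<open>y \<in> U\<close> by (metis (mono_tags, lifting) mem_Collect_eq)
    qed (use e in auto)
    then have rep: "represents 0 t (sub_edges U)" by (rule represents_sub_edges)
    have "\<exists>x\<le>piece_bound code. is_piece 0 0 t code v0 p q x \<and> coefs x = P"
      using P by (intro piece_encode[OF rep v0 q]) simp
    then obtain x where x: "x \<le> piece_bound code" "is_piece 0 0 t code v0 p q x" "coefs x = P" by blast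
    have "punishable code p q x u" if "u < N" "entry t u \<noteq> 0" for u
      using pun[of "vs ! u"] e that punishable_iff[OF that(1) q] x(3) by simp
    then show "exceeds_code code p q"
      unfolding exceeds_code_def has_edge_iff v using t(1) x(1,2) e[OF v0] U(2) by blast
  qed
qed

section \<open>Recognising and finding the value\<close>

lemma denom_code: "denom code = fact slope_max"
  by (simp add: denom_def slope_max_def)

lemma coprime_bounded_iff:
  fixes b z :: nat
  assumes b: "b > 0" and a: "\<bar>a\<bar> \<le> int z"
  shows "(\<forall>k\<le>b. (\<exists>i\<le>b. b = k * i) \<and> (\<exists>j\<le>z. a = int k * int j \<or> a = 0 - int k * int j) \<longrightarrow> k = 1) \<longleftrightarrow> coprime a (int b)"
proof -
  have 1: "(\<exists>i\<le>b. b = k * i) \<longleftrightarrow> k dvd b" for k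
  proof
    assume "k dvd b"
    then obtain i where "b = k * i" by (auto elim: dvdE)
    moreover from this have "i \<le> b" using b by (cases k) auto
    ultimately show "\<exists>i\<le>b. b = k * i" by blast
  qed auto
  have 2: "(\<exists>j\<le>z. a = int k * int j \<or> a = 0 - int k * int j) \<longleftrightarrow> int k dvd a" if "k > 0" for k
  proof
    assume "int k dvd a"
    then obtain j where j: "a = int k * j" by (auto elim: dvdE)
    have "\<bar>j\<bar> \<le> int k * \<bar>j\<bar>" using that by (intro mult_le_cancel_right1[THEN iffD2]) auto
    then have "nat \<bar>j\<bar> \<le> z" using a j by (simp add: abs_mult)
    moreover have "a = int k * int (nat \<bar>j\<bar>) \<or> a = 0 - int k * int (nat \<bar>j\<bar>)"
      using j by (cases "j \<ge> 0") auto
    ultimately show "\<exists>j\<le>z. a = int k * int j \<or> a = 0 - int k * int j" by blast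
  qed auto
  have "(\<forall>k\<le>b. (\<exists>i\<le>b. b = k * i) \<and> (\<exists>j\<le>z. a = int k * int j \<or> a = 0 - int k * int j) \<longrightarrow> k = 1)
    \<longleftrightarrow> (\<forall>k. k dvd b \<longrightarrow> int k dvd a \<longrightarrow> k = 1)"
    unfolding 1 using 2 b by (metis dvd_imp_le dvd_pos_nat)
  also have "\<dots> \<longleftrightarrow> coprime a (int b)"
  proof
    assume L: "\<forall>k. k dvd b \<longrightarrow> int k dvd a \<longrightarrow> k = 1"
    show "coprime a (int b)"
    proof (rule coprimeI)
      fix c assume "c dvd a" "c dvd int b"
      then have "nat \<bar>c\<bar> dvd b" "int (nat \<bar>c\<bar>) dvd a" by (auto simp: nat_abs_dvd_iff)
      then have "nat \<bar>c\<bar> = 1" using L by blast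
      then show "is_unit c" by auto
    qed
  next
    assume cop: "coprime a (int b)"
    show "\<forall>k. k dvd b \<longrightarrow> int k dvd a \<longrightarrow> k = 1"
    proof (intro allI impI)
      fix k assume "k dvd b" "int k dvd a"
      then have "int k dvd 1" using coprime_common_divisor[OF cop, of "int k"] by simp
      then show "k = 1" by simp
    qed
  qed
  finally show ?thesis .
qed

lemma is_value_iff:
  "is_value code r \<longleftrightarrow> 0 < psnd r \<and> psnd r dvd fact slope_max \<and> coprime (int_decode (pfst r)) (int (psnd r)) \<and>
     ASV G (vs ! v0) = ereal (real_of_int (int_decode (pfst r)) / real (psnd r))"
proof (cases "0 < psnd r \<and> psnd r dvd fact slope_max")
  case True
  then have b: "psnd r > 0" "psnd r dvd fact slope_max" by blast+
  let ?a = "int_decode (pfst r)"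
  have k: "\<exists>k\<le>fact slope_max. fact slope_max = psnd r * k"
  proof -
    obtain k where k: "fact slope_max = psnd r * k" using b(2) by (auto elim: dvdE)
    then show ?thesis using b(1) by (intro exI[of _ k]) simp
  qed
  have q: "2 * psnd r * fact slope_max > 0" using b by simp
  have "\<bar>?a\<bar> \<le> int (Suc (pfst r))" using abs_le_int_encode[of ?a] by simp
  note cop = coprime_bounded_iff[OF b(1) this]
  have sep: "exceeds_code code (2 * ?a * int (fact slope_max) - int (psnd r)) (2 * psnd r * fact slope_max) \<and>
     \<not> exceeds_code code (2 * ?a * int (fact slope_max) + int (psnd r)) (2 * psnd r * fact slope_max)
     \<longleftrightarrow> ASV G (vs ! v0) = ereal (real_of_int ?a / real (psnd r))"
    unfolding exceeds_code_iff[OF q] separates_iff[OF nth_in_verts[OF v0] b, symmetric] separates_def by simp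
  show ?thesis unfolding is_value_def denom_code cop sep using b k by blast
next
  case False
  then show ?thesis unfolding is_value_def denom_code by (metis dvd_triv_left)
qed

lemma value_code_correct: "\<exists>q. value_code code = rat_code q \<and> ASV G (vs ! v0) = ereal (real_of_rat q)"
proof -
  obtain a b where ab: "ASV G (vs ! v0) = ereal (real_of_int a / real b)" "coprime a (int b)" "0 < b" "b dvd fact slope_max"
    "b \<le> fact slope_max" "\<bar>a\<bar> \<le> int (2 * (code * code) ^ 3 * fact slope_max)"
    using ASV_quotient[OF nth_in_verts[OF v0]] by blast
  define r0 where "r0 = prod_encode (int_encode a, b)"
  have "is_value code r0" unfolding is_value_iff using ab by (simp add: r0_def)
  moreover have "int_encode a \<le> 2 * (2 * (code * code) ^ 3 * fact slope_max)"
    using int_encode_le[of a] ab(6) by linarith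
  \<comment> \<open>Strictly below the search limit, so the least number found satisfies
    \<open>is_value\<close> and not merely the stopping condition.\<close>
  then have "r0 < value_bound code"
    unfolding r0_def value_bound_def denom_code less_Suc_eq_le using ab(5) by (intro prod_encode_mono)
  moreover from calculation have P: "is_value code r0 \<or> value_bound code \<le> r0" by blast
  have "value_code code \<le> r0" unfolding value_code_def by (rule Least_le) (rule P)
  moreover have "is_value code (value_code code) \<or> value_bound code \<le> value_code code"
    unfolding value_code_def by (rule LeastI[of "\<lambda>r. is_value code r \<or> value_bound code \<le> r", OF P])
  ultimately have val: "is_value code (value_code code)" by linarith
  let ?a = "int_decode (pfst (value_code code))" and ?b = "psnd (value_code code)"
  \<comment> \<open>Lowest terms were tested, so \<open>quotient_of\<close> returns the pair
    unchanged.\<close>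
  have q: "quotient_of (Fract ?a (int ?b)) = (?a, int ?b)"
    using val unfolding is_value_iff by (simp add: quotient_of_Fract normalize_stable)
  have "rat_code (Fract ?a (int ?b)) = value_code code" by (simp add: rat_code_def q)
  moreover have "real_of_rat (Fract ?a (int ?b)) = real_of_int ?a / real ?b"
    using val unfolding is_value_iff by (simp add: of_rat_rat)
  ultimately show ?thesis using val unfolding is_value_iff by metis
qed

end

theorem theorem12:
  "\<exists>construct extract. total_recursive construct \<and> total_recursive extract \<and>
     (\<forall>(G :: 'v arena) vs i.
        arena G \<and> distinct vs \<and> set vs = verts G \<and> i < length vs \<longrightarrow>
        (\<exists>\<rho>. construct (prod_encode (arena_code vs G, i)) = fm_code \<rho> \<and>
             free_vars \<rho> = {0} \<and>
             (\<forall>e z. sat (e(0 := z)) \<rho> \<longleftrightarrow> ASV G (vs ! i) = ereal z) \<and>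
             (\<exists>q. extract (fm_code \<rho>) = rat_code q \<and>
                  ASV G (vs ! i) = ereal (of_rat q))))"
proof -
  \<comment> \<open>The code of \<open>FEq (Var 0) (Const q)\<close>: tag \<open>1\<close> of
    \<open>FEq\<close>, the code of \<open>Var 0\<close>, then tag \<open>1\<close> of
    \<open>Const\<close> with the code of the value. Reading the value back is a projection.\<close>
  define build where "build = (\<lambda>n. prod_encode (1, prod_encode (prod_encode (0, 0), prod_encode (1, value_code n))))"
  define read where "read = (\<lambda>n. psnd (psnd (psnd n)))"
  have "total_recursive build"
    unfolding build_def by (intro rec_intros rec_value_code)
  moreover have "total_recursive read"
    unfolding read_def by (intro rec_intros)
  moreover have "\<exists>\<rho>. build (prod_encode (arena_code vs G, i)) = fm_code \<rho> \<and> free_vars \<rho> = {0} \<and>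
      (\<forall>e z. sat (e(0 := z)) \<rho> \<longleftrightarrow> ASV G (vs ! i) = ereal z) \<and>
      (\<exists>q. read (fm_code \<rho>) = rat_code q \<and> ASV G (vs ! i) = ereal (of_rat q))"
    if "arena G \<and> distinct vs \<and> set vs = verts G \<and> i < length vs" for G :: "'v arena" and vs i
  proof -
    interpret coded_game G vs i by unfold_locales (use that in auto)
    obtain q where q: "value_code code = rat_code q" "ASV G (vs ! i) = ereal (real_of_rat q)"
      using value_code_correct by blast
    show ?thesis
    proof (intro exI[of _ "FEq (Var 0) (Const q)"] conjI)
      show "build (prod_encode (arena_code vs G, i)) = fm_code (FEq (Var 0) (Const q))"
        using q(1) by (simp add: build_def code_def)
      show "\<exists>q'. read (fm_code (FEq (Var 0) (Const q))) = rat_code q' \<and> ASV G (vs ! i) = ereal (of_rat q')"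
        using q(2) by (intro exI[of _ q]) (simp add: read_def)
    qed (use q(2) in auto)
  qed
  ultimately show ?thesis by blast
qed

end
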